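(* (1) There is an algorithm with the following guarantee. Its input is an $n\times n$ matrix $W$ with entries in $\mathbb{R}\cup\{-\infty\}$ together with a list of assignments $M_{k_0},M_{k_1},\ldots,M_{k_s}$, $0=k_0<k_1<\cdots<k_s\le n$, where $M_{k_j}$ is a $k_j$-assignment for $W$ and the list contains a $k$-assignment for every $k$ such that $a_kx^{n-k}$ is an essential term of the full characteristic maxpolynomial $\bar{\chi}_W(x)=\bigoplus_{k=0}^na_kx^{n-k}$ (and possibly assignments for some of the semi-essential terms). Its output consists of an $m$-assignment for every $m$ such that $a_mx^{n-m}$ is a semi-essential term of $\bar{\chi}_W(x)$ and $m\notin\{k_0,\ldots,k_s\}$. Its running time is $\mathcal{O}(n^2)$. More precisely, given a $k$-assignment and a $(k+d)$-assignment, $d>1$, that refer to adjacent terms of $\bar{\chi}_W(x)$, a sequence of $(k+i)$-assignments, $i=1,\ldots,d-1$, can be computed in time $\mathcal{O}(dn)$. (2) Consequently, there is an algorithm that, given an $n\times n$ matrix $W$ with entries in $\mathbb{R}\cup\{-\infty\}$, computes $k$-assignments for all $k=1,\ldots,n$ in total time $\mathcal{O}(n^3)$.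
   Context: Weighted graph and assignments. $K_{n,n}$ is the complete bipartite graph on $U=\{u_1,\ldots,u_n\}$, $V=\{v_1,\ldots,v_n\}$, where the edge $(u_i,v_j)$ has weight $w_{ij}$, the $(i,j)$ entry of $W$. A matching of cardinality $k$ is a set of $k$ pairwise non-adjacent edges; its weight is the sum of the weights of its edges (equal to $-\infty$ if some edge has weight $-\infty$). A $k$-assignment is a matching of cardinality $k$ whose weight is maximal among all matchings of cardinality $k$; the $0$-assignment is the empty matching. Data representation. Each assignment is represented so that every matched vertex $u_i$ points to its matched vertex $v_j$ and vice versa. Running time counts elementary operations, where arithmetic operations and comparisons on the weights have unit cost. Max-plus algebra. Over $\mathbb{R}\cup\{-\infty\}$, put $a\oplus b=\max(a,b)$ and let the product be ordinary addition. A maxpolynomial $p(x)=\bigoplus_{k=0}^n a_kx^k$ (formal expression, $a_k\in\mathbb{R}\cup\{-\infty\}$) induces the function $\hat p(x)=\max_{0\le k\le n}(a_k+kx)$ (ordinary arithmetic). Full characteristic maxpolynomial. $\bar{\chi}_W(x)=\bigoplus_{k=0}^n a_kx^{n-k}$ is the max-plus permanent $\bigoplus_{\sigma\in S_n}\prod_{i=1}^n (x\oplus w_{i\sigma(i)})$ (max-plus product and sum), expanded formally. Thus $a_0=0$, and for $1\le k\le n$ the coefficient $a_k$ equals the weight of a $k$-assignment. A $k$-assignment is said to refer to the term $a_kx^{n-k}$. Types of terms. Let $p(x)=\bigoplus_k a_kx^k$ be a maxpolynomial. The term $a_kx^k$ is essential if $\hat p(x)=a_k+kx$ for all $x$ in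 some interval of $\mathbb{R}$ (of positive length); it is inessential if $a_k+kx<\hat p(x)$ for all $x$; otherwise, i.e. when $\hat p(x)=a_k+kx$ at exactly one point $x$, it is semi-essential. Two terms $a_ix^i$ and $a_jx^j$ of $p(x)$ are adjacent if there exists $c\in\mathbb{R}$ such that $a_i+ic=a_j+jc=\hat p(c)$. *)

theory Defs
  imports
    "HOL-Library.Extended_Real"
    "HOL-Computational_Algebra.Polynomial"
    "HOL-Combinatorics.Permutations"
begin

section \<open>The max-plus semiring and maxpolynomials\<close>

typedef maxplus = "{x :: ereal. x \<noteq> \<infinity>}"
  morphisms val Abs_maxplus
  by (rule exI[of _ 0]) simp

setup_lifting type_definition_maxplus

instantiation maxplus :: comm_semiring_1
begin

lift_definition zero_maxplus :: maxplus is "- \<infinity> :: ereal" by simp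
lift_definition one_maxplus :: maxplus is "0 :: ereal" by simp
lift_definition plus_maxplus :: "maxplus \<Rightarrow> maxplus \<Rightarrow> maxplus" is "max :: ereal \<Rightarrow> _"
  by (simp add: max_def)
lift_definition times_maxplus :: "maxplus \<Rightarrow> maxplus \<Rightarrow> maxplus" is "(+) :: ereal \<Rightarrow> _"
  by simp

instance
proof
  fix a b c :: maxplus
  show "a * b * c = a * (b * c)" by transfer (simp add: add.assoc)
  show "a * b = b * a" by transfer (simp add: add.commute)
  show "1 * a = a" by transfer simp
  show "a + b + c = a + (b + c)" by transfer (simp add: max.assoc)
  show "a + b = b + a" by transfer (simp add: max.commute)
  show "0 + a = a" by transfer (simp add: max_def)
  show "0 * a = 0" by transfer simp
  show "a * 0 = 0" by transfer simp
  show "(a + b) * c = a * c + b * c"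
    by transfer (metis add_right_mono linear max.absorb1 max.absorb2)
  show "(0 :: maxplus) \<noteq> 1" by transfer simp
qed

end

text \<open>
  A formal maxpolynomial is a polynomial over \<^typ>\<open>maxplus\<close>; absent coefficients are
  the semiring zero, i.e. minus infinity. The induced function \<open>max_fun p\<close> and the types of
  terms are phrased in ordinary arithmetic through \<^const>\<open>val\<close>.
\<close>

definition term_val :: "maxplus poly \<Rightarrow> nat \<Rightarrow> real \<Rightarrow> ereal" where
  "term_val p k x = val (coeff p k) + ereal (real k * x)"

definition max_fun :: "maxplus poly \<Rightarrow> real \<Rightarrow> ereal" where
  "max_fun p x = Max ((\<lambda>k. term_val p k x) ` {..degree p})"

definition essential :: "maxplus poly \<Rightarrow> nat \<Rightarrow> bool" where
  "essential p k \<longleftrightarrow> (\<exists>a b. a < b \<and> (\<forall>x\<in>{a<..<b}. max_fun p x = term_val p k x))"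

definition inessential :: "maxplus poly \<Rightarrow> nat \<Rightarrow> bool" where
  "inessential p k \<longleftrightarrow> (\<forall>x. term_val p k x < max_fun p x)"

definition semi_essential :: "maxplus poly \<Rightarrow> nat \<Rightarrow> bool" where
  "semi_essential p k \<longleftrightarrow> \<not> essential p k \<and> \<not> inessential p k"

definition adjacent_terms :: "maxplus poly \<Rightarrow> nat \<Rightarrow> nat \<Rightarrow> bool" where
  "adjacent_terms p i j \<longleftrightarrow>
    (\<exists>c. term_val p i c = max_fun p c \<and> term_val p j c = max_fun p c)"

text \<open>Matrices are indexed by \<open>1, \<dots>, n\<close>; values outside this range play no role.\<close>

definition permanent :: "nat \<Rightarrow> (nat \<Rightarrow> nat \<Rightarrow> 'a) \<Rightarrow> 'a :: comm_semiring_1" where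
  "permanent n A = (\<Sum>\<sigma> | \<sigma> permutes {1..n}. \<Prod>i\<in>{1..n}. A i (\<sigma> i))"

definition full_char_maxpoly :: "nat \<Rightarrow> (nat \<Rightarrow> nat \<Rightarrow> maxplus) \<Rightarrow> maxplus poly" where
  "full_char_maxpoly n W = permanent n (\<lambda>i j. monom 1 1 + [:W i j:])"


section \<open>Assignments\<close>

text \<open>The pair \<open>(i, j)\<close> is the edge between \<open>u\<^sub>i\<close> and \<open>v\<^sub>j\<close> of the complete bipartite graph.\<close>

type_synonym edges = "(nat \<times> nat) set"

definition matching :: "nat \<Rightarrow> edges \<Rightarrow> bool" where
  "matching n M \<longleftrightarrow> M \<subseteq> {1..n} \<times> {1..n} \<and>
    (\<forall>e\<in>M. \<forall>f\<in>M. e \<noteq> f \<longrightarrow> fst e \<noteq> fst f \<and> snd e \<noteq> snd f)"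

definition weight :: "(nat \<Rightarrow> nat \<Rightarrow> maxplus) \<Rightarrow> edges \<Rightarrow> ereal" where
  "weight W M = (\<Sum>(i, j)\<in>M. val (W i j))"

definition is_assignment :: "nat \<Rightarrow> (nat \<Rightarrow> nat \<Rightarrow> maxplus) \<Rightarrow> nat \<Rightarrow> edges \<Rightarrow> bool" where
  "is_assignment n W k M \<longleftrightarrow> matching n M \<and> card M = k \<and>
    (\<forall>M'. matching n M' \<and> card M' = k \<longrightarrow> weight W M' \<le> weight W M)"


section \<open>Model of computation\<close>

text \<open>
  A uniform-cost random access machine with structured control flow. It has
  named two-dimensional arrays of natural numbers (indices, pointers) and, in a separate
  name space, of weights. Scalars are the cells \<open>[0][0]\<close>. Every operator, constant, memory access,
  test, assignment and control step has cost 1. Programs may contain only integer weight constants and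
  minus infinity, so no information can be hidden in real constants, and there is no
  rounding and no conversion of weights to natural numbers. Arithmetic on weights is that of
  \<^typ>\<open>ereal\<close>, which makes all operations total (subtracting minus infinity or dividing by 0 may
  give plus infinity). Subtraction of natural numbers truncates at 0.
\<close>

type_synonym name = string

record state =
  nmem :: "name \<Rightarrow> nat \<Rightarrow> nat \<Rightarrow> nat"
  wmem :: "name \<Rightarrow> nat \<Rightarrow> nat \<Rightarrow> ereal"

datatype nexp =
    NConst nat
  | NRead name nexp nexp
  | NPlus nexp nexp
  | NMinus nexp nexp

datatype wexp =
    WInt int
  | WNegInf
  | WRead name nexp nexp
  | WPlus wexp wexp
  | WMinus wexp wexp
  | WTimes wexp wexp
  | WDivide wexp wexp

datatype bexp =
    NLess nexp nexp
  | NEq nexp nexp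
  | WLess wexp wexp
  | WEq wexp wexp
  | BNot bexp
  | BAnd bexp bexp

datatype prog =
    Skip
  | NWrite name nexp nexp nexp
  | WWrite name nexp nexp wexp
  | Seq prog prog
  | Cond bexp prog prog
  | While bexp prog

primrec nval :: "nexp \<Rightarrow> state \<Rightarrow> nat" where
  "nval (NConst c) s = c"
| "nval (NRead x a b) s = nmem s x (nval a s) (nval b s)"
| "nval (NPlus a b) s = nval a s + nval b s"
| "nval (NMinus a b) s = nval a s - nval b s"

primrec ncost :: "nexp \<Rightarrow> nat" where
  "ncost (NConst c) = 1"
| "ncost (NRead x a b) = 1 + ncost a + ncost b"
| "ncost (NPlus a b) = 1 + ncost a + ncost b"
| "ncost (NMinus a b) = 1 + ncost a + ncost b"

primrec wval :: "wexp \<Rightarrow> state \<Rightarrow> ereal" where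
  "wval (WInt c) s = ereal (of_int c)"
| "wval WNegInf s = - \<infinity>"
| "wval (WRead x a b) s = wmem s x (nval a s) (nval b s)"
| "wval (WPlus a b) s = wval a s + wval b s"
| "wval (WMinus a b) s = wval a s - wval b s"
| "wval (WTimes a b) s = wval a s * wval b s"
| "wval (WDivide a b) s = wval a s / wval b s"

primrec wcost :: "wexp \<Rightarrow> nat" where
  "wcost (WInt c) = 1"
| "wcost WNegInf = 1"
| "wcost (WRead x a b) = 1 + ncost a + ncost b"
| "wcost (WPlus a b) = 1 + wcost a + wcost b"
| "wcost (WMinus a b) = 1 + wcost a + wcost b"
| "wcost (WTimes a b) = 1 + wcost a + wcost b"
| "wcost (WDivide a b) = 1 + wcost a + wcost b"

primrec bval :: "bexp \<Rightarrow> state \<Rightarrow> bool" where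
  "bval (NLess a b) s \<longleftrightarrow> nval a s < nval b s"
| "bval (NEq a b) s \<longleftrightarrow> nval a s = nval b s"
| "bval (WLess a b) s \<longleftrightarrow> wval a s < wval b s"
| "bval (WEq a b) s \<longleftrightarrow> wval a s = wval b s"
| "bval (BNot a) s \<longleftrightarrow> \<not> bval a s"
| "bval (BAnd a b) s \<longleftrightarrow> bval a s \<and> bval b s"

primrec bcost :: "bexp \<Rightarrow> nat" where
  "bcost (NLess a b) = 1 + ncost a + ncost b"
| "bcost (NEq a b) = 1 + ncost a + ncost b"
| "bcost (WLess a b) = 1 + wcost a + wcost b"
| "bcost (WEq a b) = 1 + wcost a + wcost b"
| "bcost (BNot a) = 1 + bcost a"
| "bcost (BAnd a b) = 1 + bcost a + bcost b"

definition upd :: "(name \<Rightarrow> nat \<Rightarrow> nat \<Rightarrow> 'a) \<Rightarrow> name \<Rightarrow> nat \<Rightarrow> nat \<Rightarrow> 'a \<Rightarrow> name \<Rightarrow> nat \<Rightarrow> nat \<Rightarrow> 'a"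
  where "upd m x i j v = m(x := (m x)(i := (m x i)(j := v)))"

text \<open>\<open>exec P s t s'\<close>: program \<open>P\<close> started in \<open>s\<close> halts in \<open>s'\<close> after exactly \<open>t\<close> elementary operations.\<close>

inductive exec :: "prog \<Rightarrow> state \<Rightarrow> nat \<Rightarrow> state \<Rightarrow> bool" where
  exec_Skip: "exec Skip s 1 s"
| exec_NWrite: "exec (NWrite x a b e) s (1 + ncost a + ncost b + ncost e)
    (s\<lparr>nmem := upd (nmem s) x (nval a s) (nval b s) (nval e s)\<rparr>)"
| exec_WWrite: "exec (WWrite x a b e) s (1 + ncost a + ncost b + wcost e)
    (s\<lparr>wmem := upd (wmem s) x (nval a s) (nval b s) (wval e s)\<rparr>)"
| exec_Seq: "exec P s t s' \<Longrightarrow> exec Q s' t' s'' \<Longrightarrow> exec (Seq P Q) s (t + t') s''"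
| exec_CondTrue: "bval b s \<Longrightarrow> exec P s t s' \<Longrightarrow> exec (Cond b P Q) s (1 + bcost b + t) s'"
| exec_CondFalse: "\<not> bval b s \<Longrightarrow> exec Q s t s' \<Longrightarrow> exec (Cond b P Q) s (1 + bcost b + t) s'"
| exec_WhileFalse: "\<not> bval b s \<Longrightarrow> exec (While b P) s (1 + bcost b) s"
| exec_WhileTrue: "bval b s \<Longrightarrow> exec P s t s' \<Longrightarrow> exec (While b P) s' t' s'' \<Longrightarrow>
    exec (While b P) s (1 + bcost b + t + t') s''"

inductive_cases exec_SkipE: "exec Skip s t s'"
inductive_cases exec_NWriteE: "exec (NWrite x a b e) s t s'"
inductive_cases exec_WWriteE: "exec (WWrite x a b e) s t s'"
inductive_cases exec_SeqE: "exec (Seq P Q) s t s'"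
inductive_cases exec_CondE: "exec (Cond b P Q) s t s'"
inductive_cases exec_WhileE: "exec (While b P) s t s'"

lemma exec_deterministic:
  "exec P s t s' \<Longrightarrow> exec P s t2 s2 \<Longrightarrow> t2 = t \<and> s2 = s'"
proof (induction arbitrary: t2 s2 rule: exec.induct)
  case (exec_Skip s)
  then show ?case by (rule exec_SkipE) simp
next
  case (exec_NWrite x a b e s)
  then show ?case by (rule exec_NWriteE) simp
next
  case (exec_WWrite x a b e s)
  then show ?case by (rule exec_WWriteE) simp
next
  case (exec_Seq P s t s' Q t' s'')
  from exec_Seq.prems show ?case by (rule exec_SeqE) (use exec_Seq.IH in metis)
next
  case (exec_CondTrue b s P t s' Q)
  from exec_CondTrue.prems show ?case
    by (rule exec_CondE) (use exec_CondTrue.hyps in \<open>auto dest: exec_CondTrue.IH\<close>)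
next
  case (exec_CondFalse b s Q t s' P)
  from exec_CondFalse.prems show ?case
    by (rule exec_CondE) (use exec_CondFalse.hyps in \<open>auto dest: exec_CondFalse.IH\<close>)
next
  case (exec_WhileFalse b s P)
  from exec_WhileFalse.prems show ?case by (rule exec_WhileE) (use exec_WhileFalse.hyps in auto)
next
  case (exec_WhileTrue b s P t s' t' s'')
  from exec_WhileTrue.prems show ?case
    by (rule exec_WhileE) (use exec_WhileTrue.hyps in \<open>auto dest: exec_WhileTrue.IH\<close>)
qed

definition halts_within :: "prog \<Rightarrow> state \<Rightarrow> nat \<Rightarrow> (state \<Rightarrow> bool) \<Rightarrow> bool" where
  "halts_within P s T Q \<longleftrightarrow> (\<exists>t s'. exec P s t s' \<and> t \<le> T \<and> Q s')"


section \<open>Input and output conventions\<close>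

text \<open>
  Pointer representation of a matching: \<open>u_ptr M i\<close> is the partner of \<open>u\<^sub>i\<close> and \<open>v_ptr M j\<close>
  the partner of \<open>v\<^sub>j\<close>; the null pointer 0 marks unmatched vertices.
\<close>

definition u_ptr :: "edges \<Rightarrow> nat \<Rightarrow> nat" where
  "u_ptr M i = (if \<exists>j. (i, j) \<in> M then THE j. (i, j) \<in> M else 0)"

definition v_ptr :: "edges \<Rightarrow> nat \<Rightarrow> nat" where
  "v_ptr M j = (if \<exists>i. (i, j) \<in> M then THE i. (i, j) \<in> M else 0)"

definition scalar :: "nat \<Rightarrow> nat \<Rightarrow> nat \<Rightarrow> nat" where
  "scalar c i j = (if i = 0 \<and> j = 0 then c else 0)"

text \<open>
  Initial memory for the matrix \<open>W\<close> and a list \<open>L\<close> of pairs of a cardinality and a matching: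
  \<open>k[t][0]\<close> is the cardinality and \<open>u[t]\<close>, \<open>v[t]\<close> are the pointers of the \<open>t\<close>-th entry
  (counted from 0). All other cells are 0.
\<close>

definition input_state ::
  "nat \<Rightarrow> (nat \<Rightarrow> nat \<Rightarrow> maxplus) \<Rightarrow> (nat \<times> edges) list \<Rightarrow> state" where
  "input_state n W L = \<lparr>
    nmem = (\<lambda>_ _ _. 0)(
      ''n'' := scalar n,
      ''len'' := scalar (length L),
      ''k'' := (\<lambda>t i. if t < length L \<and> i = 0 then fst (L ! t) else 0),
      ''u'' := (\<lambda>t i. if t < length L then u_ptr (snd (L ! t)) i else 0),
      ''v'' := (\<lambda>t j. if t < length L then v_ptr (snd (L ! t)) j else 0)),
    wmem = (\<lambda>_ _ _. 0)(
      ''W'' := (\<lambda>i j. if i \<in> {1..n} \<and> j \<in> {1..n} then val (W i j) else 0))\<rparr>"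

text \<open>
  The final memory lists exactly one \<open>m\<close>-assignment for each \<open>m \<in> S\<close> and nothing else:
  \<open>out[m][0]\<close> tells whether one is present, \<open>outu[m]\<close> and \<open>outv[m]\<close> are its pointers.
\<close>

definition outputs_assignments ::
  "nat \<Rightarrow> (nat \<Rightarrow> nat \<Rightarrow> maxplus) \<Rightarrow> nat set \<Rightarrow> state \<Rightarrow> bool" where
  "outputs_assignments n W S s \<longleftrightarrow>
    (\<forall>m. nmem s ''out'' m 0 = (if m \<in> S then 1 else 0)) \<and>
    (\<forall>m\<in>S. \<exists>M. is_assignment n W m M \<and>
      (\<forall>i\<in>{1..n}. nmem s ''outu'' m i = u_ptr M i) \<and>
      (\<forall>j\<in>{1..n}. nmem s ''outv'' m j = v_ptr M j))"

end

theory Submission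
  imports Defs
begin

text \<open>
  Fix a point \<open>c\<close> and subtract \<open>c\<close> from every weight. The terms whose lines pass through the graph of the
  maximum at \<open>c\<close> belong exactly to the matchings of maximal shifted weight, of whatever size. If \<open>M\<close> and
  \<open>M'\<close> are two of them, switching \<open>M\<close> along one component of the symmetric difference gives a
  matching, as does switching \<open>M'\<close>; the two new shifted weights add up to twice the optimum, so both
  are optimal. Switching the components one by one therefore yields assignments of all
  intermediate sizes. No weight is ever read, and every row is brought into agreement with \<open>M'\<close> at most
  once, so apart from writing the output a gap is filled in linear time. Since an essential term is active at
  every point, consecutive entries of the input list of part (1) refer to adjacent terms, and a single program
  serves for both statements of (1).

  Part (2) does not go through the essential terms: the Hungarian method, started from all free rows
  simultaneously, keeps the potential of the free vertices minimal, hence the matching after its \<open>k\<close>-th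
  augmentation is a \<open>k\<close>-assignment, and each augmentation takes quadratic time.
\<close>

subsection \<open>Reasoning about programs\<close>

text \<open>During a walk the current matching always stays a matching, but its counterpart may
  carry two edges at the open end of the path. The bound by the optimum is available for both only
  when the path has come to rest, so optimality is certified only there. A walk begins only at a row
  that \<open>M'\<close> matches and the current matching does not. Hence cycles are never switched,
  and a path of even length ends without a change of size and without output. The scan over the rows
  cannot run dry, because a matching that covers every row of \<open>M'\<close> has at least
  \<open>k'\<close> edges.

  All sizes strictly between two listed ones are emitted. They are the required ones: each is active
  at the common point, and no essential one is missing from the list.

  In part (2) an edge of weight minus infinity would admit no real potentials. Such weights are
  replaced by a real number so low that it never pays to use one; sizes all of whose matchings have
  weight minus infinity still receive an assignment. The numerical constants in the time bounds are
  instruction counts, rounded up.\<close>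

lemma halts_within_weaken:
  assumes "halts_within P s T Q" and "T \<le> T'" and "\<And>s'. Q s' \<Longrightarrow> R s'"
  shows "halts_within P s T' R"
  using assms unfolding halts_within_def by (meson le_trans)

lemma halts_within_Seq:
  assumes "halts_within P s T1 R" and "\<And>s'. R s' \<Longrightarrow> halts_within P' s' T2 Q"
  shows "halts_within (Seq P P') s (T1 + T2) Q"
  using assms unfolding halts_within_def by (meson add_mono exec_Seq)

lemma halts_within_CondTrue:
  assumes "bval b s" "halts_within P s T Q"
  shows "halts_within (Cond b P P') s (1 + bcost b + T) Q"
  using assms unfolding halts_within_def by (meson add_left_mono exec_CondTrue)

lemma halts_within_CondFalse:
  assumes "\<not> bval b s" "halts_within P' s T Q"
  shows "halts_within (Cond b P P') s (1 + bcost b + T) Q"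
  using assms unfolding halts_within_def by (meson add_left_mono exec_CondFalse)

text \<open>Amortised analysis: the potential \<open>F\<close> pays for every round of the loop, which also
  makes the loop terminate.\<close>

lemma halts_within_While:
  assumes "I s"
    and "\<And>s. I s \<Longrightarrow> bval b s \<Longrightarrow>
      \<exists>t. halts_within P s t (\<lambda>s'. I s' \<and> t + (1 + bcost b) + F s' \<le> F s)"
    and "\<And>s. I s \<Longrightarrow> \<not> bval b s \<Longrightarrow> Q s"
  shows "halts_within (While b P) s (F s + (1 + bcost b)) Q"
  using assms(1)
proof (induction "F s" arbitrary: s rule: less_induct)
  case less
  show ?case
  proof (cases "bval b s")
    case False
    then show ?thesis
      using exec_WhileFalse[OF False] assms(3)[OF less.prems False]
      unfolding halts_within_def by (intro exI conjI) auto
  next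
    case True
    obtain t u s' where s': "exec P s u s'" "u \<le> t" "I s'" "t + (1 + bcost b) + F s' \<le> F s"
      using assms(2)[OF less.prems True] unfolding halts_within_def by auto
    have "F s' < F s" using s' by simp
    from less.hyps[OF this s'(3)] obtain v s'' where
      v: "exec (While b P) s' v s''" "v \<le> F s' + (1 + bcost b)" "Q s''"
      unfolding halts_within_def by auto
    show ?thesis
      unfolding halts_within_def
      using exec_WhileTrue[OF True s'(1) v(1)] v s' by (intro exI conjI) auto
  qed
qed

section \<open>Straight-line code: its effect and a static cost bound\<close>

primrec straight :: "prog \<Rightarrow> bool" where
  "straight Skip \<longleftrightarrow> True"
| "straight (NWrite x a b e) \<longleftrightarrow> True"
| "straight (WWrite x a b e) \<longleftrightarrow> True"
| "straight (Seq P Q) \<longleftrightarrow> straight P \<and> straight Q"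
| "straight (Cond b P Q) \<longleftrightarrow> straight P \<and> straight Q"
| "straight (While b P) \<longleftrightarrow> False"

primrec run :: "prog \<Rightarrow> state \<Rightarrow> state" where
  "run Skip s = s"
| "run (NWrite x a b e) s = s\<lparr>nmem := upd (nmem s) x (nval a s) (nval b s) (nval e s)\<rparr>"
| "run (WWrite x a b e) s = s\<lparr>wmem := upd (wmem s) x (nval a s) (nval b s) (wval e s)\<rparr>"
| "run (Seq P Q) s = run Q (run P s)"
| "run (Cond b P Q) s = (if bval b s then run P s else run Q s)"
| "run (While b P) s = s"

text \<open>An upper bound rather than the cost, since a conditional is charged its dearer branch.
  The clauses of \<open>run\<close> and \<open>tm\<close> for \<open>While\<close> are placeholders;
  \<open>straight\<close> excludes loops.\<close>

primrec tm :: "prog \<Rightarrow> nat" where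
  "tm Skip = 1"
| "tm (NWrite x a b e) = 1 + ncost a + ncost b + ncost e"
| "tm (WWrite x a b e) = 1 + ncost a + ncost b + wcost e"
| "tm (Seq P Q) = tm P + tm Q"
| "tm (Cond b P Q) = 1 + bcost b + max (tm P) (tm Q)"
| "tm (While b P) = 0"

lemma exec_straight: "straight P \<Longrightarrow> \<exists>t. exec P s t (run P s) \<and> t \<le> tm P"
proof (induction P arbitrary: s)
  case (Seq P1 P2)
  then obtain t where t: "exec P1 s t (run P1 s)" "t \<le> tm P1" by fastforce
  from Seq obtain u where "exec P2 (run P1 s) u (run P2 (run P1 s))" "u \<le> tm P2" by fastforce
  with t show ?case by (auto intro!: exI[of _ "t + u"] exec_Seq)
next
  case (Cond b P1 P2)
  show ?case
  proof (cases "bval b s")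
    case True
    from Cond obtain t where "exec P1 s t (run P1 s)" "t \<le> tm P1" by fastforce
    with True show ?thesis by (auto intro!: exI[of _ "1 + bcost b + t"] exec_CondTrue)
  next
    case False
    from Cond obtain t where "exec P2 s t (run P2 s)" "t \<le> tm P2" by fastforce
    with False show ?thesis
      by (intro exI[of _ "1 + bcost b + t"] conjI) (use exec_CondFalse[OF False] in auto)
  qed
next
  case Skip
  show ?case by (auto intro!: exI[of _ 1] exec.intros)
next
  case (NWrite x a b e)
  show ?case using exec_NWrite by fastforce
next
  case (WWrite x a b e)
  show ?case using exec_WWrite by fastforce
qed simp

lemma halts_within_straight:
  assumes "straight P" and "tm P \<le> T" and "Q (run P s)"
  shows "halts_within P s T Q"
  using exec_straight[OF assms(1), of s] assms(2,3) unfolding halts_within_def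
  by (meson le_trans)

lemma halts_within_Seq_straight:
  assumes "straight P" and "halts_within P' (run P s) T Q"
  shows "halts_within (Seq P P') s (tm P + T) Q"
  by (rule halts_within_Seq[OF halts_within_straight[where Q = "\<lambda>s'. s' = run P s"]])
    (use assms in auto)

section \<open>Frame conditions: the arrays that a program may write\<close>

primrec nwr :: "prog \<Rightarrow> name set" where
  "nwr Skip = {}"
| "nwr (NWrite x a b e) = {x}"
| "nwr (WWrite x a b e) = {}"
| "nwr (Seq P Q) = nwr P \<union> nwr Q"
| "nwr (Cond b P Q) = nwr P \<union> nwr Q"
| "nwr (While b P) = nwr P"

primrec wwr :: "prog \<Rightarrow> name set" where
  "wwr Skip = {}"
| "wwr (NWrite x a b e) = {}"
| "wwr (WWrite x a b e) = {x}"
| "wwr (Seq P Q) = wwr P \<union> wwr Q"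
| "wwr (Cond b P Q) = wwr P \<union> wwr Q"
| "wwr (While b P) = wwr P"

text \<open>Frames speak of whole named arrays, so that facts about untouched data pass from state
  to state as equations between functions.\<close>

definition frame :: "name set \<Rightarrow> name set \<Rightarrow> state \<Rightarrow> state \<Rightarrow> bool" where
  "frame N A s s' \<longleftrightarrow> (\<forall>y. y \<notin> N \<longrightarrow> nmem s' y = nmem s y) \<and> (\<forall>y. y \<notin> A \<longrightarrow> wmem s' y = wmem s y)"

lemma frame_nmem: "frame N A s s' \<Longrightarrow> y \<notin> N \<Longrightarrow> nmem s' y = nmem s y"
  and frame_wmem: "frame N A s s' \<Longrightarrow> y \<notin> A \<Longrightarrow> wmem s' y = wmem s y"
  by (auto simp: frame_def)

lemma frame_refl: "frame N A s s"
  by (simp add: frame_def)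

lemma frame_trans: "frame N A s s' \<Longrightarrow> frame N A s' s'' \<Longrightarrow> frame N A s s''"
  by (simp add: frame_def)

lemma frame_mono: "frame N A s s' \<Longrightarrow> N \<subseteq> N' \<Longrightarrow> A \<subseteq> A' \<Longrightarrow> frame N' A' s s'"
  by (auto simp: frame_def)

lemma exec_frame: "exec P s t s' \<Longrightarrow> frame (nwr P) (wwr P) s s'"
  by (induction rule: exec.induct) (auto simp: frame_def upd_def)

lemma halts_within_frame:
  assumes "halts_within P s T Q"
  shows "halts_within P s T (\<lambda>s'. Q s' \<and> frame (nwr P) (wwr P) s s')"
  using assms exec_frame unfolding halts_within_def by blast

text \<open>Lets the second program rely on everything that the first does not write, without
  listing it in \<open>R\<close>.\<close>

lemma halts_within_Seq_frame:
  assumes "halts_within P s T1 R"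
    and "\<And>s'. R s' \<Longrightarrow> frame (nwr P) (wwr P) s s' \<Longrightarrow> halts_within P' s' T2 Q"
  shows "halts_within (Seq P P') s (T1 + T2) Q"
  using halts_within_Seq[OF halts_within_frame[OF assms(1)]] assms(2) by blast

lemma upd_apply: "upd m x i j v y a b = (if y = x \<and> a = i \<and> b = j then v else m y a b)"
  by (simp add: upd_def)

abbreviation NVar :: "name \<Rightarrow> nexp" where "NVar x \<equiv> NRead x (NConst 0) (NConst 0)"
abbreviation NSet :: "name \<Rightarrow> nexp \<Rightarrow> prog" where "NSet x e \<equiv> NWrite x (NConst 0) (NConst 0) e"
abbreviation NArr :: "name \<Rightarrow> nexp \<Rightarrow> nexp" where "NArr x e \<equiv> NRead x (NConst 0) e"
abbreviation NSetArr :: "name \<Rightarrow> nexp \<Rightarrow> nexp \<Rightarrow> prog" where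
  "NSetArr x i e \<equiv> NWrite x (NConst 0) i e"
abbreviation WVar :: "name \<Rightarrow> wexp" where "WVar x \<equiv> WRead x (NConst 0) (NConst 0)"
abbreviation WSet :: "name \<Rightarrow> wexp \<Rightarrow> prog" where "WSet x e \<equiv> WWrite x (NConst 0) (NConst 0) e"
abbreviation WArr :: "name \<Rightarrow> nexp \<Rightarrow> wexp" where "WArr x e \<equiv> WRead x (NConst 0) e"
abbreviation WSetArr :: "name \<Rightarrow> nexp \<Rightarrow> wexp \<Rightarrow> prog" where
  "WSetArr x i e \<equiv> WWrite x (NConst 0) i e"

section \<open>Counting loops from 1 to the size of the matrix\<close>

definition For :: "name \<Rightarrow> prog \<Rightarrow> prog" where
  "For x P = Seq (NSet x (NConst 1))
    (While (BNot (NLess (NVar ''n'') (NVar x))) (Seq P (NSet x (NPlus (NVar x) (NConst 1)))))"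

lemma straight_For [simp]: "straight (For x P) = False"
  and nwr_For [simp]: "nwr (For x P) = insert x (nwr P)"
  and wwr_For [simp]: "wwr (For x P) = wwr P"
  by (auto simp: For_def)

text \<open>The increment belongs to the loop and not to its body. Invariants are therefore demanded
  of the state after the body with the counter already advanced, and \<open>set_n\<close> names that
  state.\<close>

definition set_n :: "state \<Rightarrow> name \<Rightarrow> nat \<Rightarrow> state" where
  "set_n s x v = s\<lparr>nmem := upd (nmem s) x 0 0 v\<rparr>"

lemma nmem_set_n [simp]: "y \<noteq> x \<Longrightarrow> nmem (set_n s x v) y = nmem s y"
  and nmem_set_n' [simp]: "nmem (set_n s x v) x 0 0 = v"
  and wmem_set_n [simp]: "wmem (set_n s x v) = wmem s"
  by (auto simp: set_n_def upd_def)

text \<open>Where 30 comes from: a round adds 8 for the increment and 9 for the test; the initial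
  assignment and the last test cost 4 and 9, which are charged to one round because \<open>n\<close>
  is at least 1.\<close>

lemma halts_within_For:
  assumes n: "nmem s ''n'' 0 0 = n" "n \<ge> 1"
    and x: "x \<noteq> ''n''" "x \<notin> nwr P" "''n'' \<notin> nwr P"
    and init: "I 1 (set_n s x 1)"
    and step: "\<And>i s'. 1 \<le> i \<Longrightarrow> i \<le> n \<Longrightarrow> frame (insert x (nwr P)) (wwr P) s s' \<Longrightarrow> nmem s' x 0 0 = i \<Longrightarrow>
      nmem s' ''n'' 0 0 = n \<Longrightarrow>
      I i s' \<Longrightarrow> halts_within P s' K (\<lambda>s''. I (Suc i) (set_n s'' x (Suc i)))"
  shows "halts_within (For x P) s ((K + 30) * n)
    (\<lambda>s'. I (Suc n) s' \<and> frame (insert x (nwr P)) (wwr P) s s')"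
proof -
  let ?b = "BNot (NLess (NVar ''n'') (NVar x))"
  let ?P = "Seq P (NSet x (NPlus (NVar x) (NConst 1)))"
  let ?fr = "frame (insert x (nwr P)) (wwr P)"
  define J where "J = (\<lambda>s'. ?fr s s' \<and> (\<exists>i. nmem s' x 0 0 = i \<and> 1 \<le> i \<and> i \<le> Suc n \<and> I i s'))"
  define F where "F = (\<lambda>s' :: state. (Suc n - nmem s' x 0 0) * (K + 17))"
  have nn: "nmem s' ''n'' 0 0 = n" if "?fr s s'" for s'
    using that n x by (simp add: frame_def)
  have A: "halts_within (NSet x (NConst 1)) s 4 (\<lambda>s'. s' = set_n s x 1)"
    by (rule halts_within_straight) (auto simp: set_n_def)
  have B: "halts_within (While ?b ?P) (set_n s x 1) (F (set_n s x 1) + (1 + bcost ?b))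
      (\<lambda>s'. I (Suc n) s' \<and> ?fr s s')"
  proof (rule halts_within_While[where I = J])
    show "J (set_n s x 1)"
      unfolding J_def using init n by (auto simp: frame_def set_n_def upd_def)
  next
    fix s' assume J: "J s'" and b: "bval ?b s'"
    define i where "i = nmem s' x 0 0"
    from J have fr: "?fr s s'" and i: "1 \<le> i" "I i s'" unfolding J_def i_def by auto
    from b nn[OF fr] have "i \<le> n" by (simp add: i_def)
    have "halts_within P s' K (\<lambda>s''. I (Suc i) (set_n s'' x (Suc i)))"
      using step[OF i(1) \<open>i \<le> n\<close> fr _ _ i(2)] nn[OF fr] by (simp add: i_def)
    then have "halts_within ?P s' (K + 8) (\<lambda>s''. J s'' \<and> nmem s'' x 0 0 = Suc i)"
    proof (rule halts_within_Seq_frame)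
      fix s'' assume I: "I (Suc i) (set_n s'' x (Suc i))" and fr': "frame (nwr P) (wwr P) s' s''"
      have xi: "nmem s'' x 0 0 = i" using frame_nmem[OF fr' x(2)] i_def by simp
      have fr2: "?fr s s''" by (rule frame_trans[OF fr frame_mono[OF fr']]) auto
      then have fr3: "?fr s (set_n s'' x (Suc i))"
        by (auto simp: frame_def)
      show "halts_within (NSet x (NPlus (NVar x) (NConst 1))) s'' 8 (\<lambda>s''. J s'' \<and> nmem s'' x 0 0 = Suc i)"
        by (rule halts_within_straight)
          (use I xi fr3 \<open>i \<le> n\<close> in \<open>auto simp: J_def set_n_def[symmetric]\<close>)
    qed
    then have "halts_within ?P s' (K + 8) (\<lambda>s''. J s'' \<and> K + 8 + (1 + bcost ?b) + F s'' \<le> F s')"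
    proof (rule halts_within_weaken)
      fix s'' assume s'': "J s'' \<and> nmem s'' x 0 0 = Suc i"
      have "Suc n - i = Suc (n - i)" using \<open>i \<le> n\<close> by simp
      then have "F s' = K + 17 + F s''" using s'' by (simp add: F_def i_def[symmetric])
      then show "J s'' \<and> K + 8 + (1 + bcost ?b) + F s'' \<le> F s'" using s'' by simp
    qed simp
    then show "\<exists>t. halts_within ?P s' t (\<lambda>s''. J s'' \<and> t + (1 + bcost ?b) + F s'' \<le> F s')" by blast
  next
    fix s' assume J: "J s'" and b: "\<not> bval ?b s'"
    then have "?fr s s'" by (simp add: J_def)
    with nn[OF this] b J show "I (Suc n) s' \<and> ?fr s s'"
      by (auto simp: J_def le_Suc_eq)
  qed
  have "halts_within (For x P) s (4 + (F (set_n s x 1) + (1 + bcost ?b)))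
    (\<lambda>s'. I (Suc n) s' \<and> ?fr s s')"
    unfolding For_def by (rule halts_within_Seq[OF A]) (use B in simp)
  then show ?thesis
    by (rule halts_within_weaken) (use n in \<open>auto simp: F_def algebra_simps\<close>)
qed

subsection \<open>Matchings and the coefficients of the characteristic maxpolynomial\<close>

lemma val_0 [simp]: "val 0 = - \<infinity>"
  and val_1 [simp]: "val 1 = 0"
  and val_add: "val (a + b) = max (val a) (val b)"
  and val_mult: "val (a * b) = val a + val b"
  by (simp_all add: zero_maxplus.rep_eq one_maxplus.rep_eq plus_maxplus.rep_eq times_maxplus.rep_eq)

lemma val_neq_infinity [simp]: "val a \<noteq> \<infinity>"
  using val[of a] by simp

lemma val_prod: "val (prod f S) = (\<Sum>i\<in>S. val (f i))"
  by (induction S rule: infinite_finite_induct) (simp_all add: val_mult)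

lemma val_le_val_sum: "finite S \<Longrightarrow> a \<in> S \<Longrightarrow> val (f a) \<le> val (sum f S)"
  by (induction S rule: finite_induct) (auto simp: val_add intro: max.coboundedI2)

lemma val_sum_cases: "val (sum f S) = - \<infinity> \<or> (\<exists>a\<in>S. val (sum f S) = val (f a))"
  by (induction S rule: infinite_finite_induct) (auto simp: val_add max_def)

lemma matching_finite: "matching n M \<Longrightarrow> finite M"
  by (rule finite_subset[of _ "{1..n} \<times> {1..n}"]) (auto simp: matching_def)

lemma matching_inj_on_fst: "matching n M \<Longrightarrow> inj_on fst M"
  and matching_inj_on_snd: "matching n M \<Longrightarrow> inj_on snd M"
  unfolding matching_def inj_on_def by blast+

lemma matching_card_le:
  assumes "matching n M"
  shows "card M \<le> n"
proof -
  have "card M = card (fst ` M)" using matching_inj_on_fst[OF assms] by (simp add: card_image)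
  also have "\<dots> \<le> card {1..n}" by (rule card_mono) (use assms in \<open>auto simp: matching_def\<close>)
  finally show ?thesis by simp
qed

lemma u_ptr_eq: "matching n M \<Longrightarrow> (i, j) \<in> M \<Longrightarrow> u_ptr M i = j"
  unfolding u_ptr_def matching_def by (auto intro!: the_equality) fastforce

lemma v_ptr_eq: "matching n M \<Longrightarrow> (i, j) \<in> M \<Longrightarrow> v_ptr M j = i"
  unfolding v_ptr_def matching_def by (auto intro!: the_equality) fastforce

text \<open>Unmatched rows and unmatched columns are equally many, so any bijection between them
  completes the pointers. This links matchings to the permutations of the permanent.\<close>

lemma matching_extend_permutation:
  assumes M: "matching n M"
  obtains \<sigma> where "\<sigma> permutes {1..n}" "\<forall>(i, j)\<in>M. \<sigma> i = j"
proof -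
  define A where "A = fst ` M"
  define B where "B = snd ` M"
  have AB: "A \<subseteq> {1..n}" "B \<subseteq> {1..n}" using M by (auto simp: A_def B_def matching_def)
  have u: "u_ptr M (fst e) = snd e" if "e \<in> M" for e
    using u_ptr_eq[OF M, of "fst e" "snd e"] that by simp
  have "bij_betw fst M A" "bij_betw snd M B"
    using matching_inj_on_fst[OF M] matching_inj_on_snd[OF M] by (auto simp: bij_betw_def A_def B_def)
  then have card: "card A = card B" using bij_betw_same_card by metis
  have bu: "bij_betw (u_ptr M) A B"
    unfolding bij_betw_def
  proof
    show "inj_on (u_ptr M) A"
      unfolding A_def inj_on_def using u matching_inj_on_snd[OF M] by (auto simp: inj_on_def)
    show "u_ptr M ` A = B"
      unfolding A_def B_def using u by force
  qed
  have "card ({1..n} - A) = card ({1..n} - B)"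
    using AB card by (simp add: card_Diff_subset finite_subset)
  then obtain g where g: "bij_betw g ({1..n} - A) ({1..n} - B)"
    using finite_same_card_bij by (metis finite_Diff finite_atLeastAtMost)
  define \<sigma> where "\<sigma> i = (if i \<in> A then u_ptr M i else if i \<in> {1..n} then g i else i)" for i
  have "bij_betw \<sigma> A B" using bu by (rule bij_betw_cong[THEN iffD1, rotated]) (simp add: \<sigma>_def)
  moreover have "bij_betw \<sigma> ({1..n} - A) ({1..n} - B)"
    using g by (rule bij_betw_cong[THEN iffD1, rotated]) (auto simp: \<sigma>_def)
  ultimately have "bij_betw \<sigma> (A \<union> ({1..n} - A)) (B \<union> ({1..n} - B))"
    by (rule bij_betw_combine) auto
  moreover have "A \<union> ({1..n} - A) = {1..n}" "B \<union> ({1..n} - B) = {1..n}" using AB by auto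
  ultimately have "\<sigma> permutes {1..n}"
    using AB by (intro bij_imp_permutes) (auto simp: \<sigma>_def)
  moreover have "\<sigma> i = j" if "(i, j) \<in> M" for i j
    using u[OF that] that by (force simp: \<sigma>_def A_def)
  ultimately show ?thesis using that by blast
qed

text \<open>A summand of the expanded product takes the indeterminate from the factors in
  \<open>X\<close> and the constant from all others.\<close>

lemma coeff_prod_linear:
  fixes c :: "nat \<Rightarrow> 'a :: comm_semiring_1"
  assumes "finite A"
  shows "coeff (\<Prod>i\<in>A. monom 1 1 + [:c i:]) m =
    (\<Sum>X\<in>Pow A. if card X = m then \<Prod>i\<in>A - X. c i else 0)"
proof -
  have C: "(\<Prod>i\<in>S. [:c i:]) = [:\<Prod>i\<in>S. c i:]" for S
    by (induction S rule: infinite_finite_induct) (simp_all add: one_pCons ac_simps)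
  have X: "(\<Prod>i\<in>S. monom (1::'a) 1) = monom 1 (card S)" for S :: "nat set"
    by (simp add: monom_power)
  have "(\<Prod>i\<in>A. monom 1 1 + [:c i:]) = (\<Sum>X\<in>Pow A. monom 1 (card X) * [:\<Prod>i\<in>A - X. c i:])"
    unfolding prod_add[OF assms] C X ..
  also have "\<dots> = (\<Sum>X\<in>Pow A. monom (\<Prod>i\<in>A - X. c i) (card X))"
    by (simp add: mult.commute[of "monom _ _"] smult_monom)
  finally show ?thesis by (simp add: coeff_sum)
qed

lemma coeff_full_char_maxpoly:
  "coeff (full_char_maxpoly n W) m = (\<Sum>(\<sigma>, X)\<in>{\<sigma>. \<sigma> permutes {1..n}} \<times> Pow {1..n}.
     if card X = m then \<Prod>i\<in>{1..n} - X. W i (\<sigma> i) else 0)"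
  unfolding full_char_maxpoly_def permanent_def coeff_sum
  by (subst coeff_prod_linear) (simp_all add: sum.cartesian_product)

text \<open>Completing \<open>M\<close> to a permutation and taking the indeterminate from every
  unmatched row exhibits the weight of \<open>M\<close> as one of the summands, which the maximum
  dominates.\<close>

lemma weight_le_coeff:
  assumes M: "matching n M"
  shows "weight W M \<le> val (coeff (full_char_maxpoly n W) (n - card M))"
proof -
  obtain \<sigma> where \<sigma>: "\<sigma> permutes {1..n}" "\<forall>(i, j)\<in>M. \<sigma> i = j"
    by (rule matching_extend_permutation[OF M])
  define A where "A = fst ` M"
  have A: "A \<subseteq> {1..n}" "card A = card M"
    using M matching_inj_on_fst[OF M] by (auto simp: A_def matching_def card_image)
  let ?f = "\<lambda>(\<sigma>, X). if card X = n - card M then \<Prod>i\<in>{1..n} - X. W i (\<sigma> i) else 0"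
  have "{1..n} - ({1..n} - A) = A" using A by auto
  moreover have "card ({1..n} - A) = n - card M"
    using A by (simp add: card_Diff_subset finite_subset)
  ultimately have "val (?f (\<sigma>, {1..n} - A)) = (\<Sum>i\<in>A. val (W i (\<sigma> i)))"
    by (simp add: val_prod)
  also have "\<dots> = weight W M"
    unfolding A_def weight_def
    by (subst sum.reindex[OF matching_inj_on_fst[OF M]]) (use \<sigma>(2) in \<open>auto intro!: sum.cong\<close>)
  finally have "weight W M = val (?f (\<sigma>, {1..n} - A))" ..
  also have "\<dots> \<le> val (sum ?f ({\<sigma>. \<sigma> permutes {1..n}} \<times> Pow {1..n}))"
    by (rule val_le_val_sum) (use \<sigma>(1) in \<open>auto simp: finite_permutations\<close>)
  finally show ?thesis
    unfolding coeff_full_char_maxpoly .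
qed

text \<open>The converse direction: a maximum is attained by a summand, and the rows outside
  \<open>X\<close> with their images form a matching. The first alternative arises because a summand
  for a set \<open>X\<close> of the wrong size is the semiring zero and exhibits no
  matching.\<close>

lemma coeff_cases:
  obtains "val (coeff (full_char_maxpoly n W) m) = - \<infinity>"
  | M where "matching n M" "m + card M = n"
      "val (coeff (full_char_maxpoly n W) m) = weight W M"
proof -
  let ?S = "{\<sigma>. \<sigma> permutes {1..n}} \<times> Pow {1..n}"
  let ?f = "\<lambda>(\<sigma>, X). if card X = m then \<Prod>i\<in>{1..n} - X. W i (\<sigma> i) else 0"
  consider "val (sum ?f ?S) = - \<infinity>" | e where "e \<in> ?S" "val (sum ?f ?S) = val (?f e)"
    using val_sum_cases[of ?f ?S] by blast
  then show ?thesis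
  proof cases
    case 1
    then show ?thesis using that(1) by (simp add: coeff_full_char_maxpoly)
  next
    case 2
    then obtain \<sigma> X where \<sigma>: "\<sigma> permutes {1..n}" "X \<subseteq> {1..n}"
      and eq: "val (coeff (full_char_maxpoly n W) m) = val (?f (\<sigma>, X))"
      unfolding coeff_full_char_maxpoly by auto
    show ?thesis
    proof (cases "card X = m")
      case False
      then show ?thesis using eq that(1) by simp
    next
      case True
      define M where "M = (\<lambda>i. (i, \<sigma> i)) ` ({1..n} - X)"
      have inj: "inj_on (\<lambda>i. (i, \<sigma> i)) S" for S by (auto simp: inj_on_def)
      have "matching n M"
        unfolding matching_def M_def
        using permutes_in_image[OF \<sigma>(1)] permutes_inj[OF \<sigma>(1)] by (auto simp: inj_def)
      moreover have "m + card M = n"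
        unfolding M_def card_image[OF inj]
        using \<sigma>(2) True card_mono[OF _ \<sigma>(2)]
        by (simp add: card_Diff_subset finite_subset)
      moreover have "weight W M = val (?f (\<sigma>, X))"
        unfolding M_def weight_def sum.reindex[OF inj] using True by (simp add: val_prod)
      ultimately show ?thesis using that(2) eq by simp
    qed
  qed
qed

lemma is_assignment_coeff:
  assumes "is_assignment n W k M"
  shows "val (coeff (full_char_maxpoly n W) (n - k)) = weight W M"
proof (rule antisym)
  have M: "matching n M" "card M = k" and opt: "\<And>N. matching n N \<Longrightarrow> card N = k \<Longrightarrow> weight W N \<le> weight W M"
    using assms by (auto simp: is_assignment_def)
  have "k \<le> n" using matching_card_le[OF M(1)] M(2) by simp
  show "val (coeff (full_char_maxpoly n W) (n - k)) \<le> weight W M"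
    by (rule coeff_cases[of n W "n - k"]) (use opt \<open>k \<le> n\<close> in auto)
  show "weight W M \<le> val (coeff (full_char_maxpoly n W) (n - k))"
    using weight_le_coeff[OF M(1)] M(2) by simp
qed

text \<open>\<open>max_fun\<close> ranges only up to the degree, so the degree has to be
  \<open>n\<close> for all terms to compete. The leading coefficient is nonzero because the empty
  matching has weight 0.\<close>

lemma degree_full_char_maxpoly: "degree (full_char_maxpoly n W) = n"
proof (rule antisym)
  show "degree (full_char_maxpoly n W) \<le> n"
  proof (rule degree_le, intro allI impI)
    fix m assume "n < m"
    show "coeff (full_char_maxpoly n W) m = 0"
    proof (rule coeff_cases[of n W m])
      assume "val (coeff (full_char_maxpoly n W) m) = - \<infinity>"
      then show ?thesis by (metis val_0 val_inject)
    qed (use \<open>n < m\<close> in simp)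
  qed
  have "matching n {}" by (simp add: matching_def)
  from weight_le_coeff[OF this, of W] have "coeff (full_char_maxpoly n W) n \<noteq> 0"
    by (auto simp: weight_def)
  then show "n \<le> degree (full_char_maxpoly n W)" by (rule le_degree)
qed

lemma val_coeff_n_ge: "0 \<le> val (coeff (full_char_maxpoly n W) n)"
  using weight_le_coeff[of n "{}" W] by (simp add: matching_def weight_def)

subsection \<open>Active terms\<close>

lemma term_val_le_max_fun: "k \<le> degree p \<Longrightarrow> term_val p k x \<le> max_fun p x"
  unfolding max_fun_def by (rule Max_ge) auto

lemma max_fun_attained: "\<exists>k\<le>degree p. max_fun p x = term_val p k x"
proof -
  have "max_fun p x \<in> (\<lambda>k. term_val p k x) ` {..degree p}"
    unfolding max_fun_def by (rule Max_in) auto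
  then show ?thesis by auto
qed

text \<open>The common form of essential and semi-essential terms: for exponents up to the degree,
  not being inessential means being active somewhere, and adjacency means being active at a common
  point.\<close>

definition active :: "maxplus poly \<Rightarrow> nat \<Rightarrow> real \<Rightarrow> bool" where
  "active p k x \<longleftrightarrow> k \<le> degree p \<and> max_fun p x = term_val p k x"

lemma term_val_eq_real:
  assumes "val (coeff p k) \<noteq> - \<infinity>"
  shows "term_val p k x = ereal (real_of_ereal (val (coeff p k)) + real k * x)"
  using assms unfolding term_val_def by (cases "val (coeff p k)") auto

lemma max_fun_neq_infinity:
  assumes "p \<noteq> 0"
  shows "max_fun p x \<noteq> \<infinity>" "max_fun p x \<noteq> - \<infinity>"
proof -
  obtain k where "max_fun p x = term_val p k x" using max_fun_attained by blast
  then show "max_fun p x \<noteq> \<infinity>" unfolding term_val_def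
    by (cases "val (coeff p k)") (use val_neq_infinity[of "coeff p k"] in auto)
  have "val (lead_coeff p) \<noteq> - \<infinity>" using assms
    by (metis leading_coeff_0_iff val_0 val_inject)
  then have "term_val p (degree p) x > - \<infinity>" by (simp add: term_val_eq_real)
  then show "max_fun p x \<noteq> - \<infinity>"
    using term_val_le_max_fun[of "degree p" p x] by auto
qed

lemma active_coeff_finite: "p \<noteq> 0 \<Longrightarrow> active p k x \<Longrightarrow> val (coeff p k) \<noteq> - \<infinity>"
  using max_fun_neq_infinity[of p x] by (auto simp: active_def term_val_def)

lemma not_inessential_iff_active:
  assumes "k \<le> degree p"
  shows "\<not> inessential p k \<longleftrightarrow> (\<exists>x. active p k x)"
  unfolding inessential_def active_def
  using term_val_le_max_fun[OF assms] assms by (metis antisym_conv2 not_le order_refl)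

lemma essential_imp_active: "essential p k \<Longrightarrow> k \<le> degree p \<Longrightarrow> \<exists>x. active p k x"
  unfolding essential_def active_def
  by (metis dense greaterThanLessThan_iff)

text \<open>Convexity of the upper envelope: compare the two lines at \<open>x\<close> and at
  \<open>y\<close> and add the inequalities; only the slopes remain.\<close>

lemma active_mono:
  assumes "p \<noteq> 0" "active p i x" "active p j y" "x < y"
  shows "i \<le> j"
proof -
  have fin: "val (coeff p i) \<noteq> - \<infinity>" "val (coeff p j) \<noteq> - \<infinity>"
    using assms active_coeff_finite by blast+
  have "term_val p j x \<le> term_val p i x" "term_val p i y \<le> term_val p j y"
    using assms term_val_le_max_fun unfolding active_def by metis+
  then have "real i * (y - x) \<le> real j * (y - x)"
    unfolding term_val_eq_real[OF fin(1)] term_val_eq_real[OF fin(2)] by (simp add: algebra_simps)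
  then show ?thesis using \<open>x < y\<close> by simp
qed

text \<open>Among the terms active at \<open>c\<close>, the one of largest exponent stays maximal immediately to the
  right of \<open>c\<close>.\<close>

lemma ex_essential_active:
  assumes "p \<noteq> 0"
  obtains k where "essential p k" "active p k c"
proof -
  have "finite {k. active p k c}" by (rule finite_subset[of _ "{..degree p}"]) (auto simp: active_def)
  moreover have "{k. active p k c} \<noteq> {}" using max_fun_attained[of p c] by (auto simp: active_def)
  ultimately obtain k where k: "active p k c" "\<And>l. active p l c \<Longrightarrow> l \<le> k"
    using Max_in[of "{k. active p k c}"] Max_ge[of "{k. active p k c}"] by blast
  have fin: "val (coeff p k) \<noteq> - \<infinity>" using active_coeff_finite[OF assms k(1)] .
  define r where "r l = real_of_ereal (val (coeff p l))" for l
  have ev: "eventually (\<lambda>x. term_val p l x \<le> term_val p k x) (at_right c)" if l: "l \<in> {..degree p}" for l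
  proof (cases "val (coeff p l) = - \<infinity>")
    case True
    then show ?thesis by (simp add: term_val_def)
  next
    case lfin: False
    note tv = term_val_eq_real[OF fin, folded r_def] term_val_eq_real[OF lfin, folded r_def]
    have le: "term_val p l c \<le> term_val p k c"
      using l k(1) term_val_le_max_fun by (metis active_def atMost_iff)
    show ?thesis
    \<comment> \<open>A tie at \<open>c\<close> is decided by the slopes; a strict gap at
      \<open>c\<close> persists nearby by continuity.\<close>
    proof (cases "term_val p l c = term_val p k c")
      case True
      then have "l \<le> k" using l k by (auto simp: active_def)
      have "term_val p l x \<le> term_val p k x" if "c < x" for x
      proof -
        have "real l * (x - c) \<le> real k * (x - c)"
          using that \<open>l \<le> k\<close> by (intro mult_right_mono) auto
        then show ?thesis using True unfolding tv by (simp add: algebra_simps)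
      qed
      then show ?thesis by (auto simp: eventually_at_right_field intro!: exI[of _ "c + 1"])
    next
      case False
      with le have "r l + real l * c < r k + real k * c" unfolding tv by simp
      then have "(r k + real k * c) - (r l + real l * c) > 0" by simp
      moreover have "((\<lambda>x. (r k + real k * x) - (r l + real l * x)) \<longlongrightarrow>
          (r k + real k * c) - (r l + real l * c)) (at_right c)"
        by (auto intro!: tendsto_intros)
      ultimately have "eventually (\<lambda>x. (r k + real k * x) - (r l + real l * x) > 0) (at_right c)"
        by (rule order_tendstoD(1)[rotated])
      then show ?thesis by eventually_elim (simp add: tv)
    qed
  qed
  have "eventually (\<lambda>x. \<forall>l\<in>{..degree p}. term_val p l x \<le> term_val p k x) (at_right c)"
    by (rule eventually_ball_finite) (use ev in auto)
  then obtain b where b: "b > c" "\<And>x. c < x \<Longrightarrow> x < b \<Longrightarrow> \<forall>l\<le>degree p. term_val p l x \<le> term_val p k x"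
    by (auto simp: eventually_at_right_field)
  have "essential p k"
    unfolding essential_def
  proof (intro exI conjI ballI)
    show "c < b" by fact
    fix x assume x: "x \<in> {c<..<b}"
    show "max_fun p x = term_val p k x"
    proof (rule antisym)
      show "max_fun p x \<le> term_val p k x" using max_fun_attained[of p x] b(2) x by auto
      show "term_val p k x \<le> max_fun p x" using k(1) by (simp add: active_def term_val_le_max_fun)
    qed
  qed
  then show ?thesis using that k(1) by blast
qed

text \<open>If the crossing point of the two lines were not on the graph of the maximum, the essential
  term active there would have an exponent strictly in between.\<close>

lemma active_common_point:
  assumes p: "p \<noteq> 0" and x: "active p i x" and y: "active p j y" and "i < j"
    and none: "\<And>k. essential p k \<Longrightarrow> k \<le> i \<or> j \<le> k"
  obtains c where "active p i c" "active p j c"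
proof (cases "x = y")
  case True
  then show ?thesis using that x y by blast
next
  case False
  with active_mono[OF p y x] \<open>i < j\<close> have "x < y" by (meson linorder_neqE not_le)
  have fin: "val (coeff p i) \<noteq> - \<infinity>" "val (coeff p j) \<noteq> - \<infinity>"
    using x y p active_coeff_finite by blast+
  define r where "r l = real_of_ereal (val (coeff p l))" for l
  note tv = term_val_eq_real[OF fin(1), folded r_def] term_val_eq_real[OF fin(2), folded r_def]
  define c where "c = (r i - r j) / (real j - real i)"
  have ji: "real j - real i > 0" using \<open>i < j\<close> by simp
  have eq: "term_val p i c = term_val p j c"
    unfolding tv using ji by (simp add: c_def field_simps)
  have le: "term_val p j x \<le> term_val p i x" "term_val p i y \<le> term_val p j y"
    using x y term_val_le_max_fun unfolding active_def by metis+
  \<comment> \<open>Line \<open>i\<close> leads at \<open>x\<close> and line \<open>j\<close> at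
    \<open>y\<close>, so the crossing lies in between.\<close>
  then have "x \<le> c" "c \<le> y"
    unfolding tv c_def using ji by (auto simp: field_simps)
  have ij: "i \<le> degree p" "j \<le> degree p" using x y by (auto simp: active_def)
  obtain k where k: "essential p k" "active p k c" using ex_essential_active[OF p] .
  have kfin: "val (coeff p k) \<noteq> - \<infinity>" using active_coeff_finite[OF p k(2)] .
  note tvk = term_val_eq_real[OF kfin, folded r_def]
  have kd: "k \<le> degree p" using k by (simp add: active_def)
  have kx: "term_val p k x \<le> term_val p i x" and ky: "term_val p k y \<le> term_val p j y"
    using x y term_val_le_max_fun[OF kd] unfolding active_def by metis+
  have ck: "term_val p i c \<le> term_val p k c"
    using k(2) term_val_le_max_fun[OF ij(1)] unfolding active_def by metis
  have "term_val p i c = term_val p k c"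
  proof (rule ccontr)
    assume "term_val p i c \<noteq> term_val p k c"
    with ck have less: "r i + real i * c < r k + real k * c" unfolding tv tvk by simp
    \<comment> \<open>A line above the crossing with slope at most \<open>i\<close> is still above
      line \<open>i\<close> at \<open>x\<close>; one with slope at least \<open>j\<close> is still
      above line \<open>j\<close> at \<open>y\<close>.\<close>
    from none[OF k(1)] show False
    proof
      assume "k \<le> i"
      then have "real k * (c - x) \<le> real i * (c - x)" using \<open>x \<le> c\<close> by (intro mult_right_mono) auto
      then show False using less kx unfolding tv tvk by (simp add: algebra_simps)
    next
      assume "j \<le> k"
      then have "real j * (y - c) \<le> real k * (y - c)" using \<open>c \<le> y\<close> by (intro mult_right_mono) auto
      then show False using less ky eq unfolding tv tvk by (simp add: algebra_simps)
    qed
  qed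
  then have "active p i c" "active p j c"
    using k(2) eq ij by (auto simp: active_def)
  then show ?thesis using that by blast
qed

subsection \<open>Pointer representation of matchings\<close>

text \<open>Cell 0 is left unconstrained: a write through a null pointer lands there, which spares
  the programs a test for null.\<close>

definition rep :: "nat \<Rightarrow> (nat \<Rightarrow> nat) \<Rightarrow> (nat \<Rightarrow> nat) \<Rightarrow> bool" where
  "rep n f g \<longleftrightarrow> (\<forall>i\<in>{1..n}. f i \<le> n \<and> (f i \<noteq> 0 \<longrightarrow> g (f i) = i)) \<and>
    (\<forall>j\<in>{1..n}. g j \<le> n \<and> (g j \<noteq> 0 \<longrightarrow> f (g j) = j))"

definition edges_of :: "nat \<Rightarrow> (nat \<Rightarrow> nat) \<Rightarrow> edges" where
  "edges_of n f = {(i, j). i \<in> {1..n} \<and> j = f i \<and> j \<noteq> 0}"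

lemma rep_commute: "rep n f g \<longleftrightarrow> rep n g f"
  unfolding rep_def by blast

lemma repD1: "rep n f g \<Longrightarrow> i \<in> {1..n} \<Longrightarrow> f i \<noteq> 0 \<Longrightarrow> f i \<in> {1..n} \<and> g (f i) = i"
  and repD2: "rep n f g \<Longrightarrow> j \<in> {1..n} \<Longrightarrow> g j \<noteq> 0 \<Longrightarrow> g j \<in> {1..n} \<and> f (g j) = j"
  by (auto simp: rep_def)

lemma rep_cong:
  assumes "\<And>i. i \<in> {1..n} \<Longrightarrow> f i = f' i" and "\<And>i. i \<in> {1..n} \<Longrightarrow> g i = g' i"
  shows "rep n f g \<longleftrightarrow> rep n f' g'"
proof -
  have imp: "rep n f' g'" if r: "rep n f g" and e: "\<forall>i\<in>{1..n}. f i = f' i" "\<forall>i\<in>{1..n}. g i = g' i"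
    for f f' g g'
    unfolding rep_def
  proof (intro conjI ballI impI)
    fix i assume i: "i \<in> {1..n}"
    show "f' i \<le> n" "g' i \<le> n" using r e i unfolding rep_def by metis+
    show "g' (f' i) = i" if "f' i \<noteq> 0"
      using repD1[OF r i] e i that by metis
    show "f' (g' i) = i" if "g' i \<noteq> 0"
      using repD2[OF r i] e i that by metis
  qed
  show ?thesis using imp[of f g f' g'] imp[of f' g' f g] assms by auto
qed

lemma edges_of_cong: "(\<And>i. i \<in> {1..n} \<Longrightarrow> f i = f' i) \<Longrightarrow> edges_of n f = edges_of n f'"
  unfolding edges_of_def by auto

lemma edges_of_finite: "finite (edges_of n f)"
  by (rule finite_subset[of _ "(\<lambda>i. (i, f i)) ` {1..n}"]) (auto simp: edges_of_def)

lemma rep_matching: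
  assumes "rep n f g"
  shows "matching n (edges_of n f)"
  unfolding matching_def
proof (intro conjI ballI impI)
  show "edges_of n f \<subseteq> {1..n} \<times> {1..n}"
    using repD1[OF assms] by (auto simp: edges_of_def)
next
  fix e e' assume e: "e \<in> edges_of n f" "e' \<in> edges_of n f" "e \<noteq> e'"
  then have "fst e \<in> {1..n}" "snd e = f (fst e)" "g (snd e) = fst e"
    "snd e' = f (fst e')" "g (snd e') = fst e'"
    using repD1[OF assms] by (auto simp: edges_of_def)
  with e show "fst e \<noteq> fst e'" "snd e \<noteq> snd e'" by (metis prod_eqI)+
qed

text \<open>The passage to columns: with \<open>rep_commute\<close> it lets the results on forcing
  an edge at a free row serve the augmentation, which works at a free column.\<close>

lemma edges_of_swap:
  assumes "rep n f g"
  shows "edges_of n g = prod.swap ` edges_of n f"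
proof -
  have "(j, i) \<in> edges_of n g \<longleftrightarrow> (i, j) \<in> edges_of n f" for i j
    using repD1[OF assms, of i] repD2[OF assms, of j] by (auto simp: edges_of_def)
  then show ?thesis by force
qed

lemma card_edges_of_swap: "rep n f g \<Longrightarrow> card (edges_of n g) = card (edges_of n f)"
  by (simp add: edges_of_swap card_image)

lemma u_ptr_edges_of:
  assumes "rep n f g" and "i \<in> {1..n}"
  shows "u_ptr (edges_of n f) i = f i"
proof (cases "f i = 0")
  case True
  then show ?thesis by (auto simp: u_ptr_def edges_of_def)
next
  case False
  then show ?thesis using u_ptr_eq[OF rep_matching[OF assms(1)], of i "f i"] assms
    by (auto simp: edges_of_def)
qed

lemma v_ptr_edges_of:
  assumes "rep n f g" and "j \<in> {1..n}"
  shows "v_ptr (edges_of n f) j = g j"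
proof (cases "g j = 0")
  case True
  then have "(i, j) \<notin> edges_of n f" for i
    using assms by (auto simp: rep_def edges_of_def)
  then show ?thesis using True by (auto simp: v_ptr_def)
next
  case False
  then have "(g j, j) \<in> edges_of n f" using assms by (auto simp: rep_def edges_of_def)
  then show ?thesis using v_ptr_eq[OF rep_matching[OF assms(1)]] by blast
qed

lemma u_ptr_outside: "matching n M \<Longrightarrow> i \<notin> {1..n} \<Longrightarrow> u_ptr M i = 0"
  unfolding u_ptr_def matching_def by auto

lemma u_ptr_iff: "matching n M \<Longrightarrow> (i, j) \<in> M \<longleftrightarrow> j = u_ptr M i \<and> j \<noteq> 0"
proof
  assume M: "matching n M"
  show "j = u_ptr M i \<and> j \<noteq> 0" if "(i, j) \<in> M"
    using that u_ptr_eq[OF M that] M by (auto simp: matching_def)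
  assume j: "j = u_ptr M i \<and> j \<noteq> 0"
  then obtain j' where "(i, j') \<in> M" unfolding u_ptr_def by (auto split: if_splits)
  then show "(i, j) \<in> M" using j u_ptr_eq[OF M] by metis
qed

lemma v_ptr_iff: "matching n M \<Longrightarrow> (i, j) \<in> M \<longleftrightarrow> i = v_ptr M j \<and> i \<noteq> 0"
proof
  assume M: "matching n M"
  show "i = v_ptr M j \<and> i \<noteq> 0" if "(i, j) \<in> M"
    using that v_ptr_eq[OF M that] M by (auto simp: matching_def)
  assume i: "i = v_ptr M j \<and> i \<noteq> 0"
  then obtain i' where "(i', j) \<in> M" unfolding v_ptr_def by (auto split: if_splits)
  then show "(i, j) \<in> M" using i v_ptr_eq[OF M] by metis
qed

lemma edges_of_u_ptr:
  assumes "matching n M"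
  shows "edges_of n (u_ptr M) = M"
proof -
  have "(i, j) \<in> edges_of n (u_ptr M) \<longleftrightarrow> (i, j) \<in> M" for i j
    using u_ptr_iff[OF assms, of i j] u_ptr_outside[OF assms, of i]
    by (cases "i \<in> {1..n}") (auto simp: edges_of_def)
  then show ?thesis by auto
qed

lemma rep_ptr:
  assumes M: "matching n M"
  shows "rep n (u_ptr M) (v_ptr M)"
proof -
  have sub: "M \<subseteq> {1..n} \<times> {1..n}" using M by (simp add: matching_def)
  have u: "(i, u_ptr M i) \<in> M" if "u_ptr M i \<noteq> 0" for i
    using that u_ptr_iff[OF M] by blast
  have v: "(v_ptr M j, j) \<in> M" if "v_ptr M j \<noteq> 0" for j
    using that v_ptr_iff[OF M] by blast
  have "u_ptr M i \<le> n" for i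
    using u[of i] sub by (cases "u_ptr M i = 0") auto
  moreover have "v_ptr M i \<le> n" for i
    using v[of i] sub by (cases "v_ptr M i = 0") auto
  ultimately show ?thesis
    unfolding rep_def using u v u_ptr_eq[OF M] v_ptr_eq[OF M] by blast
qed

lemma is_assignment_pointers:
  assumes "rep n f g" and "is_assignment n W k (edges_of n f)"
  shows "\<exists>M. is_assignment n W k M \<and> (\<forall>i\<in>{1..n}. f i = u_ptr M i) \<and> (\<forall>j\<in>{1..n}. g j = v_ptr M j)"
  using assms u_ptr_edges_of v_ptr_edges_of by metis

text \<open>Forcing the edge \<open>(x, y)\<close> at a free vertex \<open>x\<close> releases the former partner \<open>g y\<close> of \<open>y\<close>;
  when \<open>y\<close> was free, \<open>g y\<close> is the null pointer.\<close>

context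
  fixes n f g x y f' g'
  assumes r: "rep n f g" and x: "x \<in> {1..n}" "f x = 0" and y: "y \<in> {1..n}"
  defines "f' \<equiv> f(x := y, g y := 0)" and "g' \<equiv> g(y := x)"
begin

lemma force_partner_neq: "g y \<noteq> x"
  using r x y by (auto simp: rep_def)

lemma rep_force: "rep n f' g'"
  unfolding rep_def
proof (intro conjI ballI impI)
  fix i assume i: "i \<in> {1..n}"
  show "f' i \<le> n" using r i y by (simp add: f'_def rep_def)
  show "g' i \<le> n" using r i x by (simp add: g'_def rep_def)
  show "g' (f' i) = i" if "f' i \<noteq> 0"
  proof (cases "i = x")
    case True
    then show ?thesis using force_partner_neq by (simp add: f'_def g'_def)
  next
    case False
    then have "f' i = f i" "i \<noteq> g y" using that by (auto simp: f'_def split: if_splits)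
    moreover have "g (f i) = i" using r i that calculation by (auto simp: rep_def)
    ultimately show ?thesis by (auto simp: g'_def)
  qed
  show "f' (g' i) = i" if "g' i \<noteq> 0"
  proof (cases "i = y")
    case True
    then show ?thesis using force_partner_neq by (simp add: f'_def g'_def)
  next
    case False
    then have "g i \<noteq> 0" "g' i = g i" using that by (auto simp: g'_def)
    moreover have "f (g i) = i" using r i calculation by (auto simp: rep_def)
    moreover have "f (g y) = y" if "g y \<noteq> 0" using r y that by (auto simp: rep_def)
    ultimately have "g i \<noteq> x" "g i \<noteq> g y" using x y i False by auto
    then show ?thesis using \<open>g' i = g i\<close> \<open>f (g i) = i\<close> by (simp add: f'_def)
  qed
qed

lemma edges_of_force: "edges_of n f' = insert (x, y) (edges_of n f - {(g y, y)})"
proof -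
  have "f i \<noteq> y" if "i \<in> {1..n}" "i \<noteq> g y" for i using r that y by (auto simp: rep_def)
  moreover have "f (g y) = y" if "g y \<noteq> 0" using r y that by (auto simp: rep_def)
  ultimately show ?thesis
    unfolding edges_of_def f'_def using x y force_partner_neq by auto
qed

lemma force_new: "(x, y) \<notin> edges_of n f"
  using x y by (simp add: edges_of_def)

lemma force_old: "g y \<noteq> 0 \<Longrightarrow> (g y, y) \<in> edges_of n f"
  using r y by (auto simp: rep_def edges_of_def)

lemma force_none: "g y = 0 \<Longrightarrow> (a, y) \<notin> edges_of n f"
  using r y by (auto simp: rep_def edges_of_def)

lemma card_edges_of_force:
  "card (edges_of n f') = (if g y = 0 then Suc (card (edges_of n f)) else card (edges_of n f))"
proof (cases "g y = 0")
  case True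
  then show ?thesis
    using edges_of_force force_new force_none[OF True] edges_of_finite by simp
next
  case False
  then have "card (edges_of n f) > 0"
    using force_old[OF False] edges_of_finite[of n f] by (auto simp: card_gt_0_iff)
  then show ?thesis
    using edges_of_force force_new force_old[OF False] edges_of_finite[of n f] False
    by (simp add: card_Diff_singleton)
qed

end

lemma card_edges_of_mono:
  assumes "\<And>a. a \<in> {1..n} \<Longrightarrow> h a \<noteq> 0 \<Longrightarrow> f a \<noteq> 0"
  shows "card (edges_of n h) \<le> card (edges_of n f)"
proof -
  have card: "card (edges_of n f) = card {a\<in>{1..n}. f a \<noteq> 0}" for f
  proof -
    have "edges_of n f = (\<lambda>a. (a, f a)) ` {a\<in>{1..n}. f a \<noteq> 0}" by (auto simp: edges_of_def)
    then show ?thesis by (simp add: card_image inj_on_def)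
  qed
  show ?thesis unfolding card by (rule card_mono) (use assms in auto)
qed

subsection \<open>Switching a component of the symmetric difference\<close>

text \<open>While the optimal matching \<open>f\<close> is being transformed along one alternating path towards the
  optimal matching \<open>h\<close>, the set \<open>G\<close> collects the remaining edges of both: it is \<open>h\<close> switched along the
  same path. It is a matching except possibly at the current end \<open>x\<close> of the path.\<close>

definition walk_inv ::
  "nat \<Rightarrow> edges \<Rightarrow> (nat \<times> nat \<Rightarrow> real) \<Rightarrow> real \<Rightarrow> (nat \<Rightarrow> nat) \<Rightarrow> nat \<Rightarrow> (nat \<Rightarrow> nat) \<Rightarrow> bool" where
  "walk_inv n E \<omega> A h x f \<longleftrightarrow> edges_of n f \<subseteq> E \<and> (\<exists>G. G \<subseteq> E \<inter> {1..n} \<times> {1..n} \<and>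
     sum \<omega> (edges_of n f) + sum \<omega> G = 2 * A \<and> inj_on snd G \<and> matching n (G - {(x, h x)}) \<and>
     (f x = 0 \<and> h x \<noteq> 0 \<longrightarrow> (x, h x) \<in> G) \<and>
     (f x \<noteq> 0 \<or> h x = 0 \<longrightarrow> matching n G) \<and>
     (\<forall>a b. a \<noteq> x \<longrightarrow> f a \<noteq> h a \<longrightarrow> (a, b) \<in> G \<longleftrightarrow> b = h a \<and> b \<noteq> 0))"

lemma matching_subset: "matching n M \<Longrightarrow> N \<subseteq> M \<Longrightarrow> matching n N"
  unfolding matching_def by blast

lemma matching_insert:
  assumes "matching n M" "x \<in> {1..n}" "y \<in> {1..n}" "\<And>b. (x, b) \<notin> M" "\<And>a. (a, y) \<notin> M"
  shows "matching n (insert (x, y) M)"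
  using assms unfolding matching_def by (auto 0 3)

text \<open>When the walk rests, the counterpart is a matching as well. Two numbers that are at most
  \<open>A\<close> and add up to \<open>2 * A\<close> both equal \<open>A\<close>.\<close>

lemma walk_idle:
  assumes bd: "\<And>N. matching n N \<Longrightarrow> N \<subseteq> E \<Longrightarrow> sum \<omega> N \<le> A"
    and r: "rep n f g" and inv: "walk_inv n E \<omega> A h x f" and idle: "f x \<noteq> 0 \<or> h x = 0"
  shows "sum \<omega> (edges_of n f) = A"
proof -
  obtain G where "G \<subseteq> E" "edges_of n f \<subseteq> E" "sum \<omega> (edges_of n f) + sum \<omega> G = 2 * A" "matching n G"
    using inv idle unfolding walk_inv_def by blast
  with bd[of G] bd[of "edges_of n f"] rep_matching[OF r] show ?thesis by simp
qed

text \<open>Any optimal matching may begin a walk with the untouched target \<open>M\<close> as its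
  counterpart; the counterpart of the previous walk is discarded.\<close>

lemma walk_start:
  assumes h: "h = u_ptr M" "matching n M" "M \<subseteq> E" "sum \<omega> M = A"
    and f: "edges_of n f \<subseteq> E" "sum \<omega> (edges_of n f) = A"
  shows "walk_inv n E \<omega> A h x f"
  unfolding walk_inv_def
proof (intro conjI exI[of _ M])
  show "M \<subseteq> E \<inter> {1..n} \<times> {1..n}" using h by (auto simp: matching_def)
  show "inj_on snd M" using matching_inj_on_snd[OF h(2)] .
  have M: "(a, b) \<in> M \<longleftrightarrow> b = h a \<and> b \<noteq> 0" for a b
    using u_ptr_iff[OF h(2)] h(1) by simp
  show "f x = 0 \<and> h x \<noteq> 0 \<longrightarrow> (x, h x) \<in> M"
    "\<forall>a b. a \<noteq> x \<longrightarrow> f a \<noteq> h a \<longrightarrow> (a, b) \<in> M \<longleftrightarrow> b = h a \<and> b \<noteq> 0" using M by blast+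
qed (use h f in \<open>auto intro: matching_subset\<close>)

text \<open>With \<open>y = h x\<close> and \<open>z = g y\<close>, the edge \<open>(x, y)\<close>
  passes from \<open>G\<close> to the current matching and \<open>(z, y)\<close>, if present, passes
  back, so the sum of the weights is unchanged. Row \<open>z\<close> may then carry two edges of
  \<open>G\<close>, its target edge and the returned one; without the target edge \<open>G\<close>
  is a matching.\<close>

lemma walk_step:
  assumes inv: "walk_inv n E \<omega> A h x f" and r: "rep n f g" and h: "rep n h h'" "h 0 = 0" "f 0 = 0"
    and x: "x \<in> {1..n}" "f x = 0" "h x \<noteq> 0"
  shows "walk_inv n E \<omega> A h (g (h x)) (f(x := h x, g (h x) := 0))"
proof -
  define y where "y = h x"
  define z where "z = g y"
  define f' where "f' = f(x := y, z := 0)"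
  obtain G where fE: "edges_of n f \<subseteq> E" and G: "G \<subseteq> E \<inter> {1..n} \<times> {1..n}"
    "sum \<omega> (edges_of n f) + sum \<omega> G = 2 * A" "inj_on snd G" "matching n (G - {(x, y)})" "(x, y) \<in> G"
    and Gh: "\<And>a b. a \<noteq> x \<Longrightarrow> f a \<noteq> h a \<Longrightarrow> (a, b) \<in> G \<longleftrightarrow> b = h a \<and> b \<noteq> 0"
    using inv x unfolding walk_inv_def y_def by blast
  have y: "y \<in> {1..n}" "y \<noteq> 0" using h x by (auto simp: rep_def y_def)
  have fin: "finite G" by (rule finite_subset[OF G(1)]) auto
  have zx: "z \<noteq> x" using force_partner_neq[OF r x(1,2) y(1)] by (simp add: z_def)
  have edges': "edges_of n f' = insert (x, y) (edges_of n f - {(z, y)})"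
    using edges_of_force[OF r x(1,2) y(1)] by (simp add: f'_def z_def)
  have xy: "(x, y) \<notin> edges_of n f" using force_new[OF r x(1,2) y(1)] .
  have yG: "a = x" if "(a, y) \<in> G" for a using inj_onD[OF G(3) _ that G(5)] by simp
  have fin': "finite (edges_of n f)" by (rule edges_of_finite)
  have xyE: "(x, y) \<in> E" using G by auto
  define G' where "G' = (if z = 0 then G - {(x, y)} else insert (z, y) (G - {(x, y)}))"
  have z0: "edges_of n f - {(z, y)} = edges_of n f" if "z = 0"
    using that by (auto simp: edges_of_def)
  have zf: "(z, y) \<in> edges_of n f" "f z = y" "z \<in> {1..n}" if "z \<noteq> 0"
    using force_old[OF r x(1,2) y(1)] that by (auto simp: z_def edges_of_def)
  \<comment> \<open>The target matches \<open>y\<close> to \<open>x\<close>, so row \<open>z\<close>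
    disagreed with the target before the step; hence \<open>Gh\<close> describes row
    \<open>z\<close> of \<open>G\<close> completely.\<close>
  have hz: "h z \<noteq> y" if "z \<noteq> 0"
    using zx repD1[OF h(1) x(1,3)] repD1[OF h(1) zf(3)[OF that]] y(2) unfolding y_def by metis
  have G'E: "G' \<subseteq> E \<inter> {1..n} \<times> {1..n}"
    using G(1) zf fE y by (auto simp: G'_def)
  have sumG: "sum \<omega> (G - {(x, y)}) = sum \<omega> G - \<omega> (x, y)"
    using G(5) fin by (simp add: sum_diff1)
  have zyG: "(z, y) \<notin> G - {(x, y)}" using yG zx by auto
  have c1: "sum \<omega> (edges_of n f') + sum \<omega> G' = 2 * A"
  proof (cases "z = 0")
    case True
    then show ?thesis unfolding edges' z0[OF True] G'_def
      using xy fin' sumG G(2) by simp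
  next
    case False
    have "sum \<omega> (edges_of n f') = \<omega> (x, y) + (sum \<omega> (edges_of n f) - \<omega> (z, y))"
      unfolding edges' using xy fin' zf(1)[OF False] by (simp add: sum_diff1)
    moreover have "sum \<omega> G' = \<omega> (z, y) + (sum \<omega> G - \<omega> (x, y))"
      unfolding G'_def using False zyG fin sumG by simp
    ultimately show ?thesis using G(2) by simp
  qed
  have c2: "inj_on snd G'"
    using G(3) yG unfolding G'_def by (auto simp: inj_on_def)
  have m: "matching n (G' - {(z, h z)})"
  proof (cases "z = 0")
    case True
    then show ?thesis using G(4) by (auto simp: G'_def intro: matching_subset)
  next
    case False
    have "G' - {(z, h z)} = insert (z, y) ((G - {(x, y)}) - {(z, h z)})"
      unfolding G'_def using False hz[OF False] by auto
    also have "matching n \<dots>"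
    proof (rule matching_insert)
      show "matching n (G - {(x, y)} - {(z, h z)})" using G(4) by (rule matching_subset) auto
      show "(z, b) \<notin> G - {(x, y)} - {(z, h z)}" for b
        using Gh[OF zx, of b] zf(2)[OF False] hz[OF False] by auto
      show "(a, y) \<notin> G - {(x, y)} - {(z, h z)}" for a using yG by auto
    qed (use zf(3)[OF False] y in auto)
    finally show ?thesis .
  qed
  have c3: "f' z = 0 \<and> h z \<noteq> 0 \<longrightarrow> (z, h z) \<in> G'"
  proof (cases "z = 0")
    case False
    then show ?thesis using Gh[OF zx, of "h z"] zf(2)[OF False] hz[OF False] zx by (auto simp: G'_def)
  qed (use h in simp)
  have c4: "f' z \<noteq> 0 \<or> h z = 0 \<longrightarrow> matching n G'"
  proof
    assume "f' z \<noteq> 0 \<or> h z = 0"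
    then have "h z = 0" by (simp add: f'_def)
    then have "G' - {(z, h z)} = G'" using G'E by auto
    then show "matching n G'" using m by simp
  qed
  have c5: "\<forall>a b. a \<noteq> z \<longrightarrow> f' a \<noteq> h a \<longrightarrow> (a, b) \<in> G' \<longleftrightarrow> b = h a \<and> b \<noteq> 0"
  proof (intro allI impI)
    fix a b assume that: "a \<noteq> z" "f' a \<noteq> h a"
    have "a \<noteq> x" "f a \<noteq> h a" using that zx by (auto simp: f'_def y_def split: if_splits)
    then show "(a, b) \<in> G' \<longleftrightarrow> b = h a \<and> b \<noteq> 0" using Gh that by (auto simp: G'_def)
  qed
  have c6: "edges_of n f' \<subseteq> E" unfolding edges' using fE xyE by auto
  have "walk_inv n E \<omega> A h z f'"
    unfolding walk_inv_def by (intro conjI exI[of _ G'] c1 c2 c3 c4 c5 c6 m G'E)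
  then show ?thesis by (simp add: f'_def z_def y_def)
qed

text \<open>Row \<open>x\<close> comes to agree with \<open>h\<close>, and the released row
  disagreed already, because \<open>h\<close> matches \<open>h x\<close> to \<open>x\<close>. No row
  is spoiled, which bounds the total length of all walks in one gap by \<open>n\<close>.\<close>

lemma disagreement_decreases:
  assumes r: "rep n f g" and h: "rep n h h'"
    and x: "x \<in> {1..n}" "f x = 0" "h x \<noteq> 0"
  shows "card {a\<in>{1..n}. (f(x := h x, g (h x) := 0)) a \<noteq> h a} < card {a\<in>{1..n}. f a \<noteq> h a}"
proof (rule psubset_card_mono)
  have y: "h x \<in> {1..n}" using h x by (auto simp: rep_def)
  have zx: "g (h x) \<noteq> x" using force_partner_neq[OF r x(1,2) y] .
  have "f (g (h x)) \<noteq> h (g (h x))" if g: "g (h x) \<in> {1..n}"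
  proof -
    have "f (g (h x)) = h x" using repD2[OF r y] g by auto
    moreover have "h (g (h x)) \<noteq> h x"
      using zx repD1[OF h x(1,3)] repD1[OF h g] x(3) by metis
    ultimately show ?thesis by simp
  qed
  then have "{a\<in>{1..n}. (f(x := h x, g (h x) := 0)) a \<noteq> h a} \<subseteq> {a\<in>{1..n}. f a \<noteq> h a}" by auto
  moreover have "x \<in> {a\<in>{1..n}. f a \<noteq> h a}" "x \<notin> {a\<in>{1..n}. (f(x := h x, g (h x) := 0)) a \<noteq> h a}"
    using x zx by auto
  ultimately show "{a\<in>{1..n}. (f(x := h x, g (h x) := 0)) a \<noteq> h a} \<subset> {a\<in>{1..n}. f a \<noteq> h a}" by blast
qed simp

subsection \<open>Assignments as optimal matchings for shifted weights\<close>

definition finite_edges :: "(nat \<Rightarrow> nat \<Rightarrow> maxplus) \<Rightarrow> edges" where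
  "finite_edges W = {(i, j). val (W i j) \<noteq> - \<infinity>}"

definition shifted :: "(nat \<Rightarrow> nat \<Rightarrow> maxplus) \<Rightarrow> real \<Rightarrow> nat \<times> nat \<Rightarrow> real" where
  "shifted W c = (\<lambda>(i, j). real_of_ereal (val (W i j)) - c)"

text \<open>An assignment of size \<open>k\<close> has exponent \<open>n - k\<close>, so the value
  of its line at \<open>c\<close> is its shifted weight plus \<open>n * c\<close>. Subtracting
  \<open>n * c\<close> turns the envelope into the optimum of the shifted weights; the conversion to
  a real is faithful because the maximum is finite.\<close>

definition shifted_opt :: "nat \<Rightarrow> (nat \<Rightarrow> nat \<Rightarrow> maxplus) \<Rightarrow> real \<Rightarrow> real" where
  "shifted_opt n W c = real_of_ereal (max_fun (full_char_maxpoly n W) c) - real n * c"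

lemma weight_finite:
  assumes "finite N" "N \<subseteq> finite_edges W"
  shows "weight W N = ereal (\<Sum>(i, j)\<in>N. real_of_ereal (val (W i j)))"
proof -
  have "val (W i j) = ereal (real_of_ereal (val (W i j)))" if "(i, j) \<in> N" for i j
    using assms that val_neq_infinity[of "W i j"] by (cases "val (W i j)") (auto simp: finite_edges_def)
  then have "weight W N = (\<Sum>e\<in>N. ereal (case e of (i, j) \<Rightarrow> real_of_ereal (val (W i j))))"
    unfolding weight_def by (intro sum.cong) auto
  then show ?thesis by (simp add: case_prod_unfold)
qed

lemma weight_infinite:
  assumes "finite N" "\<not> N \<subseteq> finite_edges W"
  shows "weight W N = - \<infinity>"
proof -
  obtain i j where ij: "(i, j) \<in> N" "val (W i j) = - \<infinity>" using assms by (auto simp: finite_edges_def)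
  then have "W i j = 0" by (metis val_0 val_inject)
  \<comment> \<open>Minus infinity is the zero of the semiring, and the weight is the value of this
    product, so one infinite edge absorbs everything.\<close>
  then have "(\<Prod>e\<in>N. W (fst e) (snd e)) = 0" using assms(1) ij by (intro prod_zero) force+
  then have "(\<Sum>e\<in>N. val (W (fst e) (snd e))) = - \<infinity>" by (metis val_prod val_0)
  then show ?thesis by (simp add: weight_def case_prod_unfold)
qed

lemma weight_shifted:
  assumes "finite N" "N \<subseteq> finite_edges W"
  shows "weight W N = ereal (sum (shifted W c) N + real (card N) * c)"
  unfolding weight_finite[OF assms] shifted_def by (simp add: case_prod_unfold sum_subtractf)

context
  fixes n :: nat and W :: "nat \<Rightarrow> nat \<Rightarrow> maxplus" and p
  defines "p \<equiv> full_char_maxpoly n W"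
begin

lemma full_char_maxpoly_neq_0: "p \<noteq> 0"
  using val_coeff_n_ge[of n W] by (auto simp: p_def)

lemma max_fun_shifted: "max_fun p c = ereal (shifted_opt n W c + real n * c)"
  using max_fun_neq_infinity[OF full_char_maxpoly_neq_0, of c]
  by (cases "max_fun p c") (auto simp: shifted_opt_def p_def)

lemma term_val_shifted:
  assumes "is_assignment n W k M" "M \<subseteq> finite_edges W"
  shows "term_val p (n - k) c = ereal (sum (shifted W c) M + real n * c)"
proof -
  have M: "matching n M" "card M = k" using assms by (auto simp: is_assignment_def)
  then have "k \<le> n" using matching_card_le by blast
  then show ?thesis
    unfolding term_val_def p_def is_assignment_coeff[OF assms(1)]
      weight_shifted[OF matching_finite[OF M(1)] assms(2), of c]
    using M by (simp add: algebra_simps of_nat_diff)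
qed

lemma sum_shifted_le:
  assumes "matching n N" "N \<subseteq> finite_edges W"
  shows "sum (shifted W c) N \<le> shifted_opt n W c"
proof -
  have "ereal (sum (shifted W c) N + real n * c) = weight W N + ereal (real (n - card N) * c)"
    unfolding weight_shifted[OF matching_finite[OF assms(1)] assms(2), of c]
    using matching_card_le[OF assms(1)] by (simp add: algebra_simps of_nat_diff)
  also have "\<dots> \<le> term_val p (n - card N) c"
    unfolding term_val_def p_def using weight_le_coeff[OF assms(1)] by (intro add_right_mono)
  also have "\<dots> \<le> max_fun p c" by (rule term_val_le_max_fun) (simp add: p_def degree_full_char_maxpoly)
  finally show ?thesis unfolding max_fun_shifted by simp
qed

text \<open>An active term has a finite coefficient, so its assignments avoid the infinite edges,
  and their shifted weight can be read off the envelope.\<close>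

lemma active_assignment:
  assumes "is_assignment n W k M" "active p (n - k) c"
  shows "M \<subseteq> finite_edges W" "sum (shifted W c) M = shifted_opt n W c"
proof -
  have fin: "finite M" using assms matching_finite by (auto simp: is_assignment_def)
  have "val (coeff p (n - k)) \<noteq> - \<infinity>"
    using active_coeff_finite[OF full_char_maxpoly_neq_0 assms(2)] .
  then show M: "M \<subseteq> finite_edges W"
    using weight_infinite[OF fin] is_assignment_coeff[OF assms(1)] unfolding p_def by metis
  show "sum (shifted W c) M = shifted_opt n W c"
    using term_val_shifted[OF assms(1) M, of c] assms(2) unfolding active_def max_fun_shifted by simp
qed

text \<open>Within one size the shift changes all weights by the same amount, so being optimal over
  all sizes implies being optimal within the own size; the attained value puts the term on the
  envelope. This turns a matching at which a walk rests into an assignment.\<close>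

lemma optimal_imp_assignment:
  assumes M: "matching n M" "M \<subseteq> finite_edges W" and opt: "sum (shifted W c) M = shifted_opt n W c"
  shows "is_assignment n W (card M) M" and "active p (n - card M) c"
proof -
  have fin: "finite M" using M matching_finite by blast
  have "weight W N \<le> weight W M" if N: "matching n N" "card N = card M" for N
  proof (cases "N \<subseteq> finite_edges W")
    case True
    then show ?thesis
      using sum_shifted_le[OF N(1) True, of c] opt N(2)
      unfolding weight_shifted[OF matching_finite[OF N(1)] True, of c] weight_shifted[OF fin M(2), of c]
      by simp
  next
    case False
    then show ?thesis using weight_infinite[OF matching_finite[OF N(1)]] by simp
  qed
  then show a: "is_assignment n W (card M) M" using M by (simp add: is_assignment_def)
  show "active p (n - card M) c"
    unfolding active_def max_fun_shifted term_val_shifted[OF a M(2)]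
    by (simp add: opt p_def degree_full_char_maxpoly)
qed

end

subsection \<open>Filling the gaps between adjacent terms\<close>

definition emit :: prog where
  "emit = Seq
    (For ''j'' (Seq
      (NWrite ''outu'' (NVar ''kk'') (NVar ''j'') (NArr ''cu'' (NVar ''j'')))
      (NWrite ''outv'' (NVar ''kk'') (NVar ''j'') (NArr ''cv'' (NVar ''j'')))))
    (NWrite ''out'' (NVar ''kk'') (NConst 0) (NConst 1))"

lemma nwr_emit [simp]: "nwr emit = {''j'', ''outu'', ''outv'', ''out''}"
  and wwr_emit [simp]: "wwr emit = {}"
  by (auto simp: emit_def)

lemma halts_within_emit:
  assumes n: "nmem s ''n'' 0 0 = n" "n \<ge> 1"
    and out: "outputs_assignments n W S s"
    and r: "rep n (nmem s ''cu'' 0) (nmem s ''cv'' 0)"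
    and opt: "is_assignment n W (nmem s ''kk'' 0 0) (edges_of n (nmem s ''cu'' 0))"
  shows "halts_within emit s (60 * n)
    (\<lambda>s'. outputs_assignments n W (insert (nmem s ''kk'' 0 0) S) s' \<and> frame (nwr emit) {} s s')"
proof -
  let ?k = "nmem s ''kk'' 0 0"
  let ?P = "Seq
      (NWrite ''outu'' (NVar ''kk'') (NVar ''j'') (NArr ''cu'' (NVar ''j'')))
      (NWrite ''outv'' (NVar ''kk'') (NVar ''j'') (NArr ''cv'' (NVar ''j'')))"
  define I where "I = (\<lambda>(i :: nat) (s' :: state). (\<forall>m a. m \<noteq> ?k \<longrightarrow> nmem s' ''outu'' m a = nmem s ''outu'' m a) \<and>
    (\<forall>m a. m \<noteq> ?k \<longrightarrow> nmem s' ''outv'' m a = nmem s ''outv'' m a) \<and>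
    (\<forall>a. 1 \<le> a \<longrightarrow> a < i \<longrightarrow> nmem s' ''outu'' ?k a = nmem s ''cu'' 0 a \<and> nmem s' ''outv'' ?k a = nmem s ''cv'' 0 a))"
  have "halts_within (For ''j'' ?P) s ((24 + 30) * n)
    (\<lambda>s'. I (Suc n) s' \<and> frame (insert ''j'' (nwr ?P)) (wwr ?P) s s')"
  proof (rule halts_within_For[OF n])
    show "I 1 (set_n s ''j'' 1)" by (auto simp: I_def)
    fix i s' assume fr: "frame (insert ''j'' (nwr ?P)) (wwr ?P) s s'" "nmem s' ''j'' 0 0 = i" "I i s'"
    have eq: "nmem s' ''kk'' = nmem s ''kk''" "nmem s' ''cu'' = nmem s ''cu''" "nmem s' ''cv'' = nmem s ''cv''"
      using frame_nmem[OF fr(1)] by auto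
    show "halts_within ?P s' 24 (\<lambda>s''. I (Suc i) (set_n s'' ''j'' (Suc i)))"
      by (rule halts_within_straight) (use fr eq in \<open>auto simp: I_def upd_apply less_Suc_eq\<close>)
  qed auto
  then have "halts_within emit s ((24 + 30) * n + 6) (outputs_assignments n W (insert ?k S))"
    unfolding emit_def
  proof (rule halts_within_Seq)
    fix s' assume s': "I (Suc n) s' \<and> frame (insert ''j'' (nwr ?P)) (wwr ?P) s s'"
    then have fr: "frame (insert ''j'' (nwr ?P)) (wwr ?P) s s'" and I: "I (Suc n) s'" by auto
    have eq: "nmem s' ''kk'' = nmem s ''kk''" "nmem s' ''out'' = nmem s ''out''"
      using frame_nmem[OF fr] by auto
    have cur: "\<exists>M. is_assignment n W ?k M \<and> (\<forall>i\<in>{1..n}. nmem s' ''outu'' ?k i = u_ptr M i) \<and>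
        (\<forall>j\<in>{1..n}. nmem s' ''outv'' ?k j = v_ptr M j)"
      using is_assignment_pointers[OF r opt] I by (fastforce simp: I_def)
    have "\<exists>M. is_assignment n W m M \<and> (\<forall>i\<in>{1..n}. nmem s' ''outu'' m i = u_ptr M i) \<and>
        (\<forall>j\<in>{1..n}. nmem s' ''outv'' m j = v_ptr M j)" if "m \<in> insert ?k S" for m
    proof (cases "m = ?k")
      case False
      then have "m \<in> S" using that by simp
      with out have "\<exists>M. is_assignment n W m M \<and> (\<forall>i\<in>{1..n}. nmem s ''outu'' m i = u_ptr M i) \<and>
        (\<forall>j\<in>{1..n}. nmem s ''outv'' m j = v_ptr M j)" by (simp add: outputs_assignments_def)
      then show ?thesis using I False by (simp add: I_def)
    qed (use cur in simp)
    then show "halts_within (NWrite ''out'' (NVar ''kk'') (NConst 0) (NConst 1)) s' 6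
        (outputs_assignments n W (insert ?k S))"
      by (intro halts_within_straight)
        (use out eq in \<open>auto simp: outputs_assignments_def upd_apply\<close>)
  qed
  from halts_within_frame[OF this] show ?thesis
    by (rule halts_within_weaken) (use n in auto)
qed

text \<open>If column \<open>y\<close> was free, \<open>z\<close> is null and the write of 0 to
  \<open>cu\<close> goes to cell 0, which holds 0 anyway. The released row becomes the next end of
  the path.\<close>

definition force :: prog where
  "force = Seq (NSet ''z'' (NArr ''cv'' (NVar ''y'')))
    (Seq (NSetArr ''cu'' (NVar ''x'') (NVar ''y''))
    (Seq (NSetArr ''cu'' (NVar ''z'') (NConst 0))
    (Seq (NSetArr ''cv'' (NVar ''y'') (NVar ''x''))
      (NSet ''x'' (NVar ''z'')))))"

text \<open>The size grows exactly when the forced column was free. Then \<open>x\<close> is null,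
  and the next round finds the null row idle, since its pointers are 0 in both matchings; the scan
  index \<open>i\<close> advances as after any other finished walk.\<close>

definition walk_body :: prog where
  "walk_body = Seq (NSet ''y'' (NRead ''u'' (NPlus (NVar ''t'') (NConst 1)) (NVar ''x'')))
    (Cond (BAnd (NEq (NArr ''cu'' (NVar ''x'')) (NConst 0)) (BNot (NEq (NVar ''y'') (NConst 0))))
      (Seq force
        (Cond (NEq (NVar ''z'') (NConst 0))
          (Seq (NSet ''kk'' (NPlus (NVar ''kk'') (NConst 1))) emit)
          Skip))
      (Seq (NSet ''i'' (NPlus (NVar ''i'') (NConst 1))) (NSet ''x'' (NVar ''i''))))"

text \<open>The loop stops one size short of the next entry, which belongs to the input and must not
  be emitted.\<close>

definition walk_cond :: bexp where
  "walk_cond = NLess (NPlus (NVar ''kk'') (NConst 1)) (NRead ''k'' (NPlus (NVar ''t'') (NConst 1)) (NConst 0))"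

definition load :: prog where
  "load = For ''j'' (Seq
      (NSetArr ''cu'' (NVar ''j'') (NRead ''u'' (NVar ''t'') (NVar ''j'')))
      (NSetArr ''cv'' (NVar ''j'') (NRead ''v'' (NVar ''t'') (NVar ''j''))))"

text \<open>The current matching is reloaded for every gap, because the preceding walk stopped
  before reaching the listed entry. The linear cost is covered, as every gap counts at least
  1.\<close>

definition fill_gap :: prog where
  "fill_gap = Seq load
    (Seq (Seq (NSet ''kk'' (NRead ''k'' (NVar ''t'') (NConst 0)))
      (Seq (NSet ''i'' (NConst 1)) (NSet ''x'' (NConst 1))))
      (While walk_cond walk_body))"

definition fill_gaps :: prog where
  "fill_gaps = While (NLess (NPlus (NVar ''t'') (NConst 1)) (NVar ''len''))
    (Seq fill_gap (NSet ''t'' (NPlus (NVar ''t'') (NConst 1))))"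

definition gap_names :: "name set" where
  "gap_names = {''j'', ''outu'', ''outv'', ''out'', ''y'', ''z'', ''x'', ''cu'', ''cv'', ''kk'', ''i''}"

lemma outputs_assignments_cong:
  assumes "nmem s' ''out'' = nmem s ''out''" "nmem s' ''outu'' = nmem s ''outu''"
    "nmem s' ''outv'' = nmem s ''outv''"
  shows "outputs_assignments n W S s' = outputs_assignments n W S s"
  using assms by (simp add: outputs_assignments_def)

section \<open>The walk through one gap\<close>

context
  fixes n :: nat and W :: "nat \<Rightarrow> nat \<Rightarrow> maxplus" and k k' t :: nat and M M' :: edges and c :: real
    and s0 :: state and S :: "nat set"
  assumes n: "n \<ge> 1" and kk': "k < k'"
    and M: "is_assignment n W k M" "active (full_char_maxpoly n W) (n - k) c"
    and M': "is_assignment n W k' M'" "active (full_char_maxpoly n W) (n - k') c"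
    and s0: "nmem s0 ''n'' 0 0 = n" "nmem s0 ''t'' 0 0 = t" "nmem s0 ''k'' t 0 = k" "nmem s0 ''k'' (Suc t) 0 = k'"
      "nmem s0 ''u'' t = u_ptr M" "nmem s0 ''v'' t = v_ptr M" "nmem s0 ''u'' (Suc t) = u_ptr M'"
      "nmem s0 ''cu'' 0 0 = 0" "outputs_assignments n W S s0"
begin

text \<open>The clause on rows up to \<open>i\<close> says that a scanned row needs no further walk;
  the only exception is the end \<open>x\<close> of the current path. The last clause records that
  the emitted terms are active, which later shows that they are semi-essential.\<close>

definition gap_inv :: "state \<Rightarrow> bool" where
  "gap_inv s \<longleftrightarrow> frame gap_names {} s0 s \<and> rep n (nmem s ''cu'' 0) (nmem s ''cv'' 0) \<and>
    nmem s ''cu'' 0 0 = 0 \<and> card (edges_of n (nmem s ''cu'' 0)) = nmem s ''kk'' 0 0 \<and>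
    k \<le> nmem s ''kk'' 0 0 \<and> nmem s ''kk'' 0 0 < k' \<and>
    walk_inv n (finite_edges W) (shifted W c) (shifted_opt n W c) (u_ptr M') (nmem s ''x'' 0 0) (nmem s ''cu'' 0) \<and>
    (\<forall>a\<in>{1..n}. a \<le> nmem s ''i'' 0 0 \<longrightarrow> a \<noteq> nmem s ''x'' 0 0 \<longrightarrow> nmem s ''cu'' 0 a \<noteq> 0 \<or> u_ptr M' a = 0) \<and>
    outputs_assignments n W (S \<union> {k<..nmem s ''kk'' 0 0}) s \<and>
    (\<forall>m\<in>{k<..nmem s ''kk'' 0 0}. active (full_char_maxpoly n W) (n - m) c)"

text \<open>Disagreeing rows pay for forcing steps, unscanned rows for idle steps, and missing sizes
  for the output. A round apart from its output costs at most 80, and the next test 14.\<close>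

definition gap_pot :: "state \<Rightarrow> nat" where
  "gap_pot s = 100 * card {a\<in>{1..n}. nmem s ''cu'' 0 a \<noteq> u_ptr M' a} + 100 * (Suc n - nmem s ''i'' 0 0)
    + 60 * (n * (k' - nmem s ''kk'' 0 0))"

lemma matchings: "matching n M" "card M = k" "matching n M'" "card M' = k'"
  using M M' by (auto simp: is_assignment_def)

lemma bound_shifted: "matching n N \<Longrightarrow> N \<subseteq> finite_edges W \<Longrightarrow> sum (shifted W c) N \<le> shifted_opt n W c"
  by (rule sum_shifted_le)

lemma halts_within_walk_body:
  assumes inv: "gap_inv s" and b: "bval walk_cond s"
  shows "\<exists>t. halts_within walk_body s t (\<lambda>s'. gap_inv s' \<and> t + (1 + bcost walk_cond) + gap_pot s' \<le> gap_pot s)"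
proof -
  let ?f = "nmem s ''cu'' 0" and ?g = "nmem s ''cv'' 0" and ?x = "nmem s ''x'' 0 0" and ?i = "nmem s ''i'' 0 0"
    and ?kk = "nmem s ''kk'' 0 0"
  let ?winv = "walk_inv n (finite_edges W) (shifted W c) (shifted_opt n W c) (u_ptr M')"
  have fr: "frame gap_names {} s0 s" and r: "rep n ?f ?g" and f0: "?f 0 = 0"
    and card: "card (edges_of n ?f) = ?kk" and kk: "k \<le> ?kk" "?kk < k'"
    and winv: "?winv ?x ?f"
    and dn: "\<And>a. a \<in> {1..n} \<Longrightarrow> a \<le> ?i \<Longrightarrow> a \<noteq> ?x \<Longrightarrow> ?f a \<noteq> 0 \<or> u_ptr M' a = 0"
    and out: "outputs_assignments n W (S \<union> {k<..?kk}) s"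
    and act: "\<forall>m\<in>{k<..?kk}. active (full_char_maxpoly n W) (n - m) c"
    using inv unfolding gap_inv_def by auto
  have same: "nmem s ''n'' = nmem s0 ''n''" "nmem s ''t'' = nmem s0 ''t''" "nmem s ''k'' = nmem s0 ''k''"
    "nmem s ''u'' = nmem s0 ''u''"
    using frame_nmem[OF fr] by (auto simp: gap_names_def)
  have less: "Suc ?kk < k'" using b same s0 by (simp add: walk_cond_def)
  define y where "y = u_ptr M' ?x"
  define s1 where "s1 = s\<lparr>nmem := upd (nmem s) ''y'' 0 0 y\<rparr>"
  let ?P1 = "NSet ''y'' (NRead ''u'' (NPlus (NVar ''t'') (NConst 1)) (NVar ''x''))"
  have P1: "straight ?P1" "run ?P1 s = s1" "tm ?P1 = 12"
    using same s0 by (auto simp: s1_def y_def)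
  have first: "halts_within (Seq ?P1 Q) s (12 + T) R" if "halts_within Q s1 T R" for Q T R
    using halts_within_Seq_straight[OF P1(1), of Q s T R] that unfolding P1(2,3) .
  have u0: "u_ptr M' 0 = 0" using u_ptr_outside[OF matchings(3)] by simp
  show ?thesis
  proof (cases "?f ?x = 0 \<and> y \<noteq> 0")
    case False
    then have idle: "?f ?x \<noteq> 0 \<or> u_ptr M' ?x = 0" by (simp add: y_def)
    have opt: "sum (shifted W c) (edges_of n ?f) = shifted_opt n W c"
      by (rule walk_idle[OF bound_shifted r winv idle])
    \<comment> \<open>Past the last row, the current matching would cover every row of
      \<open>M'\<close> and so have at least \<open>k'\<close> edges.\<close>
    have "?i \<le> n"
    proof (rule ccontr)
      assume "\<not> ?i \<le> n"
      then have all: "?f a \<noteq> 0 \<or> u_ptr M' a = 0" if "a \<in> {1..n}" for a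
        using dn[OF that] that idle by (cases "a = ?x") auto
      have "card (edges_of n (u_ptr M')) \<le> card (edges_of n ?f)"
      proof (rule card_edges_of_mono)
        fix a assume a: "a \<in> {1..n}" "u_ptr M' a \<noteq> 0"
        show "?f a \<noteq> 0" using all[OF a(1)] a(2) by simp
      qed
      then show False using card kk edges_of_u_ptr[OF matchings(3)] matchings(4) by simp
    qed
    have winv': "?winv (Suc ?i) ?f"
      by (rule walk_start[OF refl matchings(3) active_assignment[OF M'] _ opt])
        (use winv in \<open>simp add: walk_inv_def\<close>)
    define s2 where "s2 = s1\<lparr>nmem := upd (upd (nmem s1) ''i'' 0 0 (Suc ?i)) ''x'' 0 0 (Suc ?i)\<rparr>"
    have eqs: "nmem s2 ''cu'' = nmem s ''cu''" "nmem s2 ''cv'' = nmem s ''cv''" "nmem s2 ''kk'' = nmem s ''kk''"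
       "nmem s2 ''x'' 0 0 = Suc ?i" "nmem s2 ''i'' 0 0 = Suc ?i" "nmem s2 ''out'' = nmem s ''out''"
       "nmem s2 ''outu'' = nmem s ''outu''" "nmem s2 ''outv'' = nmem s ''outv''"
      by (auto simp: s2_def s1_def upd_apply fun_eq_iff)
    have "frame gap_names {} s s2"
      by (auto simp: frame_def s2_def s1_def upd_def gap_names_def)
    then have fr': "frame gap_names {} s0 s2" by (rule frame_trans[OF fr])
    have "gap_inv s2"
      unfolding gap_inv_def eqs outputs_assignments_cong[OF eqs(6,7,8)]
    proof (intro conjI ballI impI)
      fix a assume a: "a \<in> {1..n}" "a \<le> Suc ?i" "a \<noteq> Suc ?i"
      show "?f a \<noteq> 0 \<or> u_ptr M' a = 0"
        using dn[of a] a idle by (cases "a = ?x") auto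
    qed (use fr' r f0 card kk winv' out act in auto)
    moreover have "Suc n - ?i = Suc (Suc n - Suc ?i)" using \<open>?i \<le> n\<close> by simp
    then have "gap_pot s = gap_pot s2 + 100"
      unfolding gap_pot_def eqs by simp
    moreover have "halts_within walk_body s 50 (\<lambda>s'. s' = s2)"
      unfolding walk_body_def
    proof (rule halts_within_weaken[OF halts_within_Seq_straight[OF P1(1)]])
      show "halts_within
        (Cond (BAnd (NEq (NArr ''cu'' (NVar ''x'')) (NConst 0)) (BNot (NEq (NVar ''y'') (NConst 0))))
          (Seq force (Cond (NEq (NVar ''z'') (NConst 0))
             (Seq (NSet ''kk'' (NPlus (NVar ''kk'') (NConst 1))) emit) Skip))
          (Seq (NSet ''i'' (NPlus (NVar ''i'') (NConst 1))) (NSet ''x'' (NVar ''i''))))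
        (run ?P1 s) (1 + 14 + 20) (\<lambda>s'. s' = s2)"
        unfolding P1
        by (rule halts_within_weaken[OF halts_within_CondFalse[OF _ halts_within_straight[where T = 20]]])
          (use False in \<open>auto simp: s1_def s2_def upd_apply\<close>)
    qed (use P1 in auto)
    ultimately show ?thesis
      by (intro exI[of _ 50]) (erule halts_within_weaken, auto simp: walk_cond_def)
  next
    case True
    then have fx: "?f ?x = 0" and hx: "u_ptr M' ?x \<noteq> 0" by (auto simp: y_def)
    have x: "?x \<in> {1..n}" using u_ptr_outside[OF matchings(3), of ?x] hx by argo
    have h: "rep n (u_ptr M') (v_ptr M')" by (rule rep_ptr[OF matchings(3)])
    have y: "y \<in> {1..n}" using repD1[OF h x hx] by (simp add: y_def)
    define z where "z = ?g y"
    define f' where "f' = ?f(?x := y, z := 0)"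
    define g' where "g' = ?g(y := ?x)"
    have r': "rep n f' g'"
      using rep_force[OF r x fx y] by (simp add: f'_def g'_def z_def)
    have card': "card (edges_of n f') = (if z = 0 then Suc ?kk else ?kk)"
      using card_edges_of_force[OF r x fx y] card by (simp add: f'_def z_def)
    have winv': "?winv z f'"
      using walk_step[OF winv r h u0 f0 x fx hx] by (simp add: f'_def z_def y_def)
    have f'0: "f' 0 = 0" using f0 x by (auto simp: f'_def)
    have dis: "Suc (card {a\<in>{1..n}. f' a \<noteq> u_ptr M' a}) \<le> card {a\<in>{1..n}. ?f a \<noteq> u_ptr M' a}"
      using disagreement_decreases[OF r h x fx hx] by (simp add: f'_def z_def y_def)
    have zx: "z \<noteq> ?x" using force_partner_neq[OF r x fx y] by (simp add: z_def)
    have dn': "f' a \<noteq> 0 \<or> u_ptr M' a = 0" if "a \<in> {1..n}" "a \<le> ?i" "a \<noteq> z" for a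
      using dn[of a] that y by (cases "a = ?x") (auto simp: f'_def)
    define s2 where "s2 = run force s1"
    have eqs: "nmem s2 ''cu'' 0 = f'" "nmem s2 ''cv'' 0 = g'" "nmem s2 ''kk'' = nmem s ''kk''"
       "nmem s2 ''x'' 0 0 = z" "nmem s2 ''z'' 0 0 = z" "nmem s2 ''i'' = nmem s ''i''" "nmem s2 ''out'' = nmem s ''out''"
       "nmem s2 ''outu'' = nmem s ''outu''" "nmem s2 ''outv'' = nmem s ''outv''" "nmem s2 ''n'' = nmem s ''n''"
      using zx by (auto simp: s2_def force_def s1_def upd_apply fun_eq_iff f'_def g'_def z_def)
    have "frame gap_names {} s s2"
      by (auto simp: frame_def s2_def s1_def force_def upd_def gap_names_def)
    then have fr': "frame gap_names {} s0 s2" by (rule frame_trans[OF fr])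
    have bT: "bval (BAnd (NEq (NArr ''cu'' (NVar ''x'')) (NConst 0)) (BNot (NEq (NVar ''y'') (NConst 0)))) s1"
      using fx True by (auto simp: s1_def upd_apply)
    have force: "straight force" "tm force = 36" by (auto simp: force_def)
    show ?thesis
    proof (cases "z = 0")
      case False
      have "gap_inv s2"
        unfolding gap_inv_def eqs outputs_assignments_cong[OF eqs(7,8,9)]
        using fr' r' f'0 card' False kk winv' dn' out act by auto
      moreover have "gap_pot s2 + 100 \<le> gap_pot s"
        unfolding gap_pot_def eqs using dis by simp
      moreover have "halts_within walk_body s 80 (\<lambda>s'. s' = s2)"
      proof -
        let ?P3 = "Seq (NSet ''kk'' (NPlus (NVar ''kk'') (NConst 1))) emit"
        have "halts_within (Cond (NEq (NVar ''z'') (NConst 0)) ?P3 Skip) (run force s1)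
            (1 + bcost (NEq (NVar ''z'') (NConst 0)) + 1) (\<lambda>s'. s' = s2)"
          by (intro halts_within_CondFalse halts_within_straight)
            (use False eqs(5) in \<open>simp_all add: s2_def\<close>)
        note halts_within_CondTrue[OF bT halts_within_Seq_straight[OF force(1) this]]
        note first[OF this]
        then show ?thesis
          unfolding walk_body_def by (rule halts_within_weaken) (simp_all add: force P1)
      qed
      ultimately show ?thesis
        by (intro exI[of _ 80]) (erule halts_within_weaken, auto simp: walk_cond_def)
    next
      case True
      \<comment> \<open>The path ended in a free column, so its end is the null row. The target
        pointer there is 0, hence the walk rests and the enlarged matching is optimal.\<close>
      have opt: "sum (shifted W c) (edges_of n f') = shifted_opt n W c"
        by (rule walk_idle[OF bound_shifted r' winv']) (use u0 True in auto)
      have fin: "edges_of n f' \<subseteq> finite_edges W" using winv' by (simp add: walk_inv_def)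
      have ass: "is_assignment n W (Suc ?kk) (edges_of n f')"
        using optimal_imp_assignment(1)[OF rep_matching[OF r'] fin opt] card' True by simp
      have act': "\<forall>m\<in>{k<..Suc ?kk}. active (full_char_maxpoly n W) (n - m) c"
        using optimal_imp_assignment(2)[OF rep_matching[OF r'] fin opt] card' True act
        by (auto simp: le_Suc_eq)
      let ?P3 = "NSet ''kk'' (NPlus (NVar ''kk'') (NConst 1))"
      define s3 where "s3 = run ?P3 s2"
      have eqs3: "nmem s3 ''cu'' 0 = f'" "nmem s3 ''cv'' 0 = g'" "nmem s3 ''kk'' 0 0 = Suc ?kk"
         "nmem s3 ''x'' 0 0 = z" "nmem s3 ''i'' = nmem s ''i''" "nmem s3 ''out'' = nmem s ''out''"
         "nmem s3 ''outu'' = nmem s ''outu''" "nmem s3 ''outv'' = nmem s ''outv''" "nmem s3 ''n'' 0 0 = n"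
        using eqs same s0 by (auto simp: s3_def upd_apply fun_eq_iff)
      have fr3: "frame gap_names {} s0 s3"
        by (rule frame_trans[OF fr']) (auto simp: s3_def frame_def upd_def gap_names_def)
      have set: "insert (Suc ?kk) (S \<union> {k<..?kk}) = S \<union> {k<..Suc ?kk}" using kk by auto
      have "halts_within emit s3 (60 * n)
        (\<lambda>s'. outputs_assignments n W (S \<union> {k<..Suc ?kk}) s' \<and> frame (nwr emit) {} s3 s')"
        using halts_within_emit[OF eqs3(9) n, of W "S \<union> {k<..?kk}"] out r' ass
        unfolding eqs3 outputs_assignments_cong[OF eqs3(6,7,8)] set by simp
      then have "halts_within emit s3 (60 * n) (\<lambda>s'. gap_inv s' \<and> gap_pot s' + 100 + 60 * n \<le> gap_pot s)"
      proof (rule halts_within_weaken)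
        fix s' assume s': "outputs_assignments n W (S \<union> {k<..Suc ?kk}) s' \<and> frame (nwr emit) {} s3 s'"
        then have fr4: "frame (nwr emit) {} s3 s'" by simp
        have eqs': "nmem s' ''cu'' 0 = f'" "nmem s' ''cv'' 0 = g'" "nmem s' ''kk'' 0 0 = Suc ?kk"
          "nmem s' ''x'' 0 0 = z" "nmem s' ''i'' = nmem s ''i''"
          using frame_nmem[OF fr4] eqs3 by auto
        have "frame gap_names {} s0 s'"
          by (rule frame_trans[OF fr3 frame_mono[OF fr4]]) (auto simp: gap_names_def)
        then have "gap_inv s'"
          unfolding gap_inv_def eqs'
          using r' f'0 card' True kk less winv' dn' s' act' by auto
        moreover have "k' - ?kk = Suc (k' - Suc ?kk)" using less by simp
        then have "gap_pot s' + 100 + 60 * n \<le> gap_pot s"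
          unfolding gap_pot_def eqs' using dis by simp
        ultimately show "gap_inv s' \<and> gap_pot s' + 100 + 60 * n \<le> gap_pot s" ..
      qed simp
      then have "halts_within (Seq ?P3 emit) s2 (tm ?P3 + 60 * n) (\<lambda>s'. gap_inv s' \<and> gap_pot s' + 100 + 60 * n \<le> gap_pot s)"
        by (intro halts_within_Seq_straight) (simp_all add: s3_def)
      then have "halts_within (Cond (NEq (NVar ''z'') (NConst 0)) (Seq ?P3 emit) Skip) (run force s1)
          (1 + bcost (NEq (NVar ''z'') (NConst 0)) + (tm ?P3 + 60 * n)) (\<lambda>s'. gap_inv s' \<and> gap_pot s' + 100 + 60 * n \<le> gap_pot s)"
        by (intro halts_within_CondTrue) (use True eqs(5) in \<open>simp_all add: s2_def\<close>)
      note halts_within_CondTrue[OF bT halts_within_Seq_straight[OF force(1) this]]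
      note first[OF this]
      then have "halts_within walk_body s (80 + 60 * n) (\<lambda>s'. gap_inv s' \<and> gap_pot s' + 100 + 60 * n \<le> gap_pot s)"
        unfolding walk_body_def by (rule halts_within_weaken) (simp_all add: force P1)
      then show ?thesis
        by (intro exI[of _ "80 + 60 * n"]) (erule halts_within_weaken, auto simp: walk_cond_def)
    qed
  qed
qed

lemma halts_within_fill_gap:
  "halts_within fill_gap s0 (400 * (n * (k' - k)))
    (\<lambda>s. outputs_assignments n W (S \<union> {k<..<k'}) s \<and>
      (\<forall>m\<in>{k<..<k'}. active (full_char_maxpoly n W) (n - m) c) \<and>
      nmem s ''cu'' 0 0 = 0 \<and> frame gap_names {} s0 s)"
  (is "halts_within _ _ _ ?post")
proof -
  let ?body = "Seq
      (NSetArr ''cu'' (NVar ''j'') (NRead ''u'' (NVar ''t'') (NVar ''j'')))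
      (NSetArr ''cv'' (NVar ''j'') (NRead ''v'' (NVar ''t'') (NVar ''j'')))"
  define I where "I = (\<lambda>(i :: nat) (s :: state). nmem s ''cu'' 0 0 = 0 \<and>
    (\<forall>a. 1 \<le> a \<longrightarrow> a < i \<longrightarrow> nmem s ''cu'' 0 a = u_ptr M a \<and> nmem s ''cv'' 0 a = v_ptr M a))"
  let ?P = "Seq (NSet ''kk'' (NRead ''k'' (NVar ''t'') (NConst 0))) (Seq (NSet ''i'' (NConst 1)) (NSet ''x'' (NConst 1)))"
  have load: "halts_within load s0 ((24 + 30) * n)
      (\<lambda>s. I (Suc n) s \<and> frame (insert ''j'' (nwr ?body)) (wwr ?body) s0 s)"
    unfolding load_def
  proof (rule halts_within_For[OF s0(1) n])
    show "I 1 (set_n s0 ''j'' 1)" using s0 by (simp add: I_def)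
    fix i s assume i: "1 \<le> i" "i \<le> n" and fr: "frame (insert ''j'' (nwr ?body)) (wwr ?body) s0 s"
      and j: "nmem s ''j'' 0 0 = i" and I: "I i s"
    have same: "nmem s ''u'' = nmem s0 ''u''" "nmem s ''v'' = nmem s0 ''v''" "nmem s ''t'' = nmem s0 ''t''"
      using frame_nmem[OF fr] by auto
    show "halts_within ?body s 24 (\<lambda>s'. I (Suc i) (set_n s' ''j'' (Suc i)))"
      by (rule halts_within_straight)
        (use same s0 I j i in \<open>auto simp: I_def upd_apply less_Suc_eq\<close>)
  qed auto
  have "halts_within fill_gap s0 ((24 + 30) * n + (tm ?P + (200 * n + 60 * (n * (k' - k)) + (1 + bcost walk_cond))))
    ?post"
    unfolding fill_gap_def
  proof (rule halts_within_Seq[OF load])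
    fix s assume s: "I (Suc n) s \<and> frame (insert ''j'' (nwr ?body)) (wwr ?body) s0 s"
    then have fr: "frame (insert ''j'' (nwr ?body)) (wwr ?body) s0 s" by simp
    have same: "nmem s ''k'' = nmem s0 ''k''" "nmem s ''t'' = nmem s0 ''t''" "nmem s ''out'' = nmem s0 ''out''"
      "nmem s ''outu'' = nmem s0 ''outu''" "nmem s ''outv'' = nmem s0 ''outv''"
      using frame_nmem[OF fr] by auto
    let ?s = "run ?P s"
    have eqs: "nmem ?s ''cu'' 0 = nmem s ''cu'' 0" "nmem ?s ''cv'' 0 = nmem s ''cv'' 0"
      "nmem ?s ''kk'' 0 0 = k" "nmem ?s ''i'' 0 0 = 1" "nmem ?s ''x'' 0 0 = 1"
      "nmem ?s ''out'' = nmem s0 ''out''"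
      "nmem ?s ''outu'' = nmem s0 ''outu''" "nmem ?s ''outv'' = nmem s0 ''outv''"
      using same s0 by (auto simp: upd_apply fun_eq_iff)
    have f: "nmem s ''cu'' 0 i = u_ptr M i" "nmem s ''cv'' 0 i = v_ptr M i" if "i \<in> {1..n}" for i
      using s that by (auto simp: I_def)
    have ed: "edges_of n (nmem s ''cu'' 0) = M"
      using edges_of_cong[of n "nmem s ''cu'' 0" "u_ptr M"] f(1) edges_of_u_ptr[OF matchings(1)] by simp
    have r: "rep n (nmem s ''cu'' 0) (nmem s ''cv'' 0)"
      using rep_ptr[OF matchings(1)] rep_cong[of n "nmem s ''cu'' 0" "u_ptr M" "nmem s ''cv'' 0" "v_ptr M"] f by simp
    have "walk_inv n (finite_edges W) (shifted W c) (shifted_opt n W c) (u_ptr M') 1 (nmem s ''cu'' 0)"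
      by (rule walk_start[OF refl matchings(3) active_assignment[OF M']]; unfold ed; rule active_assignment[OF M])
    moreover have "frame gap_names {} s0 ?s"
      by (rule frame_trans[OF frame_mono[OF fr]]) (auto simp: gap_names_def frame_def upd_def)
    ultimately have inv: "gap_inv ?s"
      unfolding gap_inv_def eqs ed outputs_assignments_cong[OF eqs(6,7,8)]
      using r kk' s matchings s0 by (auto simp: I_def)
    have "card {a\<in>{1..n}. nmem ?s ''cu'' 0 a \<noteq> u_ptr M' a} \<le> card {1..n}" by (rule card_mono) auto
    then have pot: "gap_pot ?s \<le> 200 * n + 60 * (n * (k' - k))"
      unfolding gap_pot_def eqs by simp
    have "halts_within (While walk_cond walk_body) ?s (gap_pot ?s + (1 + bcost walk_cond))
      ?post"
    proof (rule halts_within_While[where I = gap_inv, OF inv halts_within_walk_body])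
      fix s assume s: "gap_inv s" "\<not> bval walk_cond s"
      then have fr: "frame gap_names {} s0 s" by (simp add: gap_inv_def)
      have "nmem s ''k'' = nmem s0 ''k''" "nmem s ''t'' = nmem s0 ''t''"
        using frame_nmem[OF fr] by (auto simp: gap_names_def)
      with s s0 have "Suc (nmem s ''kk'' 0 0) = k'" by (auto simp: gap_inv_def walk_cond_def)
      then have "{k<..nmem s ''kk'' 0 0} = {k<..<k'}" by auto
      then show "?post s"
        using s unfolding gap_inv_def by simp
    qed
    then show "halts_within (Seq ?P (While walk_cond walk_body)) s
      (tm ?P + (200 * n + 60 * (n * (k' - k)) + (1 + bcost walk_cond)))
      ?post"
      by (intro halts_within_Seq_straight halts_within_weaken[OF _ add_right_mono[OF pot]]) auto
  qed
  then show ?thesis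
  proof (rule halts_within_weaken)
    define d where "d = n * (k' - k)"
    have "n * 1 \<le> d" unfolding d_def using kk' by (intro mult_left_mono) auto
    then show "(24 + 30) * n + (tm ?P + (200 * n + 60 * (n * (k' - k)) + (1 + bcost walk_cond))) \<le> 400 * (n * (k' - k))"
      using n unfolding d_def[symmetric] by (simp add: walk_cond_def)
  qed
qed

end

text \<open>With \<open>n\<close> times the distance to the last size as potential, the costs of the
  gaps telescope. The one bound specialises to quadratic time for a whole list and to
  \<open>d * n\<close> for a single pair.\<close>

lemma halts_within_fill_gaps:
  assumes n: "n \<ge> 1" and L: "L \<noteq> []" "sorted_wrt (<) (map fst L)"
    and ass: "\<And>t. t < length L \<Longrightarrow> is_assignment n W (fst (L ! t)) (snd (L ! t))"
    and adj: "\<And>t. Suc t < length L \<Longrightarrow> \<exists>c. active (full_char_maxpoly n W) (n - fst (L ! t)) c \<and>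
      active (full_char_maxpoly n W) (n - fst (L ! Suc t)) c"
  defines "S \<equiv> \<lambda>r. {m. \<exists>t<r. fst (L ! t) < m \<and> m < fst (L ! Suc t)}"
  shows "halts_within fill_gaps (input_state n W L) (500 * (n * (fst (last L) - fst (hd L))) + 20)
    (\<lambda>s. outputs_assignments n W (S (length L - 1)) s \<and>
      (\<forall>m\<in>S (length L - 1). \<exists>c. active (full_char_maxpoly n W) (n - m) c))"
proof -
  let ?b = "NLess (NPlus (NVar ''t'') (NConst 1)) (NVar ''len'')"
  let ?P = "Seq fill_gap (NSet ''t'' (NPlus (NVar ''t'') (NConst 1)))"
  let ?s0 = "input_state n W L"
  let ?fr = "frame (insert ''t'' gap_names) {} ?s0"
  let ?l = "fst (last L)"
  have last: "?l = fst (L ! (length L - 1))" and hd: "fst (hd L) = fst (L ! 0)"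
    using L by (simp_all add: last_conv_nth hd_conv_nth)
  have less: "fst (L ! t) < fst (L ! t')" if "t < t'" "t' < length L" for t t'
    using sorted_wrt_nth_less[OF L(2), of t t'] that by simp
  then have le: "fst (L ! t) \<le> fst (L ! t')" if "t \<le> t'" "t' < length L" for t t'
    using that by (cases "t = t'") (auto intro: less_imp_le)
  define I where "I = (\<lambda>s. ?fr s \<and> nmem s ''t'' 0 0 < length L \<and> nmem s ''cu'' 0 0 = 0 \<and>
    outputs_assignments n W (S (nmem s ''t'' 0 0)) s \<and>
    (\<forall>m\<in>S (nmem s ''t'' 0 0). \<exists>c. active (full_char_maxpoly n W) (n - m) c))"
  define F where "F = (\<lambda>s :: state. 500 * (n * (?l - fst (L ! nmem s ''t'' 0 0))))"
  have "halts_within fill_gaps ?s0 (F ?s0 + (1 + bcost ?b))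
    (\<lambda>s. outputs_assignments n W (S (length L - 1)) s \<and>
      (\<forall>m\<in>S (length L - 1). \<exists>c. active (full_char_maxpoly n W) (n - m) c))"
    unfolding fill_gaps_def
  proof (rule halts_within_While[where I = I])
    show "I ?s0"
      using L by (simp add: I_def S_def frame_refl input_state_def outputs_assignments_def scalar_def)
  next
    fix s assume I: "I s" and b: "bval ?b s"
    define t where "t = nmem s ''t'' 0 0"
    have fr: "?fr s" using I by (simp add: I_def)
    have same: "nmem s ''len'' = nmem ?s0 ''len''" "nmem s ''n'' = nmem ?s0 ''n''" "nmem s ''k'' = nmem ?s0 ''k''"
      "nmem s ''u'' = nmem ?s0 ''u''" "nmem s ''v'' = nmem ?s0 ''v''"
      using frame_nmem[OF fr] by (auto simp: gap_names_def)
    have t: "Suc t < length L"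
      using b same(1) by (simp add: t_def input_state_def scalar_def)
    define k where "k = fst (L ! t)"
    define k' where "k' = fst (L ! Suc t)"
    have kk': "k < k'" using less[of t "Suc t"] t by (simp add: k_def k'_def)
    obtain c where c: "active (full_char_maxpoly n W) (n - k) c" "active (full_char_maxpoly n W) (n - k') c"
      using adj[OF t] by (auto simp: k_def k'_def)
    have Mt: "is_assignment n W k (snd (L ! t))" "is_assignment n W k' (snd (L ! Suc t))"
      using ass t by (auto simp: k_def k'_def)
    have st: "nmem s ''n'' 0 0 = n" "nmem s ''t'' 0 0 = t" "nmem s ''k'' t 0 = k" "nmem s ''k'' (Suc t) 0 = k'"
      "nmem s ''u'' t = u_ptr (snd (L ! t))" "nmem s ''v'' t = v_ptr (snd (L ! t))"
      "nmem s ''u'' (Suc t) = u_ptr (snd (L ! Suc t))"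
      "nmem s ''cu'' 0 0 = 0" "outputs_assignments n W (S t) s"
      using I t unfolding same by (auto simp: I_def t_def k_def k'_def input_state_def scalar_def fun_eq_iff)
    have act: "\<forall>m\<in>S t. \<exists>c. active (full_char_maxpoly n W) (n - m) c"
      using I by (simp add: I_def t_def)
    have kl: "k' \<le> ?l"
      using le[of "Suc t" "length L - 1"] t unfolding last k'_def by simp
    have S: "S (Suc t) = S t \<union> {k<..<k'}" by (auto simp: S_def k_def k'_def less_Suc_eq)
    have body: "halts_within ?P s (400 * (n * (k' - k)) + 8) (\<lambda>s'. I s' \<and> nmem s' ''t'' 0 0 = Suc t)"
    proof (rule halts_within_Seq[OF halts_within_fill_gap[OF n kk' Mt(1) c(1) Mt(2) c(2) st]])
      fix s' assume s': "outputs_assignments n W (S t \<union> {k<..<k'}) s' \<and>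
        (\<forall>m\<in>{k<..<k'}. active (full_char_maxpoly n W) (n - m) c) \<and>
        nmem s' ''cu'' 0 0 = 0 \<and> frame gap_names {} s s'"
      then have fr': "frame gap_names {} s s'" by simp
      have t': "nmem s' ''t'' 0 0 = t" using frame_nmem[OF fr', of "''t''"] t_def by (simp add: gap_names_def)
      define s'' where "s'' = set_n s' ''t'' (Suc t)"
      have "?fr s'" by (rule frame_trans[OF fr frame_mono[OF fr']]) auto
      then have fr'': "?fr s''" by (simp add: frame_def s''_def)
      have "outputs_assignments n W (S (Suc t)) s''"
        using s' outputs_assignments_cong[of s'' s'] by (simp add: S s''_def)
      then have "I s''" using fr'' t act s' S by (auto simp: I_def s''_def)
      then show "halts_within (NSet ''t'' (NPlus (NVar ''t'') (NConst 1))) s' 8 (\<lambda>s'. I s' \<and> nmem s' ''t'' 0 0 = Suc t)"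
        by (intro halts_within_straight) (auto simp: t' s''_def set_n_def upd_apply)
    qed
    \<comment> \<open>The constant overhead of a round is paid by the surplus of 100 per unit, as
      \<open>n * (k' - k)\<close> is at least 1.\<close>
    have cost: "400 * (n * (k' - k)) + 18 + F s' \<le> F s" if "nmem s' ''t'' 0 0 = Suc t" for s'
    proof -
      define e where "e = n * (k' - k)"
      have "n * (?l - k) = e + n * (?l - k')"
        using kk' kl by (simp add: e_def distrib_left[symmetric])
      moreover have "1 * 1 \<le> e" unfolding e_def using n kk' by (intro mult_le_mono) auto
      ultimately show ?thesis unfolding F_def that t_def[symmetric] k_def[symmetric] k'_def[symmetric] e_def[symmetric] by simp
    qed
    show "\<exists>T. halts_within ?P s T (\<lambda>s'. I s' \<and> T + (1 + bcost ?b) + F s' \<le> F s)"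
    proof (intro exI, rule halts_within_weaken[OF body order_refl])
      fix s' assume s': "I s' \<and> nmem s' ''t'' 0 0 = Suc t"
      show "I s' \<and> 400 * (n * (k' - k)) + 8 + (1 + bcost ?b) + F s' \<le> F s"
        using cost[of s'] s' by simp
    qed
  next
    fix s assume I: "I s" and b: "\<not> bval ?b s"
    have fr: "?fr s" using I by (simp add: I_def)
    have "nmem s ''len'' = nmem ?s0 ''len''" using frame_nmem[OF fr] by (auto simp: gap_names_def)
    then have "nmem s ''t'' 0 0 = length L - 1"
      using I b by (auto simp: I_def input_state_def scalar_def)
    then show "outputs_assignments n W (S (length L - 1)) s \<and>
      (\<forall>m\<in>S (length L - 1). \<exists>c. active (full_char_maxpoly n W) (n - m) c)"
      using I by (simp add: I_def)
  qed
  then show ?thesis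
    by (rule halts_within_weaken) (auto simp: F_def hd input_state_def)
qed

lemma halts_within_fill_gaps_pair:
  assumes n: "n \<ge> 1" and d: "d > 1" and M: "is_assignment n W k M" "is_assignment n W (k + d) M'"
    and adj: "adjacent_terms (full_char_maxpoly n W) (n - k) (n - (k + d))"
  shows "halts_within fill_gaps (input_state n W [(k, M), (k + d, M')]) (520 * (d * n))
    (outputs_assignments n W {k + i | i. 1 \<le> i \<and> i \<le> d - 1})"
proof -
  let ?L = "[(k, M), (k + d, M')]"
  obtain c where "term_val (full_char_maxpoly n W) (n - k) c = max_fun (full_char_maxpoly n W) c"
    "term_val (full_char_maxpoly n W) (n - (k + d)) c = max_fun (full_char_maxpoly n W) c"
    using adj by (auto simp: adjacent_terms_def)
  then have c: "active (full_char_maxpoly n W) (n - k) c" "active (full_char_maxpoly n W) (n - (k + d)) c"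
    by (simp_all add: active_def degree_full_char_maxpoly)
  have "halts_within fill_gaps (input_state n W ?L) (500 * (n * (fst (last ?L) - fst (hd ?L))) + 20)
     (\<lambda>s. outputs_assignments n W {m. \<exists>t<length ?L - 1. fst (?L ! t) < m \<and> m < fst (?L ! Suc t)} s \<and>
      (\<forall>m\<in>{m. \<exists>t<length ?L - 1. fst (?L ! t) < m \<and> m < fst (?L ! Suc t)}. \<exists>c. active (full_char_maxpoly n W) (n - m) c))"
  proof (rule halts_within_fill_gaps[OF n])
    show "is_assignment n W (fst (?L ! t)) (snd (?L ! t))" if "t < length ?L" for t
      using M that by (auto simp: less_Suc_eq)
  qed (use d c in \<open>auto simp: less_Suc_eq\<close>)
  moreover have "{m. \<exists>t<length ?L - 1. fst (?L ! t) < m \<and> m < fst (?L ! Suc t)} = {k + i | i. 1 \<le> i \<and> i \<le> d - 1}"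
  proof (rule set_eqI)
    fix m
    show "m \<in> {m. \<exists>t<length ?L - 1. fst (?L ! t) < m \<and> m < fst (?L ! Suc t)} \<longleftrightarrow>
        m \<in> {k + i | i. 1 \<le> i \<and> i \<le> d - 1}"
      using d by (auto intro!: exI[of _ "m - k"])
  qed
  moreover have "500 * (n * (fst (last ?L) - fst (hd ?L))) + 20 \<le> 520 * (d * n)"
  proof -
    define e where "e = n * d"
    have "1 * 1 \<le> e" unfolding e_def using n d by (intro mult_le_mono) auto
    then show ?thesis by (simp add: mult.commute[of d] e_def[symmetric])
  qed
  ultimately show ?thesis
    by (elim halts_within_weaken) auto
qed

text \<open>All essential terms being listed, no essential exponent lies strictly between those of
  consecutive entries, so \<open>active_common_point\<close> applies; exponents run opposite to
  sizes, so the later entry supplies the smaller exponent.\<close>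

lemma halts_within_fill_gaps_all:
  fixes n W
  defines "p \<equiv> full_char_maxpoly n W"
  assumes n: "n \<ge> 1" and L: "L \<noteq> []" "fst (hd L) = 0" "sorted_wrt (<) (map fst L)" "fst (last L) \<le> n"
    and ass: "\<forall>(k, M)\<in>set L. is_assignment n W k M"
    and all: "\<forall>k\<le>n. essential p (n - k) \<longrightarrow> k \<in> fst ` set L"
    and only: "\<forall>k\<in>fst ` set L. essential p (n - k) \<or> semi_essential p (n - k)"
  shows "halts_within fill_gaps (input_state n W L) (520 * n ^ 2)
    (outputs_assignments n W {m. m \<le> n \<and> semi_essential p (n - m) \<and> m \<notin> fst ` set L})"
proof -
  have deg: "degree p = n" by (simp add: p_def degree_full_char_maxpoly)
  have p0: "p \<noteq> 0" unfolding p_def by (rule full_char_maxpoly_neq_0)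
  have less: "fst (L ! t) < fst (L ! t')" if "t < t'" "t' < length L" for t t'
    using sorted_wrt_nth_less[OF L(3), of t t'] that by simp
  have in_L: "k \<in> fst ` set L \<longleftrightarrow> (\<exists>t<length L. k = fst (L ! t))" for k
    by (force simp: in_set_conv_nth)
  have act: "\<exists>x. active p (n - k) x" if "k \<in> fst ` set L" for k
    using only that essential_imp_active[of p "n - k"] not_inessential_iff_active[of "n - k" p]
    by (auto simp: semi_essential_def deg)
  have le: "fst (L ! t) \<le> n" if "t < length L" for t
  proof -
    have "fst (L ! t) \<le> fst (L ! (length L - 1))"
      using less[of t "length L - 1"] that by (cases "t = length L - 1") (simp_all add: less_imp_le)
    then show ?thesis using L by (simp add: last_conv_nth)
  qed
  have outside: "k \<le> fst (L ! t) \<or> fst (L ! Suc t) \<le> k" if t: "Suc t < length L" and kL: "k \<in> fst ` set L" for k t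
  proof -
    obtain r where r: "r < length L" "k = fst (L ! r)" using kL in_L[of k] by auto
    have "fst (L ! r) \<le> fst (L ! t)" if "r \<le> t"
      using less[of r t] t that by (cases "r = t") simp_all
    moreover have "fst (L ! Suc t) \<le> fst (L ! r)" if "Suc t \<le> r"
      using less[of "Suc t" r] r(1) that by (cases "r = Suc t") simp_all
    ultimately show ?thesis using r(2) by (metis not_less_eq_eq)
  qed
  have adj: "\<exists>c. active p (n - fst (L ! t)) c \<and> active p (n - fst (L ! Suc t)) c" if t: "Suc t < length L" for t
  proof -
    let ?k = "fst (L ! t)" and ?k' = "fst (L ! Suc t)"
    have "?k < ?k'" "?k' \<le> n" using less le t by auto
    have "?k \<in> fst ` set L" "?k' \<in> fst ` set L" using t by auto
    then obtain x y where "active p (n - ?k') x" "active p (n - ?k) y" using act by blast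
    then show ?thesis
    proof (rule active_common_point[OF p0])
      show "n - ?k' < n - ?k" using \<open>?k < ?k'\<close> \<open>?k' \<le> n\<close> by simp
      fix e assume e: "essential p e"
      show "e \<le> n - ?k' \<or> n - ?k \<le> e"
      proof (cases "e \<le> n")
        case True
        then have "n - e \<in> fst ` set L" using all e by simp
        from outside[OF t this] True show ?thesis by auto
      qed auto
    qed blast
  qed
  let ?S = "{m. \<exists>t<length L - 1. fst (L ! t) < m \<and> m < fst (L ! Suc t)}"
  \<comment> \<open>That every size in a gap is active is supplied by the postcondition of the run
    itself; it rules out inessential terms in the output.\<close>
  have S: "{m. m \<le> n \<and> semi_essential p (n - m) \<and> m \<notin> fst ` set L} = ?S" (is "?T = _")
    if active: "\<forall>m\<in>?S. \<exists>c. active p (n - m) c"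
  proof (intro equalityI subsetI)
    fix m assume m: "m \<in> ?T"
    then obtain x where x: "active p (n - m) x"
      using not_inessential_iff_active[of "n - m" p] by (auto simp: semi_essential_def deg)
    \<comment> \<open>Exponents cannot grow to the left of \<open>x\<close>, so an essential term
      active at \<open>x - 1\<close> gives a listed size of at least \<open>m\<close>: no missing
      semi-essential size lies beyond the list.\<close>
    obtain e where e: "essential p e" "active p e (x - 1)" using ex_essential_active[OF p0] .
    have "e \<le> n" using e(2) by (simp add: active_def deg)
    have "e \<le> n - m" using active_mono[OF p0 e(2) x] by simp
    have "n - e \<in> fst ` set L" using all e(1) \<open>e \<le> n\<close> by simp
    then obtain r where r: "r < length L" "fst (L ! r) = n - e" using in_L[of "n - e"] by auto
    have mr: "m < fst (L ! r)"
      using \<open>n - e \<in> fst ` set L\<close> m \<open>e \<le> n - m\<close> r(2) by (cases "m = n - e") auto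
    define q where "q = (LEAST r. r < length L \<and> m < fst (L ! r))"
    have q: "q < length L" "m < fst (L ! q)"
      using LeastI[of "\<lambda>r. r < length L \<and> m < fst (L ! r)" r] r mr by (auto simp: q_def)
    have L0: "fst (L ! 0) = 0" using L by (simp add: hd_conv_nth)
    then obtain t where t: "q = Suc t" using q by (cases q) auto
    then have "\<not> (t < length L \<and> m < fst (L ! t))"
      using not_less_Least[of t "\<lambda>r. r < length L \<and> m < fst (L ! r)"] by (simp add: q_def)
    moreover have "t < length L" using q t by simp
    moreover have "m \<noteq> fst (L ! t)" using m in_L[of m] \<open>t < length L\<close> by auto
    ultimately have "fst (L ! t) < m" by simp
    then show "m \<in> ?S" using q t by (auto intro!: exI[of _ t])
  next
    fix m assume m: "m \<in> ?S"
    then obtain t where t0: "t < length L - 1" and t': "fst (L ! t) < m" "m < fst (L ! Suc t)" by auto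
    from t0 have "Suc t < length L" by simp
    with t' have t: "Suc t < length L" "fst (L ! t) < m" "m < fst (L ! Suc t)" by auto
    have "m \<notin> fst ` set L" using outside[OF t(1), of m] t by auto
    moreover have "m \<le> n" using le[OF t(1)] t by simp
    moreover have "\<not> essential p (n - m)" using all calculation by blast
    moreover have "\<not> inessential p (n - m)"
      using active m not_inessential_iff_active[of "n - m" p] by (simp add: deg)
    ultimately show "m \<in> ?T" by (simp add: semi_essential_def)
  qed
  have "halts_within fill_gaps (input_state n W L) (500 * (n * (fst (last L) - fst (hd L))) + 20)
    (\<lambda>s. outputs_assignments n W ?S s \<and> (\<forall>m\<in>?S. \<exists>c. active p (n - m) c))"
    unfolding p_def
    by (rule halts_within_fill_gaps[OF n L(1,3) _ adj[unfolded p_def]]) (use ass in \<open>auto simp: case_prod_beta\<close>)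
  then show ?thesis
  proof (rule halts_within_weaken)
    define e where "e = n * n"
    have "n * (fst (last L) - fst (hd L)) \<le> e" unfolding e_def using L by (intro mult_left_mono) auto
    moreover have "1 * 1 \<le> e" unfolding e_def using n by (intro mult_le_mono) auto
    ultimately show "500 * (n * (fst (last L) - fst (hd L))) + 20 \<le> 520 * n ^ 2"
      unfolding power2_eq_square e_def[symmetric] by simp
  qed (use S in auto)
qed

subsection \<open>The Hungarian method started from all free vertices\<close>

text \<open>Any bijection between the two differences pairs a summand that only \<open>Q\<close> has
  with one of \<open>P\<close> that is at least as large.\<close>

lemma sum_le_of_exchange:
  fixes a :: "nat \<Rightarrow> real"
  assumes fin: "finite P" "finite Q" "card P = card Q" and le: "\<And>x y. x \<in> Q - P \<Longrightarrow> y \<in> P \<Longrightarrow> a x \<le> a y"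
  shows "sum a Q \<le> sum a P"
proof -
  have "card (Q - P) = card (P - Q)" using fin by (metis card_le_sym_Diff le_antisym order_refl)
  then obtain h where h: "bij_betw h (Q - P) (P - Q)"
    using fin finite_same_card_bij by (metis finite_Diff)
  have "sum a (Q - P) \<le> (\<Sum>x\<in>Q - P. a (h x))"
    by (rule sum_mono) (use h le in \<open>auto simp: bij_betw_def\<close>)
  also have "\<dots> = sum a (P - Q)" by (rule sum.reindex_bij_betw[OF h])
  finally have "sum a (Q - P) \<le> sum a (P - Q)" .
  moreover have "sum a Q = sum a (Q \<inter> P) + sum a (Q - P)" "sum a P = sum a (Q \<inter> P) + sum a (P - Q)"
    using fin by (metis sum.Int_Diff, metis sum.Int_Diff Int_commute)
  ultimately show ?thesis by simp
qed

text \<open>Complementary slackness alone would only certify optimal perfect matchings; optimality among the matchings of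
  the same size comes from the free vertices on either side having minimal potential.\<close>

definition dual_inv ::
  "nat \<Rightarrow> (nat \<Rightarrow> nat \<Rightarrow> real) \<Rightarrow> (nat \<Rightarrow> nat) \<Rightarrow> (nat \<Rightarrow> nat) \<Rightarrow> (nat \<Rightarrow> real) \<Rightarrow> (nat \<Rightarrow> real) \<Rightarrow> bool" where
  "dual_inv n X f g \<alpha> \<beta> \<longleftrightarrow>
    (\<forall>i\<in>{1..n}. \<forall>j\<in>{1..n}. X i j \<le> \<alpha> i + \<beta> j) \<and>
    (\<forall>i\<in>{1..n}. f i \<noteq> 0 \<longrightarrow> X i (f i) = \<alpha> i + \<beta> (f i)) \<and>
    (\<forall>i\<in>{1..n}. \<forall>i'\<in>{1..n}. f i = 0 \<longrightarrow> \<alpha> i \<le> \<alpha> i') \<and>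
    (\<forall>j\<in>{1..n}. 0 \<le> \<beta> j) \<and>
    (\<forall>j\<in>{1..n}. g j = 0 \<longrightarrow> \<beta> j = 0)"

text \<open>Weak duality, with different arguments on the two sides. Row potentials may have any
  sign, and minimality on the free rows allows an exchange of equally many rows. Column potentials
  are nonnegative and vanish off the matched columns, so these already carry the total.\<close>

lemma dual_inv_optimal:
  assumes r: "rep n f g" and d: "dual_inv n X f g \<alpha> \<beta>"
    and N: "matching n N" "card N = card (edges_of n f)"
  shows "(\<Sum>(i, j)\<in>N. X i j) \<le> (\<Sum>(i, j)\<in>edges_of n f. X i j)"
proof -
  let ?M = "edges_of n f"
  note M = rep_matching[OF r]
  have split: "(\<Sum>(i, j)\<in>N. \<alpha> i + \<beta> j) = sum \<alpha> (fst ` N) + sum \<beta> (snd ` N)" if "matching n N" for N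
    using sum.reindex[OF matching_inj_on_fst[OF that], of \<alpha>] sum.reindex[OF matching_inj_on_snd[OF that], of \<beta>]
    by (simp add: case_prod_beta sum.distrib)
  have sub: "fst ` N \<subseteq> {1..n}" "snd ` N \<subseteq> {1..n}" "fst ` ?M \<subseteq> {1..n}" "snd ` ?M \<subseteq> {1..n}"
    using N(1) M by (auto simp: matching_def)
  note fin = sub[THEN finite_subset[OF _ finite_atLeastAtMost]]
  have "(\<Sum>(i, j)\<in>N. X i j) \<le> (\<Sum>(i, j)\<in>N. \<alpha> i + \<beta> j)"
    by (rule sum_mono) (use N(1) d in \<open>auto simp: matching_def dual_inv_def\<close>)
  also have "\<dots> = sum \<alpha> (fst ` N) + sum \<beta> (snd ` N)" by (rule split[OF N(1)])
  also have "sum \<alpha> (fst ` N) \<le> sum \<alpha> (fst ` ?M)"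
  proof (rule sum_le_of_exchange)
    show "card (fst ` ?M) = card (fst ` N)"
      using N matching_inj_on_fst[OF N(1)] matching_inj_on_fst[OF M] by (simp add: card_image)
    fix x y assume x: "x \<in> fst ` N - fst ` ?M" and y: "y \<in> fst ` ?M"
    have "x \<in> {1..n}" "y \<in> {1..n}" using x y sub by blast+
    moreover have "f x = 0"
    proof (rule ccontr)
      assume "f x \<noteq> 0"
      then have "(x, f x) \<in> ?M" using \<open>x \<in> {1..n}\<close> by (simp add: edges_of_def)
      then show False using x by force
    qed
    ultimately show "\<alpha> x \<le> \<alpha> y" using d unfolding dual_inv_def by blast
  qed (use fin in auto)
  also have "sum \<beta> (snd ` N) \<le> sum \<beta> {1..n}"
    by (rule sum_mono2) (use sub d in \<open>auto simp: dual_inv_def\<close>)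
  also have "sum \<beta> {1..n} = sum \<beta> (snd ` ?M)"
  proof (rule sum.mono_neutral_right)
    show "\<forall>j\<in>{1..n} - snd ` ?M. \<beta> j = 0"
    proof
      fix j assume j: "j \<in> {1..n} - snd ` ?M"
      have "g j = 0"
      proof (rule ccontr)
        assume "g j \<noteq> 0"
        then have "(g j, j) \<in> ?M" using repD2[OF r, of j] j by (auto simp: edges_of_def)
        then show False using j by force
      qed
      then show "\<beta> j = 0" using d j by (auto simp: dual_inv_def)
    qed
  qed (use sub in auto)
  also have "sum \<alpha> (fst ` ?M) + sum \<beta> (snd ` ?M) = (\<Sum>(i, j)\<in>?M. \<alpha> i + \<beta> j)" by (rule split[OF M, symmetric])
  also have "\<dots> = (\<Sum>(i, j)\<in>?M. X i j)"
    by (rule sum.cong) (use d in \<open>auto simp: edges_of_def dual_inv_def\<close>)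
  finally show ?thesis by simp
qed

text \<open>The alternating forest of one phase. The label \<open>t j\<close> is the time at which \<open>j\<close> entered the forest
  (0 if it has not), and \<open>p j\<close> its parent or, outside the forest, the row of minimal slack \<open>sl j\<close>.
  The convention \<open>t 0 \<noteq> 0\<close> makes \<open>t (f i) \<noteq> 0\<close> the criterion for \<open>i\<close> to belong to the forest:
  either \<open>i\<close> is free or its partner is in the forest.\<close>

definition forest_inv ::
  "nat \<Rightarrow> (nat \<Rightarrow> nat \<Rightarrow> real) \<Rightarrow> (nat \<Rightarrow> nat) \<Rightarrow> (nat \<Rightarrow> real) \<Rightarrow> (nat \<Rightarrow> real) \<Rightarrow>
    (nat \<Rightarrow> nat) \<Rightarrow> (nat \<Rightarrow> nat) \<Rightarrow> (nat \<Rightarrow> real) \<Rightarrow> bool" where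
  "forest_inv n X f \<alpha> \<beta> t p sl \<longleftrightarrow> t 0 \<noteq> 0 \<and> (\<forall>j\<in>{1..n}. p j \<in> {1..n} \<and> t (f (p j)) \<noteq> 0 \<and>
    (t j \<noteq> 0 \<longrightarrow> X (p j) j = \<alpha> (p j) + \<beta> j \<and> t (f (p j)) < t j) \<and>
    (t j = 0 \<longrightarrow> sl j = \<alpha> (p j) + \<beta> j - X (p j) j \<and>
      (\<forall>i\<in>{1..n}. t (f i) \<noteq> 0 \<longrightarrow> sl j \<le> \<alpha> i + \<beta> j - X i j)))"

lemma forest_slack_le:
  assumes "forest_inv n X f \<alpha> \<beta> t p sl" "j \<in> {1..n}" "t j = 0" "i \<in> {1..n}" "t (f i) \<noteq> 0"
  shows "sl j \<le> \<alpha> i + \<beta> j - X i j"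
  using assms unfolding forest_inv_def by blast

context
  fixes n X f g \<alpha> \<beta> t p sl \<delta> \<alpha>' \<beta>' sl'
  assumes r: "rep n f g" and d: "dual_inv n X f g \<alpha> \<beta>" and fo: "forest_inv n X f \<alpha> \<beta> t p sl"
    and matched: "\<And>j. j \<in> {1..n} \<Longrightarrow> t j \<noteq> 0 \<Longrightarrow> g j \<noteq> 0"
    and \<delta>: "0 \<le> \<delta>" "\<And>j. j \<in> {1..n} \<Longrightarrow> t j = 0 \<Longrightarrow> \<delta> \<le> sl j"
    and \<alpha>': "\<And>i. i \<in> {1..n} \<Longrightarrow> \<alpha>' i = (if t (f i) \<noteq> 0 then \<alpha> i - \<delta> else \<alpha> i)"
    and \<beta>': "\<And>j. j \<in> {1..n} \<Longrightarrow> \<beta>' j = (if t j \<noteq> 0 then \<beta> j + \<delta> else \<beta> j)"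
    and sl': "\<And>j. j \<in> {1..n} \<Longrightarrow> sl' j = (if t j \<noteq> 0 then sl j else sl j - \<delta>)"
begin

text \<open>Forest rows lose \<open>\<delta>\<close> and forest columns gain it, so edges inside the
  forest stay tight. The slacks of each outside column all fall by the same amount, so its
  minimising row remains one.\<close>

lemma forest_inv_shift: "forest_inv n X f \<alpha>' \<beta>' t p sl'"
  unfolding forest_inv_def
proof (intro conjI ballI impI)
  show "t 0 \<noteq> 0" using fo by (simp add: forest_inv_def)
  fix j assume j: "j \<in> {1..n}"
  have pj: "p j \<in> {1..n}" "t (f (p j)) \<noteq> 0" using fo j by (auto simp: forest_inv_def)
  then show "p j \<in> {1..n}" "t (f (p j)) \<noteq> 0" by auto
  show "t (f (p j)) < t j" if "t j \<noteq> 0" using fo j that by (auto simp: forest_inv_def)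
  show "X (p j) j = \<alpha>' (p j) + \<beta>' j" if "t j \<noteq> 0"
    using fo j that pj \<alpha>' \<beta>' by (auto simp: forest_inv_def)
  show "sl' j = \<alpha>' (p j) + \<beta>' j - X (p j) j" if "t j = 0"
    using fo j that pj \<alpha>' \<beta>' sl' by (auto simp: forest_inv_def)
  show "sl' j \<le> \<alpha>' i + \<beta>' j - X i j" if "t j = 0" "i \<in> {1..n}" "t (f i) \<noteq> 0" for i
    using forest_slack_le[OF fo j that] \<alpha>'[OF that(2)] \<beta>'[OF j] sl'[OF j] that by simp
qed

text \<open>A matched row is in the forest exactly when its partner is, so matched edges stay tight.
  All free rows are roots and sink together, and no row sinks further, so their minimality survives.
  By \<open>matched\<close> no free column is raised.\<close>

lemma dual_inv_shift: "dual_inv n X f g \<alpha>' \<beta>'"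
  unfolding dual_inv_def
proof (intro conjI ballI impI)
  have t0: "t 0 \<noteq> 0" using fo by (simp add: forest_inv_def)
  fix i assume i: "i \<in> {1..n}"
  show "X i (f i) = \<alpha>' i + \<beta>' (f i)" if "f i \<noteq> 0"
  proof -
    have "f i \<in> {1..n}" using repD1[OF r i that] by simp
    then show ?thesis using d i that \<alpha>'[OF i] \<beta>'[of "f i"] by (auto simp: dual_inv_def)
  qed
  show "0 \<le> \<beta>' i" using d \<delta> i \<beta>'[OF i] by (auto simp: dual_inv_def)
  show "\<beta>' i = 0" if "g i = 0"
    using d i that \<beta>'[OF i] matched[OF i] by (auto simp: dual_inv_def)
  fix j assume j: "j \<in> {1..n}"
  have X: "X i j \<le> \<alpha> i + \<beta> j" using d i j by (simp add: dual_inv_def)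
  show "X i j \<le> \<alpha>' i + \<beta>' j"
  proof (cases "t (f i) \<noteq> 0 \<and> t j = 0")
    case True
    have "sl j \<le> \<alpha> i + \<beta> j - X i j" using forest_slack_le[OF fo j _ i] True by simp
    then show ?thesis using \<delta>(2)[OF j] True \<alpha>'[OF i] \<beta>'[OF j] by auto
  next
    case False
    then show ?thesis using X \<delta>(1) \<alpha>'[OF i] \<beta>'[OF j] by auto
  qed
  show "\<alpha>' i \<le> \<alpha>' j" if "f i = 0"
  proof -
    have "\<alpha> i \<le> \<alpha> j" using d i j that by (simp add: dual_inv_def)
    then show ?thesis using \<alpha>'[OF i] \<alpha>'[OF j] \<delta>(1) that t0 by auto
  qed
qed

end

lemma forest_slack_nonneg:
  assumes "dual_inv n X f g \<alpha> \<beta>" "forest_inv n X f \<alpha> \<beta> t p sl" "j \<in> {1..n}" "t j = 0"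
  shows "0 \<le> sl j"
proof -
  have "p j \<in> {1..n}" "sl j = \<alpha> (p j) + \<beta> j - X (p j) j" using assms by (auto simp: forest_inv_def)
  then show ?thesis using assms(1,3) by (simp add: dual_inv_def)
qed

text \<open>The edge from the parent is tight because the slack of \<open>y\<close> is 0. Only the
  partner \<open>g y\<close> becomes a new forest row, so one relaxation restores the slacks, and
  none is due if \<open>y\<close> is free. A label above all others makes labels decrease towards
  the roots.\<close>

lemma forest_inv_add:
  assumes r: "rep n f g" and fo: "forest_inv n X f \<alpha> \<beta> t p sl"
    and y: "y \<in> {1..n}" "t y = 0" "sl y = 0"
    and st: "\<And>j. j \<le> n \<Longrightarrow> t j < st"
    and p': "\<And>j. j \<in> {1..n} \<Longrightarrow> p' j = (if g y \<noteq> 0 \<and> j \<noteq> y \<and> t j = 0 \<and> \<alpha> (g y) + \<beta> j - X (g y) j < sl j then g y else p j)"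
    and sl': "\<And>j. j \<in> {1..n} \<Longrightarrow> sl' j = (if g y \<noteq> 0 \<and> j \<noteq> y \<and> t j = 0 \<and> \<alpha> (g y) + \<beta> j - X (g y) j < sl j
      then \<alpha> (g y) + \<beta> j - X (g y) j else sl j)"
  shows "forest_inv n X f \<alpha> \<beta> (t(y := st)) p' sl'"
  unfolding forest_inv_def
proof (intro conjI ballI impI)
  let ?t = "t(y := st)"
  have st0: "st \<noteq> 0" using st[of 0] by simp
  show "?t 0 \<noteq> 0" using fo y by (auto simp: forest_inv_def)
  have gy: "g y \<in> {1..n}" "f (g y) = y" if "g y \<noteq> 0" using repD2[OF r y(1) that] by auto
  fix j assume j: "j \<in> {1..n}"
  have pj: "p j \<in> {1..n}" "t (f (p j)) \<noteq> 0" using fo j by (auto simp: forest_inv_def)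
  \<comment> \<open>Parents were forest rows before \<open>y\<close> received its label, so the
    labels of their partners do not change.\<close>
  then have fpj: "f (p j) \<noteq> y" using y by auto
  have fn: "f (p j) \<le> n" using r pj by (simp add: rep_def)
  show "p' j \<in> {1..n}" using p'[OF j] pj gy by auto
  show "?t (f (p' j)) \<noteq> 0" using p'[OF j] pj gy st0 fpj by auto
  show "X (p' j) j = \<alpha> (p' j) + \<beta> j" if "?t j \<noteq> 0"
  proof (cases "j = y")
    case True
    then have "sl y = \<alpha> (p y) + \<beta> y - X (p y) y" using fo y by (auto simp: forest_inv_def)
    then show ?thesis using True y p'[OF j] by simp
  next
    case False
    then show ?thesis using fo j that p'[OF j] by (auto simp: forest_inv_def)
  qed
  show "?t (f (p' j)) < ?t j" if "?t j \<noteq> 0"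
  proof (cases "j = y")
    case True
    then have "p' j = p j" using p'[OF j] by simp
    then show ?thesis using True fpj st[OF fn] by simp
  next
    case False
    then have "t (f (p j)) < t j" using fo j that by (auto simp: forest_inv_def)
    then show ?thesis using that False fpj p'[OF j] by auto
  qed
  show "sl' j = \<alpha> (p' j) + \<beta> j - X (p' j) j" if "?t j = 0"
    using fo j that st0 p'[OF j] sl'[OF j] by (auto simp: forest_inv_def split: if_splits)
  show "sl' j \<le> \<alpha> i + \<beta> j - X i j" if "?t j = 0" "i \<in> {1..n}" "?t (f i) \<noteq> 0" for i
  proof -
    have jy: "j \<noteq> y" "t j = 0" using that st0 by (auto split: if_splits)
    show ?thesis
    proof (cases "f i = y")
      case True
      then have "i = g y" using repD1[OF r that(2)] y by auto
      then show ?thesis using jy sl'[OF j] that(2) by auto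
    next
      case False
      then have "sl j \<le> \<alpha> i + \<beta> j - X i j" using forest_slack_le[OF fo j jy(2) that(2)] that by simp
      then show ?thesis using sl'[OF j] by auto
    qed
  qed
qed

text \<open>During the augmentation, \<open>x\<close> is the column that has just been released (0 at the end); all other
  columns keep the conditions of \<open>dual_inv\<close>, and the forest is still intact below the label of \<open>x\<close>.\<close>

definition augment_inv ::
  "nat \<Rightarrow> (nat \<Rightarrow> nat \<Rightarrow> real) \<Rightarrow> (nat \<Rightarrow> real) \<Rightarrow> (nat \<Rightarrow> real) \<Rightarrow> (nat \<Rightarrow> nat) \<Rightarrow> (nat \<Rightarrow> nat) \<Rightarrow> nat \<Rightarrow>
    (nat \<Rightarrow> nat) \<Rightarrow> (nat \<Rightarrow> nat) \<Rightarrow> nat \<Rightarrow> bool" where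
  "augment_inv n X \<alpha> \<beta> t p m f g x \<longleftrightarrow> rep n f g \<and>
    (\<forall>i\<in>{1..n}. \<forall>j\<in>{1..n}. X i j \<le> \<alpha> i + \<beta> j) \<and>
    (\<forall>i\<in>{1..n}. f i \<noteq> 0 \<longrightarrow> X i (f i) = \<alpha> i + \<beta> (f i)) \<and>
    (\<forall>i\<in>{1..n}. \<forall>i'\<in>{1..n}. f i = 0 \<longrightarrow> \<alpha> i \<le> \<alpha> i') \<and>
    (\<forall>j\<in>{1..n}. 0 \<le> \<beta> j) \<and>
    (\<forall>j\<in>{1..n}. g j = 0 \<longrightarrow> j = x \<or> \<beta> j = 0) \<and>
    x \<le> n \<and> t x \<noteq> 0 \<and> (x \<noteq> 0 \<longrightarrow> g x = 0) \<and>
    card (edges_of n f) + (if x = 0 then 0 else 1) = m \<and>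
    (\<forall>j\<in>{1..n}. t j \<noteq> 0 \<longrightarrow> t j \<le> t x \<longrightarrow> p j \<in> {1..n} \<and> X (p j) j = \<alpha> (p j) + \<beta> j \<and>
      t (f (p j)) \<noteq> 0 \<and> t (f (p j)) < t j)"

lemma augment_start:
  assumes "rep n f g" "dual_inv n X f g \<alpha> \<beta>" "forest_inv n X f \<alpha> \<beta> t p sl"
    and "x \<in> {1..n}" "t x \<noteq> 0" "g x = 0" "Suc (card (edges_of n f)) = m"
  shows "augment_inv n X \<alpha> \<beta> t p m f g x"
  using assms unfolding augment_inv_def dual_inv_def forest_inv_def by auto

text \<open>This is the forcing of an edge with rows and columns exchanged: \<open>x\<close> is the
  free column, and the column \<open>f (p x)\<close> is released. Its smaller label makes the loop
  terminate; being different from \<open>x\<close>, it makes the order of the two writes to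
  \<open>g\<close> immaterial.\<close>

lemma augment_step:
  assumes a: "augment_inv n X \<alpha> \<beta> t p m f g x" and x: "x \<noteq> 0"
  shows "augment_inv n X \<alpha> \<beta> t p m (f(p x := x)) (g(x := p x, f (p x) := 0)) (f (p x))"
    and "t (f (p x)) < t x" and "f (p x) \<noteq> x"
proof -
  have r: "rep n f g" and xn: "x \<in> {1..n}" and gx: "g x = 0"
    and card: "Suc (card (edges_of n f)) = m" and tx: "t x \<noteq> 0"
    and par: "\<And>j. j \<in> {1..n} \<Longrightarrow> t j \<noteq> 0 \<Longrightarrow> t j \<le> t x \<Longrightarrow> p j \<in> {1..n} \<and> X (p j) j = \<alpha> (p j) + \<beta> j \<and>
      t (f (p j)) \<noteq> 0 \<and> t (f (p j)) < t j"
    using a x unfolding augment_inv_def by auto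
  define i where "i = p x"
  define z where "z = f i"
  define f' where "f' = f(i := x)"
  define g' where "g' = g(x := i, z := 0)"
  have i: "i \<in> {1..n}" "X i x = \<alpha> i + \<beta> x" "t z \<noteq> 0" "t z < t x"
    using par[OF xn tx] by (auto simp: i_def z_def)
  have r': "rep n g f" using r rep_commute by blast
  have rf: "rep n f' g'"
    using rep_force[OF r' xn gx i(1)] rep_commute by (simp add: f'_def g'_def z_def)
  have zx: "z \<noteq> x" using force_partner_neq[OF r' xn gx i(1)] by (simp add: z_def)
  have card': "card (edges_of n f') + (if z = 0 then 0 else 1) = m"
    using card_edges_of_force[OF r' xn gx i(1)] card card_edges_of_swap[OF r] card_edges_of_swap[OF rf]
    by (auto simp: f'_def g'_def z_def split: if_splits)
  have zn: "z \<le> n" using r i(1) by (simp add: rep_def z_def)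
  have par': "p j \<in> {1..n} \<and> X (p j) j = \<alpha> (p j) + \<beta> j \<and> t (f' (p j)) \<noteq> 0 \<and> t (f' (p j)) < t j"
    if j: "j \<in> {1..n}" "t j \<noteq> 0" "t j \<le> t z" for j
  proof -
    have "t j \<le> t x" using j i(4) by simp
    note pj = par[OF j(1,2) this]
    \<comment> \<open>A column whose parent is the rerouted row has a label above
      \<open>t z\<close>, so the remaining path does not meet it.\<close>
    have "p j \<noteq> i"
    proof
      assume "p j = i"
      then have "t z < t j" using pj by (simp add: z_def)
      then show False using j by simp
    qed
    then show ?thesis using pj by (simp add: f'_def)
  qed
  have "augment_inv n X \<alpha> \<beta> t p m f' g' z"
    unfolding augment_inv_def
  proof (intro conjI)
    show "\<forall>j\<in>{1..n}. g' j = 0 \<longrightarrow> j = z \<or> \<beta> j = 0"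
      using a i(1) by (auto simp: augment_inv_def g'_def)
    show "\<forall>i\<in>{1..n}. f' i \<noteq> 0 \<longrightarrow> X i (f' i) = \<alpha> i + \<beta> (f' i)"
      using a i(2) by (auto simp: augment_inv_def f'_def)
    show "\<forall>i\<in>{1..n}. \<forall>i'\<in>{1..n}. f' i = 0 \<longrightarrow> \<alpha> i \<le> \<alpha> i'"
      using a x by (auto simp: augment_inv_def f'_def)
    show "z \<noteq> 0 \<longrightarrow> g' z = 0" by (simp add: g'_def)
  qed (use a rf card' zn i par' in \<open>auto simp: augment_inv_def\<close>)
  then show "augment_inv n X \<alpha> \<beta> t p m (f(p x := x)) (g(x := p x, f (p x) := 0)) (f (p x))"
    by (simp add: f'_def g'_def z_def i_def)
  show "t (f (p x)) < t x" "f (p x) \<noteq> x" using i zx by (auto simp: z_def i_def)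
qed

lemma augment_end:
  assumes "augment_inv n X \<alpha> \<beta> t p m f g 0"
  shows "rep n f g" "dual_inv n X f g \<alpha> \<beta>" "card (edges_of n f) = m"
  using assms unfolding augment_inv_def dual_inv_def by auto

lemma ex_free:
  assumes "rep n f g" "card (edges_of n f) < n"
  shows "\<exists>i\<in>{1..n}. f i = 0"
proof (rule ccontr)
  assume "\<not> ?thesis"
  then have "card (edges_of n (\<lambda>i. i)) \<le> card (edges_of n f)"
    by (intro card_edges_of_mono) auto
  moreover have "edges_of n (\<lambda>i. i) = (\<lambda>i. (i, i)) ` {1..n}" by (auto simp: edges_of_def)
  then have "card (edges_of n (\<lambda>i. i)) = n" by (simp add: card_image inj_on_def)
  ultimately show False using assms by simp
qed

subsection \<open>Replacing infinite weights\<close>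

text \<open>\<open>real_of_ereal\<close> sends minus infinity to 0, so infinite edges contribute
  nothing to the total, just as \<open>total_body\<close> skips them.\<close>

definition abs_weight :: "(nat \<Rightarrow> nat \<Rightarrow> maxplus) \<Rightarrow> nat \<Rightarrow> nat \<Rightarrow> real" where
  "abs_weight W i j = \<bar>real_of_ereal (val (W i j))\<bar>"

definition total_weight :: "nat \<Rightarrow> (nat \<Rightarrow> nat \<Rightarrow> maxplus) \<Rightarrow> real" where
  "total_weight n W = (\<Sum>i\<in>{1..n}. \<Sum>j\<in>{1..n}. abs_weight W i j)"

text \<open>With total \<open>T\<close> of absolute values, a matching of finite edges weighs at
  least \<open>- T\<close>, while one replaced edge pulls any matching down to at most
  \<open>- (2 * T + 1) + T = - T - 1\<close>.\<close>

definition real_weight :: "nat \<Rightarrow> (nat \<Rightarrow> nat \<Rightarrow> maxplus) \<Rightarrow> nat \<Rightarrow> nat \<Rightarrow> real" where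
  "real_weight n W i j =
    (if val (W i j) = - \<infinity> then - (2 * total_weight n W + 1) else real_of_ereal (val (W i j)))"

lemma abs_weight_nonneg: "0 \<le> abs_weight W i j"
  unfolding abs_weight_def by (rule abs_ge_zero)

lemma le_abs_weight: "real_of_ereal (val (W i j)) \<le> abs_weight W i j"
  and minus_abs_weight_le: "- abs_weight W i j \<le> real_of_ereal (val (W i j))"
  unfolding abs_weight_def by linarith+

lemma sum_abs_weight_le:
  assumes "N \<subseteq> {1..n} \<times> {1..n}"
  shows "(\<Sum>(i, j)\<in>N. abs_weight W i j) \<le> total_weight n W"
proof -
  have "(\<Sum>(i, j)\<in>N. abs_weight W i j) \<le> (\<Sum>(i, j)\<in>{1..n} \<times> {1..n}. abs_weight W i j)"
    by (rule sum_mono2) (use assms abs_weight_nonneg in auto)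
  then show ?thesis by (simp add: total_weight_def sum.cartesian_product)
qed

lemma real_weight_le_abs: "real_weight n W i j \<le> abs_weight W i j"
proof -
  have "0 \<le> total_weight n W"
    unfolding total_weight_def by (intro sum_nonneg abs_weight_nonneg)
  then show ?thesis using le_abs_weight[of W i j] abs_weight_nonneg[of W i j]
    by (auto simp: real_weight_def)
qed

lemma real_weight_le_total:
  assumes "i \<in> {1..n}" "j \<in> {1..n}"
  shows "real_weight n W i j \<le> total_weight n W"
proof -
  have "abs_weight W i j = (\<Sum>(i, j)\<in>{(i, j)}. abs_weight W i j)" by simp
  also have "\<dots> \<le> total_weight n W" by (rule sum_abs_weight_le) (use assms in auto)
  finally show ?thesis using real_weight_le_abs order_trans by blast
qed

text \<open>An optimal matching for the modified weights uses a replaced edge only if every matching of the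
  same size has weight minus infinity.\<close>

lemma is_assignment_real_weight:
  assumes M: "matching n M"
    and opt: "\<And>N. matching n N \<Longrightarrow> card N = card M \<Longrightarrow>
      (\<Sum>(i, j)\<in>N. real_weight n W i j) \<le> (\<Sum>(i, j)\<in>M. real_weight n W i j)"
  shows "is_assignment n W (card M) M"
  unfolding is_assignment_def
proof (intro conjI allI impI)
  let ?w = "\<lambda>N. \<Sum>(i, j)\<in>N. real_weight n W i j"
  have w: "weight W N = ereal (?w N)" if "matching n N" "N \<subseteq> finite_edges W" for N
    unfolding weight_finite[OF matching_finite[OF that(1)] that(2)]
    using that(2) by (auto intro!: sum.cong simp: finite_edges_def real_weight_def)
  fix N assume "matching n N \<and> card N = card M"
  then have N: "matching n N" "card N = card M" by auto
  show "weight W N \<le> weight W M"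
  proof (cases "N \<subseteq> finite_edges W")
    case False
    then show ?thesis using weight_infinite[OF matching_finite[OF N(1)]] by simp
  next
    case True
    have "- total_weight n W \<le> (\<Sum>(i, j)\<in>N. - abs_weight W i j)"
      using sum_abs_weight_le[of N n W] N(1) by (simp add: matching_def case_prod_beta sum_negf)
    also have "\<dots> \<le> ?w N"
    proof (rule sum_mono)
      fix e assume "e \<in> N"
      moreover obtain a b where "e = (a, b)" by (cases e)
      ultimately have "val (W a b) \<noteq> - \<infinity>" using True by (auto simp: finite_edges_def)
      then show "(case e of (i, j) \<Rightarrow> - abs_weight W i j) \<le> (case e of (i, j) \<Rightarrow> real_weight n W i j)"
        using minus_abs_weight_le[of W a b] \<open>e = (a, b)\<close> by (simp add: real_weight_def)
    qed
    also have "\<dots> \<le> ?w M" by (rule opt[OF N])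
    finally have lower: "- total_weight n W \<le> ?w M" .
    have "M \<subseteq> finite_edges W"
    proof (rule ccontr)
      assume "\<not> M \<subseteq> finite_edges W"
      then obtain a b where ab: "(a, b) \<in> M" "val (W a b) = - \<infinity>" by (auto simp: finite_edges_def)
      have "?w M = real_weight n W a b + ?w (M - {(a, b)})"
        using sum.remove[OF matching_finite[OF M] ab(1), of "\<lambda>(i, j). real_weight n W i j"] by simp
      also have "?w (M - {(a, b)}) \<le> (\<Sum>(i, j)\<in>M - {(a, b)}. abs_weight W i j)"
        by (rule sum_mono) (use real_weight_le_abs in auto)
      also have "\<dots> \<le> total_weight n W"
        by (rule sum_abs_weight_le) (use M in \<open>auto simp: matching_def\<close>)
      finally have "?w M \<le> - total_weight n W - 1" using ab(2) by (simp add: real_weight_def)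
      then show False using lower by simp
    qed
    then show ?thesis using opt[OF N] by (simp add: w M N True)
  qed
qed (use M in auto)

subsection \<open>The program for all cardinalities\<close>

definition warr :: "state \<Rightarrow> name \<Rightarrow> nat \<Rightarrow> (nat \<Rightarrow> real) \<Rightarrow> bool" where
  "warr s x n a \<longleftrightarrow> (\<forall>i\<in>{1..n}. wmem s x 0 i = ereal (a i))"

definition wmat :: "state \<Rightarrow> name \<Rightarrow> nat \<Rightarrow> (nat \<Rightarrow> nat \<Rightarrow> real) \<Rightarrow> bool" where
  "wmat s x n X \<longleftrightarrow> (\<forall>i\<in>{1..n}. \<forall>j\<in>{1..n}. wmem s x i j = ereal (X i j))"

section \<open>Relaxing the slacks from one row\<close>

abbreviation slack_exp :: wexp where
  "slack_exp \<equiv> WMinus (WPlus (WArr ''al'' (NVar ''r'')) (WArr ''be'' (NVar ''j'')))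
    (WRead ''X'' (NVar ''r'') (NVar ''j''))"

definition relax_body :: prog where
  "relax_body =
    Cond (BAnd (NEq (NArr ''t'' (NVar ''j'')) (NConst 0)) (WLess slack_exp (WArr ''sl'' (NVar ''j''))))
      (Seq (WSetArr ''sl'' (NVar ''j'') slack_exp) (NSetArr ''p'' (NVar ''j'') (NVar ''r'')))
      Skip"

definition relax :: prog where
  "relax = For ''j'' relax_body"

lemma relax_names: "nwr relax_body = {''p''}" "wwr relax_body = {''sl''}"
  "nwr relax = {''j'', ''p''}" "wwr relax = {''sl''}"
  by (auto simp: relax_def relax_body_def)

lemma halts_within_relax:
  assumes n: "nmem s ''n'' 0 0 = n" "n \<ge> 1"
    and X: "wmat s ''X'' n X" and al: "warr s ''al'' n \<alpha>" and be: "warr s ''be'' n \<beta>"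
    and r: "nmem s ''r'' 0 0 = r" "r \<in> {1..n}"
  defines "v \<equiv> \<lambda>j. \<alpha> r + \<beta> j - X r j"
  defines "c \<equiv> \<lambda>j. nmem s ''t'' 0 j = 0 \<and> ereal (v j) < wmem s ''sl'' 0 j"
  shows "halts_within relax s (130 * n) (\<lambda>s'. frame {''j'', ''p''} {''sl''} s s' \<and>
    (\<forall>j\<in>{1..n}. nmem s' ''p'' 0 j = (if c j then r else nmem s ''p'' 0 j) \<and>
      wmem s' ''sl'' 0 j = (if c j then ereal (v j) else wmem s ''sl'' 0 j)))"
proof -
  define I where "I = (\<lambda>(i :: nat) (s' :: state). \<forall>j\<in>{1..n}.
    nmem s' ''p'' 0 j = (if j < i \<and> c j then r else nmem s ''p'' 0 j) \<and>
      wmem s' ''sl'' 0 j = (if j < i \<and> c j then ereal (v j) else wmem s ''sl'' 0 j))"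
  have "halts_within relax s ((100 + 30) * n)
    (\<lambda>s'. I (Suc n) s' \<and> frame (insert ''j'' (nwr relax_body)) (wwr relax_body) s s')"
    unfolding relax_def
  proof (rule halts_within_For[OF n])
    show "I 1 (set_n s ''j'' 1)" by (auto simp: I_def)
    fix i s' assume i: "1 \<le> i" "i \<le> n" and fr: "frame (insert ''j'' (nwr relax_body)) (wwr relax_body) s s'"
      and j: "nmem s' ''j'' 0 0 = i" and I: "I i s'"
    have same: "nmem s' ''t'' = nmem s ''t''" "nmem s' ''r'' = nmem s ''r''" "wmem s' ''al'' = wmem s ''al''"
      "wmem s' ''be'' = wmem s ''be''" "wmem s' ''X'' = wmem s ''X''"
      using frame_nmem[OF fr] frame_wmem[OF fr] by (auto simp: relax_names)
    have rd: "wmem s ''al'' 0 r = ereal (\<alpha> r)" "wmem s ''be'' 0 i = ereal (\<beta> i)" "wmem s ''X'' r i = ereal (X r i)"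
      using X al be i r by (auto simp: warr_def wmat_def)
    have cur: "wmem s' ''sl'' 0 i = wmem s ''sl'' 0 i" "nmem s' ''p'' 0 i = nmem s ''p'' 0 i"
      using I i by (auto simp: I_def)
    have slack: "wval slack_exp s' = ereal (v i)"
      using same rd j r by (simp add: v_def)
    show "halts_within relax_body s' 100 (\<lambda>s''. I (Suc i) (set_n s'' ''j'' (Suc i)))"
    proof (rule halts_within_straight)
      define s'' where "s'' = run relax_body s'"
      have "nmem s'' ''p'' 0 a = (if a = i \<and> c i then r else nmem s' ''p'' 0 a)"
        "wmem s'' ''sl'' 0 a = (if a = i \<and> c i then ereal (v i) else wmem s' ''sl'' 0 a)" for a
        using same slack cur j r
        by (auto simp: s''_def relax_body_def c_def upd_apply simp del: wval.simps(4,5))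
      then show "I (Suc i) (set_n (run relax_body s') ''j'' (Suc i))"
        using I unfolding s''_def[symmetric] by (auto simp: I_def upd_apply less_Suc_eq)
    qed (auto simp: relax_body_def)
  qed (auto simp: relax_names)
  then show ?thesis
    by (rule halts_within_weaken) (auto simp: relax_names I_def)
qed

section \<open>Choosing the dual step and shifting the potentials\<close>

definition find_min_body :: prog where
  "find_min_body =
    Cond (BAnd (NEq (NArr ''t'' (NVar ''j'')) (NConst 0)) (WLess (WArr ''sl'' (NVar ''j'')) (WVar ''d'')))
      (Seq (NSet ''y'' (NVar ''j'')) (WSet ''d'' (WArr ''sl'' (NVar ''j''))))
      Skip"

text \<open>The language has no constant for plus infinity; it is obtained by subtracting minus
  infinity from 0.\<close>

definition find_min :: prog where
  "find_min = Seq (WSet ''d'' (WMinus (WInt 0) WNegInf)) (For ''j'' find_min_body)"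

lemma find_min_names: "nwr find_min_body = {''y''}" "wwr find_min_body = {''d''}"
  "nwr find_min = {''j'', ''y''}" "wwr find_min = {''d''}"
  by (auto simp: find_min_def find_min_body_def)

lemma halts_within_find_min:
  assumes n: "nmem s ''n'' 0 0 = n" "n \<ge> 1" and sl: "warr s ''sl'' n sl"
    and ex: "\<exists>j\<in>{1..n}. nmem s ''t'' 0 j = 0"
  shows "halts_within find_min s (140 * n) (\<lambda>s'. frame {''j'', ''y''} {''d''} s s' \<and>
    nmem s' ''y'' 0 0 \<in> {1..n} \<and> nmem s ''t'' 0 (nmem s' ''y'' 0 0) = 0 \<and>
    wmem s' ''d'' 0 0 = ereal (sl (nmem s' ''y'' 0 0)) \<and>
    (\<forall>j\<in>{1..n}. nmem s ''t'' 0 j = 0 \<longrightarrow> sl (nmem s' ''y'' 0 0) \<le> sl j))"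
proof -
  define I where "I = (\<lambda>(i :: nat) (s' :: state).
    wmem s' ''d'' 0 0 = \<infinity> \<and> (\<forall>j\<in>{1..n}. j < i \<longrightarrow> nmem s ''t'' 0 j \<noteq> 0) \<or>
    nmem s' ''y'' 0 0 \<in> {1..n} \<and> nmem s ''t'' 0 (nmem s' ''y'' 0 0) = 0 \<and>
    wmem s' ''d'' 0 0 = ereal (sl (nmem s' ''y'' 0 0)) \<and>
    (\<forall>j\<in>{1..n}. j < i \<longrightarrow> nmem s ''t'' 0 j = 0 \<longrightarrow> sl (nmem s' ''y'' 0 0) \<le> sl j))"
  let ?s = "run (WSet ''d'' (WMinus (WInt 0) WNegInf)) s"
  have eqs: "nmem ?s = nmem s" "wmem ?s ''sl'' = wmem s ''sl''" by (auto simp: upd_apply fun_eq_iff)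
  have "halts_within (For ''j'' find_min_body) ?s ((100 + 30) * n)
    (\<lambda>s'. I (Suc n) s' \<and> frame (insert ''j'' (nwr find_min_body)) (wwr find_min_body) ?s s')"
  proof (rule halts_within_For)
    show "I 1 (set_n ?s ''j'' 1)" by (auto simp: I_def upd_apply)
    fix i s' assume i: "1 \<le> i" "i \<le> n" and fr: "frame (insert ''j'' (nwr find_min_body)) (wwr find_min_body) ?s s'"
      and j: "nmem s' ''j'' 0 0 = i" and I: "I i s'"
    have same: "nmem s' ''t'' = nmem s ''t''" "wmem s' ''sl'' = wmem s ''sl''"
      using frame_nmem[OF fr, of "''t''"] frame_wmem[OF fr, of "''sl''"] eqs by (auto simp: find_min_names)
    have sli: "wmem s ''sl'' 0 i = ereal (sl i)" using sl i by (simp add: warr_def)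
    show "halts_within find_min_body s' 100 (\<lambda>s''. I (Suc i) (set_n s'' ''j'' (Suc i)))"
    proof (rule halts_within_straight)
      define s'' where "s'' = run find_min_body s'"
      define c where "c \<longleftrightarrow> nmem s ''t'' 0 i = 0 \<and> ereal (sl i) < wmem s' ''d'' 0 0"
      have s'': "nmem s'' ''y'' 0 0 = (if c then i else nmem s' ''y'' 0 0)"
        "wmem s'' ''d'' 0 0 = (if c then ereal (sl i) else wmem s' ''d'' 0 0)"
        using same sli j by (auto simp: s''_def find_min_body_def c_def upd_apply)
      show "I (Suc i) (set_n (run find_min_body s') ''j'' (Suc i))"
        using I i unfolding s''_def[symmetric]
        by (auto simp: I_def s'' c_def less_Suc_eq)
    qed (auto simp: find_min_body_def)
  qed (use n eqs in \<open>auto simp: find_min_names\<close>)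
  then have "halts_within find_min s (tm (WSet ''d'' (WMinus (WInt 0) WNegInf)) + (100 + 30) * n)
    (\<lambda>s'. I (Suc n) s' \<and> frame (insert ''j'' (nwr find_min_body)) (wwr find_min_body) ?s s')"
    unfolding find_min_def by (intro halts_within_Seq_straight) auto
  from halts_within_frame[OF this] show ?thesis
    by (rule halts_within_weaken) (use n ex in \<open>auto simp: find_min_names I_def\<close>)
qed

text \<open>The nested read tests whether a row is in the forest. For a free row it reads cell 0 of
  \<open>t\<close>, whose label is never 0 after \<open>reset\<close>.\<close>

definition shift_rows :: prog where
  "shift_rows = For ''i'' (Cond (NEq (NArr ''t'' (NArr ''cu'' (NVar ''i''))) (NConst 0)) Skip
    (WSetArr ''al'' (NVar ''i'') (WMinus (WArr ''al'' (NVar ''i'')) (WVar ''d''))))"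

definition shift_cols :: prog where
  "shift_cols = For ''j'' (Cond (NEq (NArr ''t'' (NVar ''j'')) (NConst 0))
    (WSetArr ''sl'' (NVar ''j'') (WMinus (WArr ''sl'' (NVar ''j'')) (WVar ''d'')))
    (WSetArr ''be'' (NVar ''j'') (WPlus (WArr ''be'' (NVar ''j'')) (WVar ''d''))))"

lemma shift_names: "nwr shift_rows = {''i''}" "wwr shift_rows = {''al''}"
  "nwr shift_cols = {''j''}" "wwr shift_cols = {''sl'', ''be''}"
  by (auto simp: shift_rows_def shift_cols_def)

lemma halts_within_shift_rows:
  assumes n: "nmem s ''n'' 0 0 = n" "n \<ge> 1" and al: "warr s ''al'' n \<alpha>" and d: "wmem s ''d'' 0 0 = ereal \<delta>"
  shows "halts_within shift_rows s (130 * n) (\<lambda>s'. frame {''i''} {''al''} s s' \<and>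
    warr s' ''al'' n (\<lambda>i. if nmem s ''t'' 0 (nmem s ''cu'' 0 i) \<noteq> 0 then \<alpha> i - \<delta> else \<alpha> i))"
proof -
  let ?P = "Cond (NEq (NArr ''t'' (NArr ''cu'' (NVar ''i''))) (NConst 0)) Skip
    (WSetArr ''al'' (NVar ''i'') (WMinus (WArr ''al'' (NVar ''i'')) (WVar ''d'')))"
  define I where "I = (\<lambda>(i :: nat) (s' :: state). warr s' ''al'' n
    (\<lambda>j. if j < i \<and> nmem s ''t'' 0 (nmem s ''cu'' 0 j) \<noteq> 0 then \<alpha> j - \<delta> else \<alpha> j))"
  have "halts_within shift_rows s ((100 + 30) * n)
    (\<lambda>s'. I (Suc n) s' \<and> frame (insert ''i'' (nwr ?P)) (wwr ?P) s s')"
    unfolding shift_rows_def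
  proof (rule halts_within_For[OF n])
    show "I 1 (set_n s ''i'' 1)" using al by (auto simp: I_def warr_def)
    fix i s' assume i: "1 \<le> i" "i \<le> n" and fr: "frame (insert ''i'' (nwr ?P)) (wwr ?P) s s'"
      and j: "nmem s' ''i'' 0 0 = i" and I: "I i s'"
    have same: "nmem s' ''t'' = nmem s ''t''" "nmem s' ''cu'' = nmem s ''cu''" "wmem s' ''d'' = wmem s ''d''"
      using frame_nmem[OF fr] frame_wmem[OF fr] by auto
    show "halts_within ?P s' 100 (\<lambda>s''. I (Suc i) (set_n s'' ''i'' (Suc i)))"
      by (rule halts_within_straight)
        (use I i same j d in \<open>auto simp: I_def warr_def upd_apply less_Suc_eq\<close>)
  qed auto
  then show ?thesis
    by (rule halts_within_weaken) (auto simp: I_def warr_def)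
qed

lemma halts_within_shift_cols:
  assumes n: "nmem s ''n'' 0 0 = n" "n \<ge> 1" and be: "warr s ''be'' n \<beta>" and sl: "warr s ''sl'' n sl"
    and d: "wmem s ''d'' 0 0 = ereal \<delta>"
  shows "halts_within shift_cols s (130 * n) (\<lambda>s'. frame {''j''} {''sl'', ''be''} s s' \<and>
    warr s' ''be'' n (\<lambda>j. if nmem s ''t'' 0 j \<noteq> 0 then \<beta> j + \<delta> else \<beta> j) \<and>
    warr s' ''sl'' n (\<lambda>j. if nmem s ''t'' 0 j \<noteq> 0 then sl j else sl j - \<delta>))"
proof -
  let ?P = "Cond (NEq (NArr ''t'' (NVar ''j'')) (NConst 0))
    (WSetArr ''sl'' (NVar ''j'') (WMinus (WArr ''sl'' (NVar ''j'')) (WVar ''d'')))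
    (WSetArr ''be'' (NVar ''j'') (WPlus (WArr ''be'' (NVar ''j'')) (WVar ''d'')))"
  define I where "I = (\<lambda>(i :: nat) (s' :: state).
    warr s' ''be'' n (\<lambda>j. if j < i \<and> nmem s ''t'' 0 j \<noteq> 0 then \<beta> j + \<delta> else \<beta> j) \<and>
    warr s' ''sl'' n (\<lambda>j. if j < i \<and> nmem s ''t'' 0 j = 0 then sl j - \<delta> else sl j))"
  have "halts_within shift_cols s ((100 + 30) * n)
    (\<lambda>s'. I (Suc n) s' \<and> frame (insert ''j'' (nwr ?P)) (wwr ?P) s s')"
    unfolding shift_cols_def
  proof (rule halts_within_For[OF n])
    show "I 1 (set_n s ''j'' 1)" using be sl by (auto simp: I_def warr_def)
    fix i s' assume i: "1 \<le> i" "i \<le> n" and fr: "frame (insert ''j'' (nwr ?P)) (wwr ?P) s s'"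
      and j: "nmem s' ''j'' 0 0 = i" and I: "I i s'"
    have same: "nmem s' ''t'' = nmem s ''t''" "wmem s' ''d'' = wmem s ''d''"
      using frame_nmem[OF fr] frame_wmem[OF fr] by auto
    show "halts_within ?P s' 100 (\<lambda>s''. I (Suc i) (set_n s'' ''j'' (Suc i)))"
      by (rule halts_within_straight)
        (use I i same j d in \<open>auto simp: I_def warr_def upd_apply less_Suc_eq\<close>)
  qed auto
  then show ?thesis
    by (rule halts_within_weaken) (auto simp: I_def warr_def insert_commute)
qed

section \<open>Rooting the forest at all free rows\<close>

definition reset_body :: prog where
  "reset_body = Seq (NSetArr ''t'' (NVar ''j'') (NConst 0)) (WSetArr ''sl'' (NVar ''j'') (WMinus (WInt 0) WNegInf))"

text \<open>Label 1 on the null column makes every free row a root. Genuine columns are labelled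
  from 2 on, since \<open>grow\<close> increments \<open>st\<close> before using it.\<close>

definition reset :: prog where
  "reset = Seq (For ''j'' reset_body) (NSetArr ''t'' (NConst 0) (NConst 1))"

lemma halts_within_reset:
  assumes n: "nmem s ''n'' 0 0 = n" "n \<ge> 1"
  shows "halts_within reset s (140 * n) (\<lambda>s'. frame {''j'', ''t''} {''sl''} s s' \<and>
    nmem s' ''t'' 0 0 = 1 \<and> (\<forall>j\<in>{1..n}. nmem s' ''t'' 0 j = 0 \<and> wmem s' ''sl'' 0 j = \<infinity>))"
proof -
  define I where "I = (\<lambda>(i :: nat) (s' :: state). \<forall>j\<in>{1..n}. j < i \<longrightarrow> nmem s' ''t'' 0 j = 0 \<and> wmem s' ''sl'' 0 j = \<infinity>)"
  have "halts_within (For ''j'' reset_body) s ((100 + 30) * n)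
    (\<lambda>s'. I (Suc n) s' \<and> frame (insert ''j'' (nwr reset_body)) (wwr reset_body) s s')"
  proof (rule halts_within_For[OF n])
    show "I 1 (set_n s ''j'' 1)" by (auto simp: I_def)
    fix i s' assume i: "1 \<le> i" "i \<le> n" and j: "nmem s' ''j'' 0 0 = i" and I: "I i s'"
    show "halts_within reset_body s' 100 (\<lambda>s''. I (Suc i) (set_n s'' ''j'' (Suc i)))"
      by (rule halts_within_straight)
        (use I i j in \<open>auto simp: I_def reset_body_def upd_apply less_Suc_eq\<close>)
  qed (auto simp: reset_body_def)
  then have "halts_within reset s ((100 + 30) * n + 10) (\<lambda>s'.
    nmem s' ''t'' 0 0 = 1 \<and> (\<forall>j\<in>{1..n}. nmem s' ''t'' 0 j = 0 \<and> wmem s' ''sl'' 0 j = \<infinity>))"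
    unfolding reset_def
    by (rule halts_within_Seq) (auto intro!: halts_within_straight simp: upd_apply I_def)
  from halts_within_frame[OF this] show ?thesis
    by (rule halts_within_weaken) (use n in \<open>auto simp: reset_def reset_body_def insert_commute\<close>)
qed

definition start_body :: prog where
  "start_body = Cond (NEq (NArr ''cu'' (NVar ''i'')) (NConst 0)) (Seq (NSet ''r'' (NVar ''i'')) relax) Skip"

definition start :: prog where
  "start = Seq reset (For ''i'' start_body)"

lemma start_names: "nwr start_body = {''r'', ''j'', ''p''}" "wwr start_body = {''sl''}"
  "nwr start = {''i'', ''r'', ''j'', ''p'', ''t''}" "wwr start = {''sl''}"
  by (auto simp: start_def start_body_def relax_names reset_def reset_body_def)

lemma halts_within_start:
  assumes n: "nmem s ''n'' 0 0 = n" "n \<ge> 1"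
    and X: "wmat s ''X'' n X" and al: "warr s ''al'' n \<alpha>" and be: "warr s ''be'' n \<beta>"
    and ex: "\<exists>i\<in>{1..n}. nmem s ''cu'' 0 i = 0" and f: "\<And>i. i \<in> {1..n} \<Longrightarrow> nmem s ''cu'' 0 i \<le> n"
  shows "halts_within start s (400 * (n * n)) (\<lambda>s'. frame (nwr start) (wwr start) s s' \<and>
    nmem s' ''t'' 0 0 = 1 \<and> (\<forall>j\<in>{1..n}. nmem s' ''t'' 0 j = 0) \<and>
    (\<exists>sl. warr s' ''sl'' n sl \<and> forest_inv n X (nmem s ''cu'' 0) \<alpha> \<beta> (nmem s' ''t'' 0) (nmem s' ''p'' 0) sl))"
proof -
  let ?f = "nmem s ''cu'' 0"
  define v where "v = (\<lambda>r j. \<alpha> r + \<beta> j - X r j)"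
  \<comment> \<open>Until the first free row is met, the slack is infinite and the parent arbitrary;
    \<open>ex\<close> excludes this alternative at the end of the loop.\<close>
  define K where "K = (\<lambda>(i :: nat) (s' :: state) j.
    wmem s' ''sl'' 0 j = \<infinity> \<and> (\<forall>r\<in>{1..n}. r < i \<longrightarrow> ?f r \<noteq> 0) \<or>
    nmem s' ''p'' 0 j \<in> {1..n} \<and> ?f (nmem s' ''p'' 0 j) = 0 \<and> wmem s' ''sl'' 0 j = ereal (v (nmem s' ''p'' 0 j) j) \<and>
      (\<forall>r\<in>{1..n}. r < i \<longrightarrow> ?f r = 0 \<longrightarrow> v (nmem s' ''p'' 0 j) j \<le> v r j))"
  define I where "I = (\<lambda>(i :: nat) (s' :: state). \<forall>j\<in>{1..n}. K i s' j)"
  have "halts_within start s (140 * n + (150 * n + 30) * n)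
    (\<lambda>s'. nmem s' ''t'' 0 0 = 1 \<and> (\<forall>j\<in>{1..n}. nmem s' ''t'' 0 j = 0) \<and> I (Suc n) s')"
    unfolding start_def
  proof (rule halts_within_Seq[OF halts_within_reset[OF n]])
    fix s1 assume s1: "frame {''j'', ''t''} {''sl''} s s1 \<and>
      nmem s1 ''t'' 0 0 = 1 \<and> (\<forall>j\<in>{1..n}. nmem s1 ''t'' 0 j = 0 \<and> wmem s1 ''sl'' 0 j = \<infinity>)"
    then have fr1: "frame {''j'', ''t''} {''sl''} s s1" by simp
    have same1: "nmem s1 ''n'' = nmem s ''n''" "nmem s1 ''cu'' = nmem s ''cu''" "wmem s1 ''al'' = wmem s ''al''"
      "wmem s1 ''be'' = wmem s ''be''" "wmem s1 ''X'' = wmem s ''X''"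
      using frame_nmem[OF fr1] frame_wmem[OF fr1] by auto
    have n1: "nmem s1 ''n'' 0 0 = n" using same1 n by simp
    have "halts_within (For ''i'' start_body) s1 ((150 * n + 30) * n) (\<lambda>s'. I (Suc n) s' \<and>
      frame (insert ''i'' (nwr start_body)) (wwr start_body) s1 s')"
    proof (rule halts_within_For[OF n1 n(2)])
      show "I 1 (set_n s1 ''i'' 1)" using s1 by (auto simp: I_def K_def)
      fix i s' assume i: "1 \<le> i" "i \<le> n" and fr: "frame (insert ''i'' (nwr start_body)) (wwr start_body) s1 s'"
        and ii: "nmem s' ''i'' 0 0 = i" and n': "nmem s' ''n'' 0 0 = n" and I: "I i s'"
      have same: "nmem s' ''t'' = nmem s1 ''t''" "nmem s' ''cu'' = nmem s ''cu''" "wmem s' ''al'' = wmem s ''al''"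
        "wmem s' ''be'' = wmem s ''be''" "wmem s' ''X'' = wmem s ''X''"
        using frame_nmem[OF fr] frame_wmem[OF fr] same1 by (auto simp: start_names)
      let ?s = "run (NSet ''r'' (NVar ''i'')) s'"
      have eqs: "nmem ?s ''n'' = nmem s' ''n''" "nmem ?s ''t'' = nmem s' ''t''" "nmem ?s ''p'' = nmem s' ''p''"
        "nmem ?s ''r'' 0 0 = i" "wmem ?s = wmem s'"
        using ii by (auto simp: upd_apply fun_eq_iff)
      show "halts_within start_body s' (150 * n) (\<lambda>s''. I (Suc i) (set_n s'' ''i'' (Suc i)))"
      proof (cases "?f i = 0")
        case False
        then have "halts_within start_body s' (1 + bcost (NEq (NArr ''cu'' (NVar ''i'')) (NConst 0)) + 1)
            (\<lambda>s''. I (Suc i) (set_n s'' ''i'' (Suc i)))"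
          unfolding start_body_def using ii same I
          by (intro halts_within_CondFalse halts_within_straight) (auto simp: I_def K_def less_Suc_eq)
        then show ?thesis by (rule halts_within_weaken) (use n in auto)
      next
        case True
        have Xs: "wmat ?s ''X'' n X" using X unfolding wmat_def eqs same .
        have als: "warr ?s ''al'' n \<alpha>" using al unfolding warr_def eqs same .
        have bes: "warr ?s ''be'' n \<beta>" using be unfolding warr_def eqs same .
        have "i \<in> {1..n}" using i by simp
        have ns: "nmem ?s ''n'' 0 0 = n" using n' eqs by simp
        note relax = halts_within_relax[OF ns n(2) Xs als bes eqs(4) \<open>i \<in> {1..n}\<close>]
        have "halts_within relax ?s (130 * n) (\<lambda>s''. I (Suc i) (set_n s'' ''i'' (Suc i)))"
        proof (rule halts_within_weaken[OF relax order_refl])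
          fix s'' assume s'': "frame {''j'', ''p''} {''sl''} ?s s'' \<and>
             (\<forall>j\<in>{1..n}.
                 nmem s'' ''p'' 0 j = (if nmem ?s ''t'' 0 j = 0 \<and> ereal (\<alpha> i + \<beta> j - X i j) < wmem ?s ''sl'' 0 j
                    then i else nmem ?s ''p'' 0 j) \<and>
                 wmem s'' ''sl'' 0 j = (if nmem ?s ''t'' 0 j = 0 \<and> ereal (\<alpha> i + \<beta> j - X i j) < wmem ?s ''sl'' 0 j
                    then ereal (\<alpha> i + \<beta> j - X i j) else wmem ?s ''sl'' 0 j))"
          have t0: "nmem ?s ''t'' 0 j = 0" if "j \<in> {1..n}" for j using eqs same s1 that by simp
          have new: "nmem s'' ''p'' 0 j = (if ereal (v i j) < wmem s' ''sl'' 0 j then i else nmem s' ''p'' 0 j)"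
            "wmem s'' ''sl'' 0 j = (if ereal (v i j) < wmem s' ''sl'' 0 j then ereal (v i j) else wmem s' ''sl'' 0 j)"
            if "j \<in> {1..n}" for j
            using s'' t0[OF that] that eqs by (auto simp: v_def)
          show "I (Suc i) (set_n s'' ''i'' (Suc i))"
            unfolding I_def
          proof
            fix j assume j: "j \<in> {1..n}"
            let ?p = "nmem s' ''p'' 0 j"
            from bspec[OF I[unfolded I_def] j] show "K (Suc i) (set_n s'' ''i'' (Suc i)) j"
              unfolding K_def
            proof (elim disjE, goal_cases)
              case 1
              then show ?case using new[OF j] i True by (auto simp: less_Suc_eq)
            next
              case 2
              have "v i j \<le> v r j" if "v i j < v ?p j" "r \<in> {1..n}" "r < i" "?f r = 0" for r
                using 2 that by force
              then show ?case using new[OF j] i True 2 by (auto simp: less_Suc_eq)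
            qed
          qed
        qed
        then have "halts_within start_body s' (1 + bcost (NEq (NArr ''cu'' (NVar ''i'')) (NConst 0)) +
            (tm (NSet ''r'' (NVar ''i'')) + 130 * n))
            (\<lambda>s''. I (Suc i) (set_n s'' ''i'' (Suc i)))"
          unfolding start_body_def using ii same True
          by (intro halts_within_CondTrue halts_within_Seq_straight) auto
        then show ?thesis by (rule halts_within_weaken) (use n in auto)
      qed
    qed (auto simp: start_names)
    then show "halts_within (For ''i'' start_body) s1 ((150 * n + 30) * n)
      (\<lambda>s'. nmem s' ''t'' 0 0 = 1 \<and> (\<forall>j\<in>{1..n}. nmem s' ''t'' 0 j = 0) \<and> I (Suc n) s')"
    proof (rule halts_within_weaken)
      fix s' assume s': "I (Suc n) s' \<and>
        frame (insert ''i'' (nwr start_body)) (wwr start_body) s1 s'"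
      then have "nmem s' ''t'' = nmem s1 ''t''" by (intro frame_nmem) (auto simp: start_names)
      then show "nmem s' ''t'' 0 0 = 1 \<and> (\<forall>j\<in>{1..n}. nmem s' ''t'' 0 j = 0) \<and> I (Suc n) s'"
        using s1 s' by auto
    qed simp
  qed
  from halts_within_frame[OF this] show ?thesis
  proof (rule halts_within_weaken)
    have "n * 1 \<le> n * n" using n by (intro mult_left_mono) auto
    then show "140 * n + (150 * n + 30) * n \<le> 400 * (n * n)" by (simp add: algebra_simps)
    fix s' assume s': "(nmem s' ''t'' 0 0 = 1 \<and> (\<forall>j\<in>{1..n}. nmem s' ''t'' 0 j = 0) \<and> I (Suc n) s') \<and>
      frame (nwr start) (wwr start) s s'"
    let ?p = "nmem s' ''p'' 0" and ?t = "nmem s' ''t'' 0"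
    have I': "I (Suc n) s'" using s' by simp
    have I: "?p j \<in> {1..n}" "?f (?p j) = 0" "wmem s' ''sl'' 0 j = ereal (v (?p j) j)"
      "\<And>r. r \<in> {1..n} \<Longrightarrow> ?f r = 0 \<Longrightarrow> v (?p j) j \<le> v r j" if j: "j \<in> {1..n}" for j
    proof -
      have "\<not> (\<forall>r\<in>{1..n}. r < Suc n \<longrightarrow> ?f r \<noteq> 0)" using ex by auto
      then have "?p j \<in> {1..n} \<and> ?f (?p j) = 0 \<and> wmem s' ''sl'' 0 j = ereal (v (?p j) j) \<and>
        (\<forall>r\<in>{1..n}. r < Suc n \<longrightarrow> ?f r = 0 \<longrightarrow> v (?p j) j \<le> v r j)"
        using bspec[OF I'[unfolded I_def] j] unfolding K_def by argo
      then show "?p j \<in> {1..n}" "?f (?p j) = 0" "wmem s' ''sl'' 0 j = ereal (v (?p j) j)"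
        "\<And>r. r \<in> {1..n} \<Longrightarrow> ?f r = 0 \<Longrightarrow> v (?p j) j \<le> v r j" by auto
    qed
    have "warr s' ''sl'' n (\<lambda>j. v (?p j) j)" using I(3) by (simp add: warr_def)
    \<comment> \<open>Before growth only the null column is labelled, so the forest rows are the
      free rows.\<close>
    moreover have free: "?f r = 0" if "r \<in> {1..n}" "?t (?f r) \<noteq> 0" for r
    proof (rule ccontr)
      assume "?f r \<noteq> 0"
      then have "?f r \<in> {1..n}" using f[OF that(1)] by simp
      then show False using s' that by simp
    qed
    have "forest_inv n X ?f \<alpha> \<beta> ?t ?p (\<lambda>j. v (?p j) j)"
      unfolding forest_inv_def
    proof (intro conjI ballI impI)
      fix j r assume "j \<in> {1..n}" "r \<in> {1..n}" "?t (?f r) \<noteq> 0"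
      then show "v (?p j) j \<le> \<alpha> r + \<beta> j - X r j" using I(4)[of j r] free[of r] by (simp add: v_def)
    qed (use I(1,2) s' in \<open>auto simp: v_def\<close>)
    ultimately show "frame (nwr start) (wwr start) s s' \<and>
      nmem s' ''t'' 0 0 = 1 \<and> (\<forall>j\<in>{1..n}. nmem s' ''t'' 0 j = 0) \<and>
      (\<exists>sl. warr s' ''sl'' n sl \<and> forest_inv n X ?f \<alpha> \<beta> ?t ?p sl)"
      using s' by blast
  qed
qed

section \<open>Growing the forest until it reaches a free column\<close>

definition grow :: prog where
  "grow = Seq (Seq (NSet ''st'' (NPlus (NVar ''st'') (NConst 1))) (NSetArr ''t'' (NVar ''y'') (NVar ''st'')))
    (Cond (NEq (NArr ''cv'' (NVar ''y'')) (NConst 0))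
      (NSet ''fl'' (NConst 0))
      (Seq (NSet ''r'' (NArr ''cv'' (NVar ''y''))) relax))"

text \<open>The flag \<open>fl\<close> drops to 0 when the column just labelled is free;
  \<open>y\<close> then stays in memory as the start of the augmentation.\<close>

definition grow_loop :: prog where
  "grow_loop = Seq (Seq (NSet ''st'' (NConst 1)) (NSet ''fl'' (NConst 1)))
    (While (NEq (NVar ''fl'') (NConst 1)) (Seq find_min (Seq shift_rows (Seq shift_cols grow))))"

definition grow_names :: "name set" where
  "grow_names = {''i'', ''j'', ''p'', ''r'', ''y'', ''t'', ''st'', ''fl''}"

definition grow_wnames :: "name set" where
  "grow_wnames = {''al'', ''be'', ''sl'', ''d''}"

lemma grow_loop_names: "nwr grow_loop = grow_names" "wwr grow_loop = grow_wnames"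
  "nwr (Seq find_min (Seq shift_rows (Seq shift_cols grow))) \<subseteq> grow_names"
  "wwr (Seq find_min (Seq shift_rows (Seq shift_cols grow))) \<subseteq> grow_wnames"
  by (auto simp: grow_loop_def grow_def shift_names find_min_names relax_names grow_names_def grow_wnames_def)

context
  fixes n :: nat and X :: "nat \<Rightarrow> nat \<Rightarrow> real" and s0 :: state and f g :: "nat \<Rightarrow> nat"
  assumes n0: "nmem s0 ''n'' 0 0 = n" "n \<ge> 1" and X0: "wmat s0 ''X'' n X"
    and f0: "nmem s0 ''cu'' 0 = f" and g0: "nmem s0 ''cv'' 0 = g"
    and r: "rep n f g" and free: "card (edges_of n f) < n"
begin

definition forest_state :: "state \<Rightarrow> (nat \<Rightarrow> real) \<Rightarrow> (nat \<Rightarrow> real) \<Rightarrow> (nat \<Rightarrow> real) \<Rightarrow> bool" where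
  "forest_state s \<alpha> \<beta> sl \<longleftrightarrow> warr s ''al'' n \<alpha> \<and> warr s ''be'' n \<beta> \<and> warr s ''sl'' n sl \<and>
    dual_inv n X f g \<alpha> \<beta> \<and> forest_inv n X f \<alpha> \<beta> (nmem s ''t'' 0) (nmem s ''p'' 0) sl"

text \<open>Each new label uses up an unlabelled column, so their joint budget keeps labels at most
  \<open>n + 1\<close>; this later bounds the length of the augmenting path. While the flag is set
  no labelled column is free, as the dual shift requires.\<close>

definition grow_inv :: "state \<Rightarrow> bool" where
  "grow_inv s \<longleftrightarrow> frame grow_names grow_wnames s0 s \<and> (\<exists>\<alpha> \<beta> sl. forest_state s \<alpha> \<beta> sl) \<and>
    (\<forall>j\<le>n. nmem s ''t'' 0 j \<le> nmem s ''st'' 0 0) \<and>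
    nmem s ''st'' 0 0 + card {j\<in>{1..n}. nmem s ''t'' 0 j = 0} \<le> Suc n \<and>
    (nmem s ''fl'' 0 0 = 1 \<longrightarrow> (\<forall>j\<in>{1..n}. nmem s ''t'' 0 j \<noteq> 0 \<longrightarrow> g j \<noteq> 0)) \<and>
    (nmem s ''fl'' 0 0 \<noteq> 1 \<longrightarrow> nmem s ''y'' 0 0 \<in> {1..n} \<and> nmem s ''t'' 0 (nmem s ''y'' 0 0) \<noteq> 0 \<and>
      g (nmem s ''y'' 0 0) = 0)"

lemma grow_same:
  assumes "frame grow_names grow_wnames s0 s"
  shows "nmem s ''n'' 0 0 = n" "wmat s ''X'' n X" "nmem s ''cu'' 0 = f" "nmem s ''cv'' 0 = g"
  using frame_nmem[OF assms] frame_wmem[OF assms] n0 X0 f0 g0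
  by (auto simp: grow_names_def grow_wnames_def wmat_def)

lemma card_unlabelled_upd:
  fixes t :: "nat \<Rightarrow> nat"
  assumes "y \<in> {1..n}" "t y = 0" "v \<noteq> 0"
  shows "Suc (card {j\<in>{1..n}. (t(y := v)) j = 0}) = card {j\<in>{1..n}. t j = 0}"
proof -
  have "{j\<in>{1..n}. t j = 0} = insert y {j\<in>{1..n}. (t(y := v)) j = 0}" using assms by auto
  moreover have "y \<notin> {j\<in>{1..n}. (t(y := v)) j = 0}" using assms by auto
  ultimately show ?thesis by simp
qed

lemma halts_within_grow:
  assumes fr: "frame grow_names grow_wnames s0 s" and fs: "forest_state s \<alpha> \<beta> sl"
    and st: "\<And>j. j \<le> n \<Longrightarrow> nmem s ''t'' 0 j \<le> nmem s ''st'' 0 0"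
    and count: "nmem s ''st'' 0 0 + card {j\<in>{1..n}. nmem s ''t'' 0 j = 0} \<le> Suc n"
    and fl: "nmem s ''fl'' 0 0 = 1" and matched: "\<And>j. j \<in> {1..n} \<Longrightarrow> nmem s ''t'' 0 j \<noteq> 0 \<Longrightarrow> g j \<noteq> 0"
    and y: "nmem s ''y'' 0 0 = y" "y \<in> {1..n}" "nmem s ''t'' 0 y = 0" "sl y = 0"
  shows "halts_within grow s (200 * n) (\<lambda>s'. grow_inv s' \<and>
    Suc (card {j\<in>{1..n}. nmem s' ''t'' 0 j = 0}) = card {j\<in>{1..n}. nmem s ''t'' 0 j = 0})"
    (is "halts_within _ _ _ ?Q")
proof -
  let ?t = "nmem s ''t'' 0" and ?st = "nmem s ''st'' 0 0"
  let ?P = "Seq (NSet ''st'' (NPlus (NVar ''st'') (NConst 1))) (NSetArr ''t'' (NVar ''y'') (NVar ''st''))"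
  let ?C = "NEq (NArr ''cv'' (NVar ''y'')) (NConst 0)"
  define s1 where "s1 = run ?P s"
  define t1 where "t1 = ?t(y := Suc ?st)"
  note same = grow_same[OF fr]
  have s1: "nmem s1 ''t'' 0 = t1" "nmem s1 ''st'' 0 0 = Suc ?st" "nmem s1 ''p'' = nmem s ''p''" "nmem s1 ''y'' 0 0 = y"
    "nmem s1 ''fl'' = nmem s ''fl''" "nmem s1 ''cv'' 0 = g" "nmem s1 ''n'' = nmem s ''n''" "wmem s1 = wmem s"
    using y same by (auto simp: s1_def t1_def upd_apply fun_eq_iff)
  have fr1: "frame grow_names grow_wnames s0 s1"
    by (rule frame_trans[OF fr]) (auto simp: s1_def frame_def upd_def grow_names_def)
  have ws: "warr s ''al'' n \<alpha>" "warr s ''be'' n \<beta>" "warr s ''sl'' n sl" "dual_inv n X f g \<alpha> \<beta>"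
    and fo: "forest_inv n X f \<alpha> \<beta> ?t (nmem s ''p'' 0) sl"
    using fs by (auto simp: forest_state_def)
  have dec: "Suc (card {j\<in>{1..n}. t1 j = 0}) = card {j\<in>{1..n}. ?t j = 0}"
    unfolding t1_def by (rule card_unlabelled_upd[where t = ?t, OF y(2,3)]) simp
  have t1_le: "t1 j \<le> Suc ?st" if "j \<le> n" for j using st[OF that] by (simp add: t1_def)
  have less: "?t j < Suc ?st" if "j \<le> n" for j using st[OF that] by simp
  have "halts_within grow s (tm ?P + (1 + bcost ?C + (10 + 130 * n))) ?Q"
    unfolding grow_def
  proof (rule halts_within_Seq_straight, simp, fold s1_def, cases "g y = 0")
    case True
    have "forest_inv n X f \<alpha> \<beta> t1 (nmem s ''p'' 0) sl"
      unfolding t1_def by (rule forest_inv_add[OF r fo y(2,3,4) less]) (use True in auto)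
    define s2 where "s2 = run (NSet ''fl'' (NConst 0)) s1"
    have s2: "nmem s2 ''t'' 0 = t1" "nmem s2 ''st'' 0 0 = Suc ?st" "nmem s2 ''p'' = nmem s ''p''" "nmem s2 ''y'' 0 0 = y"
      "nmem s2 ''fl'' 0 0 = 0" "wmem s2 = wmem s"
      using s1 by (auto simp: s2_def upd_apply fun_eq_iff)
    have fr2: "frame grow_names grow_wnames s0 s2"
      by (rule frame_trans[OF fr1]) (auto simp: s2_def frame_def upd_def grow_names_def)
    have "forest_state s2 \<alpha> \<beta> sl"
      using ws \<open>forest_inv n X f \<alpha> \<beta> t1 (nmem s ''p'' 0) sl\<close> unfolding forest_state_def s2 warr_def by simp
    then have "grow_inv s2"
      unfolding grow_inv_def s2 using fr2 t1_le dec count y True by (auto simp: t1_def)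
    then have "halts_within (NSet ''fl'' (NConst 0)) s1 (10 + 130 * n) ?Q"
      using dec s2 by (intro halts_within_straight) (simp_all add: s2_def)
    then show "halts_within (Cond ?C (NSet ''fl'' (NConst 0)) (Seq (NSet ''r'' (NArr ''cv'' (NVar ''y''))) relax)) s1
        (1 + bcost ?C + (10 + 130 * n)) ?Q"
      by (intro halts_within_CondTrue) (use True s1 in auto)
  next
    case False
    have gy: "g y \<in> {1..n}" using repD2[OF r y(2) False] by simp
    define s2 where "s2 = run (NSet ''r'' (NArr ''cv'' (NVar ''y''))) s1"
    have s2: "nmem s2 ''t'' 0 = t1" "nmem s2 ''st'' 0 0 = Suc ?st" "nmem s2 ''p'' = nmem s ''p''" "nmem s2 ''y'' 0 0 = y"
      "nmem s2 ''fl'' = nmem s ''fl''" "nmem s2 ''n'' 0 0 = n" "nmem s2 ''r'' 0 0 = g y" "wmem s2 = wmem s"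
      using s1 same by (auto simp: s2_def upd_apply fun_eq_iff)
    have fr2: "frame grow_names grow_wnames s0 s2"
      by (rule frame_trans[OF fr1]) (auto simp: s2_def frame_def upd_def grow_names_def)
    have w2: "wmat s2 ''X'' n X" "warr s2 ''al'' n \<alpha>" "warr s2 ''be'' n \<beta>"
      using ws same unfolding wmat_def warr_def s2 by auto
    have "halts_within relax s2 (130 * n) ?Q"
    proof (rule halts_within_weaken[OF halts_within_relax[OF s2(6) n0(2) w2 s2(7) gy] order_refl], unfold s2)
      fix s' assume s': "frame {''j'', ''p''} {''sl''} s2 s' \<and>
             (\<forall>j\<in>{1..n}.
                 nmem s' ''p'' 0 j = (if t1 j = 0 \<and> ereal (\<alpha> (g y) + \<beta> j - X (g y) j) < wmem s ''sl'' 0 j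
                    then g y else nmem s ''p'' 0 j) \<and>
                 wmem s' ''sl'' 0 j = (if t1 j = 0 \<and> ereal (\<alpha> (g y) + \<beta> j - X (g y) j) < wmem s ''sl'' 0 j
                    then ereal (\<alpha> (g y) + \<beta> j - X (g y) j) else wmem s ''sl'' 0 j))"
      define v where "v = (\<lambda>j. \<alpha> (g y) + \<beta> j - X (g y) j)"
      define sl' where "sl' = (\<lambda>j. if g y \<noteq> 0 \<and> j \<noteq> y \<and> ?t j = 0 \<and> v j < sl j then v j else sl j)"
      have t1: "t1 j = 0 \<longleftrightarrow> j \<noteq> y \<and> ?t j = 0" for j by (auto simp: t1_def)
      have slj: "wmem s ''sl'' 0 j = ereal (sl j)" if "j \<in> {1..n}" for j using ws that by (simp add: warr_def)
      have new: "nmem s' ''p'' 0 j = (if g y \<noteq> 0 \<and> j \<noteq> y \<and> ?t j = 0 \<and> v j < sl j then g y else nmem s ''p'' 0 j)"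
        "wmem s' ''sl'' 0 j = ereal (sl' j)" if "j \<in> {1..n}" for j
        using s' that slj[OF that] False by (auto simp: t1 sl'_def v_def)
      have fr': "frame {''j'', ''p''} {''sl''} s2 s'" using s' by simp
      have s's: "nmem s' ''t'' 0 = t1" "nmem s' ''st'' 0 0 = Suc ?st" "nmem s' ''y'' 0 0 = y"
        "nmem s' ''fl'' 0 0 = 1" "wmem s' ''al'' = wmem s ''al''" "wmem s' ''be'' = wmem s ''be''"
        using frame_nmem[OF fr'] frame_wmem[OF fr'] s2 fl by auto
      have "frame grow_names grow_wnames s0 s'"
        by (rule frame_trans[OF fr2 frame_mono[OF fr']]) (auto simp: grow_names_def grow_wnames_def)
      moreover have "forest_inv n X f \<alpha> \<beta> t1 (nmem s' ''p'' 0) sl'"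
        unfolding t1_def
        by (rule forest_inv_add[OF r fo y(2,3,4) less]) (use new(1) in \<open>auto simp: sl'_def v_def\<close>)
      then have "forest_state s' \<alpha> \<beta> sl'"
        using ws new(2) unfolding forest_state_def s's warr_def by simp
      ultimately show "grow_inv s' \<and> Suc (card {j\<in>{1..n}. nmem s' ''t'' 0 j = 0}) = card {j\<in>{1..n}. ?t j = 0}"
        unfolding grow_inv_def s's using t1_le dec count matched False by (auto simp: t1_def)
    qed
    then have "halts_within (Seq (NSet ''r'' (NArr ''cv'' (NVar ''y''))) relax) s1 (8 + 130 * n) ?Q"
      unfolding s2_def by (rule halts_within_weaken[OF halts_within_Seq_straight, rotated]) auto
    then show "halts_within (Cond ?C (NSet ''fl'' (NConst 0)) (Seq (NSet ''r'' (NArr ''cv'' (NVar ''y''))) relax)) s1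
        (1 + bcost ?C + (10 + 130 * n)) ?Q"
      by (intro halts_within_CondFalse) (use False s1 in \<open>auto elim: halts_within_weaken\<close>)
  qed
  then show ?thesis by (rule halts_within_weaken) (use n0 in auto)
qed

lemma halts_within_grow_step:
  assumes inv: "grow_inv s" and fl: "nmem s ''fl'' 0 0 = 1"
  shows "halts_within (Seq find_min (Seq shift_rows (Seq shift_cols grow))) s (600 * n) (\<lambda>s'. grow_inv s' \<and>
    Suc (card {j\<in>{1..n}. nmem s' ''t'' 0 j = 0}) = card {j\<in>{1..n}. nmem s ''t'' 0 j = 0})"
    (is "halts_within _ _ _ ?Q")
proof -
  let ?t = "nmem s ''t'' 0"
  obtain \<alpha> \<beta> sl where fs: "forest_state s \<alpha> \<beta> sl" using inv by (auto simp: grow_inv_def)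
  have fr: "frame grow_names grow_wnames s0 s" and matched: "\<And>j. j \<in> {1..n} \<Longrightarrow> ?t j \<noteq> 0 \<Longrightarrow> g j \<noteq> 0"
    using inv fl by (auto simp: grow_inv_def)
  note same = grow_same[OF fr]
  have ws: "warr s ''al'' n \<alpha>" "warr s ''be'' n \<beta>" "warr s ''sl'' n sl" "dual_inv n X f g \<alpha> \<beta>"
    and fo: "forest_inv n X f \<alpha> \<beta> ?t (nmem s ''p'' 0) sl"
    using fs by (auto simp: forest_state_def)
  \<comment> \<open>The matching is not perfect, so some column is free, and a free column cannot be
    labelled yet.\<close>
  have ex: "\<exists>j\<in>{1..n}. ?t j = 0"
    using ex_free[of n g f] r rep_commute free card_edges_of_swap[OF r] matched by metis
  have "halts_within (Seq find_min (Seq shift_rows (Seq shift_cols grow))) s (140 * n + (130 * n + (130 * n + 200 * n))) ?Q"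
  proof (rule halts_within_Seq[OF halts_within_find_min[OF same(1) n0(2) ws(3) ex]])
    fix s1 assume s1: "frame {''j'', ''y''} {''d''} s s1 \<and>
      nmem s1 ''y'' 0 0 \<in> {1..n} \<and> ?t (nmem s1 ''y'' 0 0) = 0 \<and>
      wmem s1 ''d'' 0 0 = ereal (sl (nmem s1 ''y'' 0 0)) \<and>
      (\<forall>j\<in>{1..n}. ?t j = 0 \<longrightarrow> sl (nmem s1 ''y'' 0 0) \<le> sl j)"
    define y where "y = nmem s1 ''y'' 0 0"
    define \<delta> where "\<delta> = sl y"
    have y: "y \<in> {1..n}" "?t y = 0" "\<And>j. j \<in> {1..n} \<Longrightarrow> ?t j = 0 \<Longrightarrow> \<delta> \<le> sl j" and d1: "wmem s1 ''d'' 0 0 = ereal \<delta>"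
      using s1 by (auto simp: y_def \<delta>_def)
    have \<delta>: "0 \<le> \<delta>" unfolding \<delta>_def by (rule forest_slack_nonneg[OF ws(4) fo y(1,2)])
    have fr1: "frame {''j'', ''y''} {''d''} s s1" using s1 by simp
    have s1s: "nmem s1 ''n'' 0 0 = n" "nmem s1 ''t'' = nmem s ''t''" "nmem s1 ''cu'' 0 = f" "wmem s1 ''al'' = wmem s ''al''"
      "wmem s1 ''be'' = wmem s ''be''" "wmem s1 ''sl'' = wmem s ''sl''"
      "nmem s1 ''st'' = nmem s ''st''" "nmem s1 ''fl'' = nmem s ''fl''" "nmem s1 ''p'' = nmem s ''p''"
      using frame_nmem[OF fr1] frame_wmem[OF fr1] same by auto
    have w1: "warr s1 ''al'' n \<alpha>" using ws unfolding warr_def s1s by simp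
    let ?\<alpha> = "\<lambda>i. if ?t (f i) \<noteq> 0 then \<alpha> i - \<delta> else \<alpha> i"
    let ?\<beta> = "\<lambda>j. if ?t j \<noteq> 0 then \<beta> j + \<delta> else \<beta> j"
    let ?sl = "\<lambda>j. if ?t j \<noteq> 0 then sl j else sl j - \<delta>"
    show "halts_within (Seq shift_rows (Seq shift_cols grow)) s1 (130 * n + (130 * n + 200 * n)) ?Q"
    proof (rule halts_within_Seq[OF halts_within_shift_rows[OF s1s(1) n0(2) w1 d1]])
      fix s2 assume s2: "frame {''i''} {''al''} s1 s2 \<and>
        warr s2 ''al'' n (\<lambda>i. if nmem s1 ''t'' 0 (nmem s1 ''cu'' 0 i) \<noteq> 0 then \<alpha> i - \<delta> else \<alpha> i)"
      then have fr2: "frame {''i''} {''al''} s1 s2" and al2: "warr s2 ''al'' n ?\<alpha>" by (auto simp: s1s)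
      have s2s: "nmem s2 ''n'' 0 0 = n" "nmem s2 ''t'' = nmem s ''t''"
        "wmem s2 ''be'' = wmem s ''be''" "wmem s2 ''sl'' = wmem s ''sl''" "wmem s2 ''d'' 0 0 = ereal \<delta>"
        "nmem s2 ''st'' = nmem s ''st''" "nmem s2 ''fl'' = nmem s ''fl''" "nmem s2 ''p'' = nmem s ''p''"
        "nmem s2 ''y'' 0 0 = y"
        using frame_nmem[OF fr2] frame_wmem[OF fr2] s1s d1 by (auto simp: y_def)
      have w2: "warr s2 ''be'' n \<beta>" "warr s2 ''sl'' n sl" using ws unfolding warr_def s2s by auto
      show "halts_within (Seq shift_cols grow) s2 (130 * n + 200 * n) ?Q"
      proof (rule halts_within_Seq[OF halts_within_shift_cols[OF s2s(1) n0(2) w2 s2s(5)]])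
        fix s3 assume s3: "frame {''j''} {''sl'', ''be''} s2 s3 \<and>
          warr s3 ''be'' n (\<lambda>j. if nmem s2 ''t'' 0 j \<noteq> 0 then \<beta> j + \<delta> else \<beta> j) \<and>
          warr s3 ''sl'' n (\<lambda>j. if nmem s2 ''t'' 0 j \<noteq> 0 then sl j else sl j - \<delta>)"
        then have fr3: "frame {''j''} {''sl'', ''be''} s2 s3" and w3: "warr s3 ''be'' n ?\<beta>" "warr s3 ''sl'' n ?sl"
          by (auto simp: s2s)
        have s3s: "nmem s3 ''t'' = nmem s ''t''" "wmem s3 ''al'' = wmem s2 ''al''"
          "nmem s3 ''st'' = nmem s ''st''" "nmem s3 ''fl'' = nmem s ''fl''" "nmem s3 ''p'' = nmem s ''p''"
          "nmem s3 ''y'' 0 0 = y"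
          using frame_nmem[OF fr3] frame_wmem[OF fr3] s2s by auto
        have fr03: "frame grow_names grow_wnames s0 s3"
          by (rule frame_trans[OF fr], rule frame_trans[OF frame_mono[OF fr1]], unfold grow_names_def grow_wnames_def, simp, simp,
              rule frame_trans[OF frame_mono[OF fr2] frame_mono[OF fr3]]) auto
        have "dual_inv n X f g ?\<alpha> ?\<beta>"
          by (rule dual_inv_shift[OF r ws(4) fo matched \<delta> y(3)]) auto
        moreover have "forest_inv n X f ?\<alpha> ?\<beta> ?t (nmem s ''p'' 0) ?sl"
          by (rule forest_inv_shift[OF r ws(4) fo matched \<delta> y(3)]) auto
        ultimately have fs3: "forest_state s3 ?\<alpha> ?\<beta> ?sl"
          using al2 w3 unfolding forest_state_def s3s warr_def by simp
        show "halts_within grow s3 (200 * n) ?Q"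
          using halts_within_grow[OF fr03 fs3, of y] inv fl matched y unfolding s3s
          by (simp add: grow_inv_def \<delta>_def)
      qed
    qed
  qed
  then show ?thesis by (rule halts_within_weaken) auto
qed

end

text \<open>Every round labels one more column. Since slacks are updated instead of recomputed, a
  round takes linear time and the whole search quadratic time.\<close>

lemma halts_within_grow_loop:
  assumes n0: "nmem s0 ''n'' 0 0 = n" "n \<ge> 1" and X0: "wmat s0 ''X'' n X"
    and f0: "nmem s0 ''cu'' 0 = f" and g0: "nmem s0 ''cv'' 0 = g"
    and r: "rep n f g" and free: "card (edges_of n f) < n"
    and fs: "forest_state n X f g s0 \<alpha> \<beta> sl" and t: "nmem s0 ''t'' 0 0 = 1" "\<And>j. j \<in> {1..n} \<Longrightarrow> nmem s0 ''t'' 0 j = 0"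
  shows "halts_within grow_loop s0 (700 * (n * n)) (\<lambda>s. frame grow_names grow_wnames s0 s \<and>
    (\<exists>\<alpha> \<beta> sl. forest_state n X f g s \<alpha> \<beta> sl) \<and>
    nmem s ''y'' 0 0 \<in> {1..n} \<and> nmem s ''t'' 0 (nmem s ''y'' 0 0) \<noteq> 0 \<and> g (nmem s ''y'' 0 0) = 0 \<and>
    (\<forall>j\<le>n. nmem s ''t'' 0 j \<le> Suc n))" (is "halts_within _ _ _ ?Q")
proof -
  let ?b = "NEq (NVar ''fl'') (NConst 1)"
  let ?P = "Seq find_min (Seq shift_rows (Seq shift_cols grow))"
  let ?init = "Seq (NSet ''st'' (NConst 1)) (NSet ''fl'' (NConst 1))"
  define s1 where "s1 = run ?init s0"
  define F where "F = (\<lambda>s :: state. 630 * n * card {j\<in>{1..n}. nmem s ''t'' 0 j = 0})"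
  let ?inv = "grow_inv n X s0 f g"
  have s1: "nmem s1 ''t'' = nmem s0 ''t''" "nmem s1 ''p'' = nmem s0 ''p''" "nmem s1 ''st'' 0 0 = 1" "nmem s1 ''fl'' 0 0 = 1"
    "wmem s1 = wmem s0"
    by (auto simp: s1_def upd_apply fun_eq_iff)
  have "{j\<in>{1..n}. nmem s0 ''t'' 0 j = 0} = {1..n}" using t by auto
  then have card: "card {j\<in>{1..n}. nmem s0 ''t'' 0 j = 0} = n" by simp
  have fs1: "forest_state n X f g s1 \<alpha> \<beta> sl"
    using fs unfolding forest_state_def[OF n0 X0 f0 g0 r free] s1 warr_def by simp
  have fr1: "frame grow_names grow_wnames s0 s1"
    by (auto simp: s1_def frame_def upd_def grow_names_def)
  have le: "\<forall>j\<le>n. nmem s0 ''t'' 0 j \<le> 1"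
  proof (intro allI impI)
    fix j assume "j \<le> n"
    then show "nmem s0 ''t'' 0 j \<le> 1" using t(1) t(2)[of j] by (cases "j = 0") auto
  qed
  have inv1: "?inv s1"
    unfolding grow_inv_def[OF n0 X0 f0 g0 r free] s1 card using fs1 fr1 le t(2) by auto
  have "halts_within (While ?b ?P) s1 (F s1 + (1 + bcost ?b)) ?Q"
  proof (rule halts_within_While[where I = ?inv, OF inv1])
    fix s assume inv: "?inv s" and b: "bval ?b s"
    then have fl: "nmem s ''fl'' 0 0 = 1" by simp
    note step = halts_within_grow_step[OF n0 X0 f0 g0 r free inv fl]
    show "\<exists>T. halts_within ?P s T (\<lambda>s'. ?inv s' \<and> T + (1 + bcost ?b) + F s' \<le> F s)"
    proof (intro exI, rule halts_within_weaken[OF step order_refl])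
      fix s' assume s': "?inv s' \<and>
        Suc (card {j\<in>{1..n}. nmem s' ''t'' 0 j = 0}) = card {j\<in>{1..n}. nmem s ''t'' 0 j = 0}"
      then have "F s = 630 * n + F s'" unfolding F_def by (metis mult_Suc_right)
      then show "?inv s' \<and> 600 * n + (1 + bcost ?b) + F s' \<le> F s" using s' n0 by simp
    qed
  next
    fix s assume inv: "?inv s" and b: "\<not> bval ?b s"
    have "nmem s ''t'' 0 j \<le> Suc n" if "j \<le> n" for j
    proof -
      have "nmem s ''t'' 0 j \<le> nmem s ''st'' 0 0" "nmem s ''st'' 0 0 \<le> Suc n"
        using inv that unfolding grow_inv_def[OF n0 X0 f0 g0 r free] by auto
      then show ?thesis by simp
    qed
    then show "?Q s" using inv b unfolding grow_inv_def[OF n0 X0 f0 g0 r free] by simp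
  qed
  then have "halts_within grow_loop s0 (tm ?init + (F s1 + (1 + bcost ?b))) ?Q"
    unfolding grow_loop_def by (intro halts_within_Seq_straight) (simp_all add: s1_def)
  then show ?thesis
  proof (rule halts_within_weaken)
    define e where "e = n * n"
    have "1 * 1 \<le> e" unfolding e_def using n0 by (intro mult_le_mono) auto
    moreover have "F s1 = 630 * e" unfolding F_def s1 card e_def by simp
    ultimately show "tm ?init + (F s1 + (1 + bcost ?b)) \<le> 700 * (n * n)" unfolding e_def[symmetric] by simp
  qed
qed

section \<open>Augmenting along the parents\<close>

definition augment_body :: prog where
  "augment_body = Seq (NSet ''i'' (NArr ''p'' (NVar ''x'')))
    (Seq (NSet ''z'' (NArr ''cu'' (NVar ''i'')))
    (Seq (NSetArr ''cu'' (NVar ''i'') (NVar ''x''))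
    (Seq (NSetArr ''cv'' (NVar ''x'') (NVar ''i''))
    (Seq (NSetArr ''cv'' (NVar ''z'') (NConst 0))
      (NSet ''x'' (NVar ''z''))))))"

text \<open>At a root the released column is null: the final write to \<open>cv\<close> lands in
  cell 0, and the loop stops.\<close>

definition augment :: prog where
  "augment = Seq (NSet ''x'' (NVar ''y'')) (While (BNot (NEq (NVar ''x'') (NConst 0))) augment_body)"

lemma augment_names: "nwr augment = {''i'', ''z'', ''cu'', ''cv'', ''x''}" "wwr augment = {}"
  by (auto simp: augment_def augment_body_def)

text \<open>The label of the current column serves as the potential: it falls in every step and is
  at most \<open>n + 1\<close> at the beginning.\<close>

lemma halts_within_augment:
  assumes a: "augment_inv n X \<alpha> \<beta> (nmem s ''t'' 0) (nmem s ''p'' 0) m (nmem s ''cu'' 0) (nmem s ''cv'' 0) (nmem s ''y'' 0 0)"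
    and t: "nmem s ''t'' 0 (nmem s ''y'' 0 0) \<le> Suc n" and n: "n \<ge> 1"
  shows "halts_within augment s (300 * n) (\<lambda>s'. frame {''i'', ''z'', ''cu'', ''cv'', ''x''} {} s s' \<and>
    rep n (nmem s' ''cu'' 0) (nmem s' ''cv'' 0) \<and> dual_inv n X (nmem s' ''cu'' 0) (nmem s' ''cv'' 0) \<alpha> \<beta> \<and>
    card (edges_of n (nmem s' ''cu'' 0)) = m)" (is "halts_within _ _ _ ?Q")
proof -
  let ?b = "BNot (NEq (NVar ''x'') (NConst 0))"
  let ?t = "nmem s ''t'' 0" and ?p = "nmem s ''p'' 0"
  let ?fr = "frame {''i'', ''z'', ''cu'', ''cv'', ''x''} {} s"
  define I where "I = (\<lambda>s' :: state. ?fr s' \<and>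
    augment_inv n X \<alpha> \<beta> ?t ?p m (nmem s' ''cu'' 0) (nmem s' ''cv'' 0) (nmem s' ''x'' 0 0))"
  define F where "F = (\<lambda>s' :: state. 100 * ?t (nmem s' ''x'' 0 0))"
  define s1 where "s1 = run (NSet ''x'' (NVar ''y'')) s"
  have s1: "nmem s1 ''cu'' 0 = nmem s ''cu'' 0" "nmem s1 ''cv'' 0 = nmem s ''cv'' 0" "nmem s1 ''x'' 0 0 = nmem s ''y'' 0 0"
    by (auto simp: s1_def upd_apply fun_eq_iff)
  have "?fr s1" by (auto simp: s1_def frame_def upd_def)
  then have "I s1" using a unfolding I_def s1 by simp
  then have "halts_within (While ?b augment_body) s1 (F s1 + (1 + bcost ?b)) ?Q"
  proof (rule halts_within_While)
    fix s' assume I: "I s'" and b: "bval ?b s'"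
    let ?x = "nmem s' ''x'' 0 0" and ?f = "nmem s' ''cu'' 0" and ?g = "nmem s' ''cv'' 0"
    have fr: "?fr s'" and inv: "augment_inv n X \<alpha> \<beta> ?t ?p m ?f ?g ?x" using I by (auto simp: I_def)
    have x: "?x \<noteq> 0" using b by simp
    note step = augment_step[OF inv x]
    have p: "nmem s' ''p'' = nmem s ''p''" using frame_nmem[OF fr] by simp
    define s'' where "s'' = run augment_body s'"
    have s'': "nmem s'' ''cu'' 0 = ?f(?p ?x := ?x)" "nmem s'' ''cv'' 0 = ?g(?x := ?p ?x, ?f (?p ?x) := 0)"
      "nmem s'' ''x'' 0 0 = ?f (?p ?x)"
      using p step(3) by (auto simp: s''_def augment_body_def upd_apply fun_eq_iff)
    have "?fr s''"
      by (rule frame_trans[OF fr]) (auto simp: s''_def augment_body_def frame_def upd_def)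
    then have "I s''" using step(1) unfolding I_def s'' by simp
    moreover have "100 + F s'' \<le> F s'" using step(2) unfolding F_def s'' by simp
    ultimately have "halts_within augment_body s' 70 (\<lambda>s''. I s'' \<and> 70 + (1 + bcost ?b) + F s'' \<le> F s')"
      by (intro halts_within_straight) (simp_all add: augment_body_def s''_def)
    then show "\<exists>T. halts_within augment_body s' T (\<lambda>s''. I s'' \<and> T + (1 + bcost ?b) + F s'' \<le> F s')" by blast
  next
    fix s' assume I: "I s'" and b: "\<not> bval ?b s'"
    then have "augment_inv n X \<alpha> \<beta> ?t ?p m (nmem s' ''cu'' 0) (nmem s' ''cv'' 0) 0" by (simp add: I_def)
    from augment_end[OF this] I show "?Q s'" by (simp add: I_def)
  qed
  then have "halts_within augment s (tm (NSet ''x'' (NVar ''y'')) + (F s1 + (1 + bcost ?b))) ?Q"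
    unfolding augment_def by (intro halts_within_Seq_straight) (simp_all add: s1_def)
  then show ?thesis
    by (rule halts_within_weaken) (use t n in \<open>auto simp: F_def s1\<close>)
qed

section \<open>One phase: from one cardinality to the next\<close>

definition phase :: prog where
  "phase = Seq start (Seq grow_loop (Seq augment emit))"

definition phase_names :: "name set" where
  "phase_names = {''i'', ''j'', ''p'', ''r'', ''y'', ''t'', ''st'', ''fl'', ''z'', ''cu'', ''cv'', ''x'', ''outu'', ''outv'', ''out''}"

lemma phase_names: "nwr phase = phase_names" "wwr phase = {''al'', ''be'', ''sl'', ''d''}"
  by (auto simp: phase_def start_names grow_loop_names augment_names phase_names_def grow_names_def grow_wnames_def)

text \<open>Nothing is said about the forest, which every phase rebuilds; only the matching and the
  potentials survive.\<close>

definition phase_inv :: "nat \<Rightarrow> (nat \<Rightarrow> nat \<Rightarrow> maxplus) \<Rightarrow> nat \<Rightarrow> state \<Rightarrow> bool" where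
  "phase_inv n W m s \<longleftrightarrow> nmem s ''n'' 0 0 = n \<and> wmat s ''X'' n (real_weight n W) \<and>
    rep n (nmem s ''cu'' 0) (nmem s ''cv'' 0) \<and> card (edges_of n (nmem s ''cu'' 0)) = m \<and>
    (\<exists>\<alpha> \<beta>. warr s ''al'' n \<alpha> \<and> warr s ''be'' n \<beta> \<and>
      dual_inv n (real_weight n W) (nmem s ''cu'' 0) (nmem s ''cv'' 0) \<alpha> \<beta>) \<and>
    outputs_assignments n W {1..m} s"

lemma halts_within_phase:
  assumes inv: "phase_inv n W m s" and m: "m < n" and kk: "nmem s ''kk'' 0 0 = Suc m"
  shows "halts_within phase s (1500 * (n * n)) (phase_inv n W (Suc m))"
proof -
  let ?X = "real_weight n W"
  define f where "f = nmem s ''cu'' 0"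
  define g where "g = nmem s ''cv'' 0"
  have n: "n \<ge> 1" using m by simp
  obtain \<alpha> \<beta> where ns: "nmem s ''n'' 0 0 = n" and X: "wmat s ''X'' n ?X" and r: "rep n f g"
    and card: "card (edges_of n f) = m" and w: "warr s ''al'' n \<alpha>" "warr s ''be'' n \<beta>"
    and d: "dual_inv n ?X f g \<alpha> \<beta>" and out: "outputs_assignments n W {1..m} s"
    using inv unfolding phase_inv_def f_def g_def by blast
  have free: "card (edges_of n f) < n" using card m by simp
  have ex: "\<exists>i\<in>{1..n}. nmem s ''cu'' 0 i = 0" using ex_free[OF r free] by (simp add: f_def)
  have fle: "nmem s ''cu'' 0 i \<le> n" if "i \<in> {1..n}" for i using r that by (auto simp: rep_def f_def)
  have "halts_within phase s (400 * (n * n) + (700 * (n * n) + (300 * n + 60 * n))) (phase_inv n W (Suc m))"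
    unfolding phase_def
  proof (rule halts_within_Seq[OF halts_within_start[OF ns n X w ex fle]])
    fix s1 assume s1: "frame (nwr start) (wwr start) s s1 \<and>
      nmem s1 ''t'' 0 0 = 1 \<and> (\<forall>j\<in>{1..n}. nmem s1 ''t'' 0 j = 0) \<and>
      (\<exists>sl. warr s1 ''sl'' n sl \<and> forest_inv n ?X (nmem s ''cu'' 0) \<alpha> \<beta> (nmem s1 ''t'' 0) (nmem s1 ''p'' 0) sl)"
    then obtain sl where sl: "warr s1 ''sl'' n sl" "forest_inv n ?X f \<alpha> \<beta> (nmem s1 ''t'' 0) (nmem s1 ''p'' 0) sl"
      by (auto simp: f_def)
    have fr1: "frame (nwr start) (wwr start) s s1" using s1 by simp
    have s1s: "nmem s1 ''n'' 0 0 = n" "nmem s1 ''cu'' 0 = f" "nmem s1 ''cv'' 0 = g" "wmem s1 ''al'' = wmem s ''al''"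
      "wmem s1 ''be'' = wmem s ''be''" "wmem s1 ''X'' = wmem s ''X''" "nmem s1 ''kk'' 0 0 = Suc m"
      "nmem s1 ''out'' = nmem s ''out''" "nmem s1 ''outu'' = nmem s ''outu''" "nmem s1 ''outv'' = nmem s ''outv''"
      using frame_nmem[OF fr1] frame_wmem[OF fr1] ns kk by (auto simp: start_names f_def g_def)
    have X1: "wmat s1 ''X'' n ?X" using X unfolding wmat_def s1s .
    have fs: "forest_state n ?X f g s1 \<alpha> \<beta> sl"
      unfolding forest_state_def[OF s1s(1) n X1 s1s(2,3) r free] using sl w d unfolding warr_def s1s by simp
    have t1: "nmem s1 ''t'' 0 0 = 1" "\<And>j. j \<in> {1..n} \<Longrightarrow> nmem s1 ''t'' 0 j = 0" using s1 by auto
    show "halts_within (Seq grow_loop (Seq augment emit)) s1 (700 * (n * n) + (300 * n + 60 * n)) (phase_inv n W (Suc m))"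
    proof (rule halts_within_Seq[OF halts_within_grow_loop[OF s1s(1) n X1 s1s(2,3) r free fs t1]])
      fix s2 assume s2: "frame grow_names grow_wnames s1 s2 \<and>
        (\<exists>\<alpha> \<beta> sl. forest_state n ?X f g s2 \<alpha> \<beta> sl) \<and>
        nmem s2 ''y'' 0 0 \<in> {1..n} \<and> nmem s2 ''t'' 0 (nmem s2 ''y'' 0 0) \<noteq> 0 \<and> g (nmem s2 ''y'' 0 0) = 0 \<and>
        (\<forall>j\<le>n. nmem s2 ''t'' 0 j \<le> Suc n)"
      then obtain \<alpha>2 \<beta>2 sl2 where fs2: "forest_state n ?X f g s2 \<alpha>2 \<beta>2 sl2" by blast
      then have w2: "warr s2 ''al'' n \<alpha>2" "warr s2 ''be'' n \<beta>2" "dual_inv n ?X f g \<alpha>2 \<beta>2"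
        "forest_inv n ?X f \<alpha>2 \<beta>2 (nmem s2 ''t'' 0) (nmem s2 ''p'' 0) sl2"
        unfolding forest_state_def[OF s1s(1) n X1 s1s(2,3) r free] by auto
      have fr2: "frame grow_names grow_wnames s1 s2" using s2 by simp
      have s2s: "nmem s2 ''n'' 0 0 = n" "nmem s2 ''cu'' 0 = f" "nmem s2 ''cv'' 0 = g"
        "wmem s2 ''X'' = wmem s ''X''" "nmem s2 ''kk'' 0 0 = Suc m"
        "nmem s2 ''out'' = nmem s ''out''" "nmem s2 ''outu'' = nmem s ''outu''" "nmem s2 ''outv'' = nmem s ''outv''"
        using frame_nmem[OF fr2] frame_wmem[OF fr2] s1s by (auto simp: grow_names_def grow_wnames_def)
      have aug: "augment_inv n ?X \<alpha>2 \<beta>2 (nmem s2 ''t'' 0) (nmem s2 ''p'' 0) (Suc m) (nmem s2 ''cu'' 0)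
          (nmem s2 ''cv'' 0) (nmem s2 ''y'' 0 0)"
        unfolding s2s by (rule augment_start[OF r w2(3,4)]) (use s2 card in auto)
      have ty: "nmem s2 ''t'' 0 (nmem s2 ''y'' 0 0) \<le> Suc n" using s2 by auto
      show "halts_within (Seq augment emit) s2 (300 * n + 60 * n) (phase_inv n W (Suc m))"
      proof (rule halts_within_Seq[OF halts_within_augment[OF aug ty n]])
        fix s3 :: state let ?f = "nmem s3 ''cu'' 0" and ?g = "nmem s3 ''cv'' 0"
        assume s3: "frame {''i'', ''z'', ''cu'', ''cv'', ''x''} {} s2 s3 \<and>
          rep n ?f ?g \<and> dual_inv n ?X ?f ?g \<alpha>2 \<beta>2 \<and> card (edges_of n ?f) = Suc m"
        then have fr3: "frame {''i'', ''z'', ''cu'', ''cv'', ''x''} {} s2 s3" and r3: "rep n ?f ?g"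
          and d3: "dual_inv n ?X ?f ?g \<alpha>2 \<beta>2" and card3: "card (edges_of n ?f) = Suc m" by auto
        have s3s: "nmem s3 ''n'' 0 0 = n" "wmem s3 = wmem s2" "nmem s3 ''kk'' 0 0 = Suc m"
          "nmem s3 ''out'' = nmem s ''out''" "nmem s3 ''outu'' = nmem s ''outu''" "nmem s3 ''outv'' = nmem s ''outv''"
          using frame_nmem[OF fr3] frame_wmem[OF fr3] s2s by auto
        \<comment> \<open>The potentials left by the search still certify the augmented matching,
          because augmentation changes only tight edges; no comparison with the preceding assignment
          is needed.\<close>
        have ass: "is_assignment n W (nmem s3 ''kk'' 0 0) (edges_of n ?f)"
          using is_assignment_real_weight[OF rep_matching[OF r3] dual_inv_optimal[OF r3 d3]] card3 s3s by simp
        have out3: "outputs_assignments n W {1..m} s3"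
          using out outputs_assignments_cong[OF s3s(4,5,6)] by simp
        show "halts_within emit s3 (60 * n) (phase_inv n W (Suc m))"
        proof (rule halts_within_weaken[OF halts_within_emit[OF s3s(1) n out3 r3 ass] order_refl])
          fix s4 assume s4: "outputs_assignments n W (insert (nmem s3 ''kk'' 0 0) {1..m}) s4 \<and> frame (nwr emit) {} s3 s4"
          then have fr4: "frame (nwr emit) {} s3 s4" by simp
          have s4s: "nmem s4 ''n'' 0 0 = n" "nmem s4 ''cu'' = nmem s3 ''cu''" "nmem s4 ''cv'' = nmem s3 ''cv''"
            "wmem s4 = wmem s2"
            using frame_nmem[OF fr4] frame_wmem[OF fr4] s3s by auto
          have "insert (nmem s3 ''kk'' 0 0) {1..m} = {1..Suc m}" using s3s by auto
          then show "phase_inv n W (Suc m) s4"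
            unfolding phase_inv_def s4s using s4 X r3 card3 d3 w2(1,2)
            by (auto simp: s4s s2s wmat_def warr_def)
        qed
      qed
    qed
  qed
  then show ?thesis
  proof (rule halts_within_weaken)
    have "n * 1 \<le> n * n" using n by (intro mult_left_mono) auto
    then show "400 * (n * n) + (700 * (n * n) + (300 * n + 60 * n)) \<le> 1500 * (n * n)" by simp
  qed
qed

section \<open>Finite weights and the initial potentials\<close>

abbreviation W_exp :: wexp where
  "W_exp \<equiv> WRead ''W'' (NVar ''i'') (NVar ''j'')"

definition total_body :: prog where
  "total_body = Cond (WEq W_exp WNegInf) Skip
    (Cond (WLess W_exp (WInt 0))
      (WSet ''T'' (WMinus (WVar ''T'') W_exp))
      (WSet ''T'' (WPlus (WVar ''T'') W_exp)))"

definition total :: prog where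
  "total = For ''i'' (For ''j'' total_body)"

definition copy_body :: prog where
  "copy_body = Cond (WEq W_exp WNegInf)
    (WWrite ''X'' (NVar ''i'') (NVar ''j'') (WMinus (WInt (- 1)) (WPlus (WVar ''T'') (WVar ''T''))))
    (WWrite ''X'' (NVar ''i'') (NVar ''j'') W_exp)"

definition copy :: prog where
  "copy = For ''i'' (For ''j'' copy_body)"

text \<open>All rows are free at first, so their potentials must be equal. \<open>T\<close>
  dominates every modified weight, which makes the columns feasible with the potential 0 that they
  have in the initial memory.\<close>

definition init_rows :: prog where
  "init_rows = For ''i'' (WSetArr ''al'' (NVar ''i'') (WVar ''T''))"

definition hungarian :: prog where
  "hungarian = Seq total (Seq copy (Seq init_rows (For ''kk'' phase)))"

lemma setup_names: "nwr total_body = {}" "wwr total_body = {''T''}" "nwr total = {''i'', ''j''}" "wwr total = {''T''}"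
  "nwr copy_body = {}" "wwr copy_body = {''X''}" "nwr copy = {''i'', ''j''}" "wwr copy = {''X''}"
  by (auto simp: total_def total_body_def copy_def copy_body_def)

lemma halts_within_total:
  assumes n: "nmem s ''n'' 0 0 = n" "n \<ge> 1" and T: "wmem s ''T'' 0 0 = 0"
    and W: "\<And>i j. i \<in> {1..n} \<Longrightarrow> j \<in> {1..n} \<Longrightarrow> wmem s ''W'' i j = val (W i j)"
  shows "halts_within total s (200 * (n * n))
    (\<lambda>s'. frame {''i'', ''j''} {''T''} s s' \<and> wmem s' ''T'' 0 0 = ereal (total_weight n W))"
proof -
  let ?a = "abs_weight W"
  define I where "I = (\<lambda>(i :: nat) (s' :: state). wmem s' ''T'' 0 0 = ereal (\<Sum>a\<in>{1..<i}. \<Sum>b\<in>{1..n}. ?a a b))"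
  have "halts_within total s (((100 + 30) * n + 30) * n)
    (\<lambda>s'. I (Suc n) s' \<and>
      frame (insert ''i'' (nwr (For ''j'' total_body))) (wwr (For ''j'' total_body)) s s')"
    unfolding total_def
  proof (rule halts_within_For[OF n])
    show "I 1 (set_n s ''i'' 1)" using T by (simp add: I_def)
    fix i s1 assume i: "1 \<le> i" "i \<le> n"
      and fr1: "frame (insert ''i'' (nwr (For ''j'' total_body))) (wwr (For ''j'' total_body)) s s1"
      and ii: "nmem s1 ''i'' 0 0 = i" and n1: "nmem s1 ''n'' 0 0 = n" and I: "I i s1"
    define J where "J = (\<lambda>(j :: nat) (s' :: state). wmem s' ''T'' 0 0 =
      ereal ((\<Sum>a\<in>{1..<i}. \<Sum>b\<in>{1..n}. ?a a b) + (\<Sum>b\<in>{1..<j}. ?a i b)))"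
    have "halts_within (For ''j'' total_body) s1 ((100 + 30) * n)
      (\<lambda>s'. J (Suc n) s' \<and> frame (insert ''j'' (nwr total_body)) (wwr total_body) s1 s')"
    proof (rule halts_within_For[OF n1 n(2)])
      show "J 1 (set_n s1 ''j'' 1)" using I by (simp add: I_def J_def)
      fix j s2 assume j: "1 \<le> j" "j \<le> n" and fr2: "frame (insert ''j'' (nwr total_body)) (wwr total_body) s1 s2"
        and jj: "nmem s2 ''j'' 0 0 = j" and J: "J j s2"
      have "wmem s2 ''W'' = wmem s ''W''" "nmem s2 ''i'' = nmem s1 ''i''"
        using frame_wmem[OF fr1, of "''W''"] frame_wmem[OF fr2, of "''W''"] frame_nmem[OF fr2, of "''i''"]
        by (auto simp: setup_names)
      then have Wij: "wval W_exp s2 = val (W i j)" using W[of i j] i j ii jj by simp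
      define S where "S = (\<Sum>a\<in>{1..<i}. \<Sum>b\<in>{1..n}. ?a a b) + (\<Sum>b\<in>{1..<j}. ?a i b)"
      have T2: "wmem s2 ''T'' 0 0 = ereal S" using J by (simp add: J_def S_def)
      have "wmem (run total_body s2) ''T'' 0 0 = ereal (S + ?a i j)"
      proof (cases "val (W i j)")
        case (real x)
        then show ?thesis using Wij T2 by (auto simp: total_body_def abs_weight_def upd_apply)
      next
        case PInf
        then show ?thesis using val_neq_infinity by blast
      next
        case MInf
        then show ?thesis using Wij T2 by (auto simp: total_body_def abs_weight_def upd_apply)
      qed
      moreover have "S + ?a i j = (\<Sum>a\<in>{1..<i}. \<Sum>b\<in>{1..n}. ?a a b) + (\<Sum>b\<in>{1..<Suc j}. ?a i b)"
        using j by (simp add: S_def atLeastLessThanSuc add.commute)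
      ultimately show "halts_within total_body s2 100 (\<lambda>s'. J (Suc j) (set_n s' ''j'' (Suc j)))"
        by (intro halts_within_straight) (simp_all add: J_def, simp_all add: total_body_def)
    qed (auto simp: setup_names)
    then show "halts_within (For ''j'' total_body) s1 ((100 + 30) * n) (\<lambda>s'. I (Suc i) (set_n s' ''i'' (Suc i)))"
    proof (rule halts_within_weaken)
      fix s' assume "J (Suc n) s' \<and> frame (insert ''j'' (nwr total_body)) (wwr total_body) s1 s'"
      then show "I (Suc i) (set_n s' ''i'' (Suc i))"
        using i atLeastLessThanSuc[of 1 i] unfolding I_def J_def atLeastLessThanSuc_atLeastAtMost
        by (simp add: add.commute)
    qed simp
  qed (auto simp: setup_names)
  then show ?thesis
  proof (rule halts_within_weaken)
    have "n * 1 \<le> n * n" using n by (intro mult_left_mono) auto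
    then show "((100 + 30) * n + 30) * n \<le> 200 * (n * n)" by (simp add: algebra_simps)
  qed (simp add: I_def total_weight_def setup_names atLeastLessThanSuc_atLeastAtMost)
qed

lemma halts_within_copy:
  assumes n: "nmem s ''n'' 0 0 = n" "n \<ge> 1" and T: "wmem s ''T'' 0 0 = ereal (total_weight n W)"
    and W: "\<And>i j. i \<in> {1..n} \<Longrightarrow> j \<in> {1..n} \<Longrightarrow> wmem s ''W'' i j = val (W i j)"
  shows "halts_within copy s (200 * (n * n))
    (\<lambda>s'. frame {''i'', ''j''} {''X''} s s' \<and> wmat s' ''X'' n (real_weight n W))"
proof -
  let ?X = "real_weight n W"
  define I where "I = (\<lambda>(i :: nat) (s' :: state). \<forall>a\<in>{1..n}. \<forall>b\<in>{1..n}. a < i \<longrightarrow> wmem s' ''X'' a b = ereal (?X a b))"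
  have "halts_within copy s (((100 + 30) * n + 30) * n)
    (\<lambda>s'. I (Suc n) s' \<and>
      frame (insert ''i'' (nwr (For ''j'' copy_body))) (wwr (For ''j'' copy_body)) s s')"
    unfolding copy_def
  proof (rule halts_within_For[OF n])
    show "I 1 (set_n s ''i'' 1)" by (simp add: I_def)
    fix i s1 assume i: "1 \<le> i" "i \<le> n"
      and fr1: "frame (insert ''i'' (nwr (For ''j'' copy_body))) (wwr (For ''j'' copy_body)) s s1"
      and ii: "nmem s1 ''i'' 0 0 = i" and n1: "nmem s1 ''n'' 0 0 = n" and I: "I i s1"
    define J where "J = (\<lambda>(j :: nat) (s' :: state). I i s' \<and> (\<forall>b\<in>{1..n}. b < j \<longrightarrow> wmem s' ''X'' i b = ereal (?X i b)))"
    have "halts_within (For ''j'' copy_body) s1 ((100 + 30) * n)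
      (\<lambda>s'. J (Suc n) s' \<and> frame (insert ''j'' (nwr copy_body)) (wwr copy_body) s1 s')"
    proof (rule halts_within_For[OF n1 n(2)])
      show "J 1 (set_n s1 ''j'' 1)" using I by (simp add: I_def J_def)
      fix j s2 assume j: "1 \<le> j" "j \<le> n" and fr2: "frame (insert ''j'' (nwr copy_body)) (wwr copy_body) s1 s2"
        and jj: "nmem s2 ''j'' 0 0 = j" and J: "J j s2"
      have same: "wmem s2 ''W'' = wmem s ''W''" "nmem s2 ''i'' = nmem s1 ''i''" "wmem s2 ''T'' = wmem s ''T''"
        using frame_wmem[OF fr1, of "''W''"] frame_wmem[OF fr2, of "''W''"] frame_nmem[OF fr2, of "''i''"]
          frame_wmem[OF fr1, of "''T''"] frame_wmem[OF fr2, of "''T''"]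
        by (auto simp: setup_names)
      then have Wij: "wval W_exp s2 = val (W i j)" using W[of i j] i j ii jj by simp
      have new: "wmem (run copy_body s2) ''X'' a b = (if a = i \<and> b = j then ereal (?X i j) else wmem s2 ''X'' a b)" for a b
      proof (cases "val (W i j)")
        case (real x)
        then show ?thesis using Wij same ii jj by (auto simp: copy_body_def real_weight_def upd_apply)
      next
        case PInf
        then show ?thesis using val_neq_infinity by blast
      next
        case MInf
        then show ?thesis using Wij same ii jj T by (auto simp: copy_body_def real_weight_def upd_apply)
      qed
      show "halts_within copy_body s2 100 (\<lambda>s'. J (Suc j) (set_n s' ''j'' (Suc j)))"
        by (intro halts_within_straight)
          (use J new in \<open>simp_all add: J_def I_def less_Suc_eq del: run.simps\<close>, simp_all add: copy_body_def)
    qed (auto simp: setup_names)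
    then show "halts_within (For ''j'' copy_body) s1 ((100 + 30) * n) (\<lambda>s'. I (Suc i) (set_n s' ''i'' (Suc i)))"
      by (rule halts_within_weaken) (auto simp: I_def J_def less_Suc_eq)
  qed (auto simp: setup_names)
  then show ?thesis
  proof (rule halts_within_weaken)
    have "n * 1 \<le> n * n" using n by (intro mult_left_mono) auto
    then show "((100 + 30) * n + 30) * n \<le> 200 * (n * n)" by (simp add: algebra_simps)
  qed (auto simp: I_def wmat_def setup_names)
qed

lemma halts_within_init_rows:
  assumes n: "nmem s ''n'' 0 0 = n" "n \<ge> 1" and T: "wmem s ''T'' 0 0 = ereal T"
  shows "halts_within init_rows s (50 * n) (\<lambda>s'. frame {''i''} {''al''} s s' \<and> warr s' ''al'' n (\<lambda>_. T))"
proof -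
  let ?P = "WSetArr ''al'' (NVar ''i'') (WVar ''T'')"
  define I where "I = (\<lambda>(i :: nat) (s' :: state). \<forall>a\<in>{1..n}. a < i \<longrightarrow> wmem s' ''al'' 0 a = ereal T)"
  have "halts_within init_rows s ((20 + 30) * n)
    (\<lambda>s'. I (Suc n) s' \<and> frame (insert ''i'' (nwr ?P)) (wwr ?P) s s')"
    unfolding init_rows_def
  proof (rule halts_within_For[OF n])
    show "I 1 (set_n s ''i'' 1)" by (simp add: I_def)
    fix i s' assume i: "1 \<le> i" "i \<le> n" and fr: "frame (insert ''i'' (nwr ?P)) (wwr ?P) s s'"
      and ii: "nmem s' ''i'' 0 0 = i" and I: "I i s'"
    have "wmem s' ''T'' = wmem s ''T''" using frame_wmem[OF fr] by simp
    then show "halts_within ?P s' 20 (\<lambda>s''. I (Suc i) (set_n s'' ''i'' (Suc i)))"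
      by (intro halts_within_straight) (use I ii T in \<open>auto simp: I_def upd_apply less_Suc_eq\<close>)
  qed auto
  then show ?thesis
    by (rule halts_within_weaken) (auto simp: I_def warr_def)
qed

lemma halts_within_hungarian:
  assumes n: "n \<ge> 1"
  shows "halts_within hungarian (input_state n W []) (3000 * n ^ 3) (outputs_assignments n W {1..n})"
proof -
  let ?s = "input_state n W []" and ?X = "real_weight n W" and ?T = "total_weight n W"
  have ns: "nmem ?s ''n'' 0 0 = n" by (simp add: input_state_def scalar_def)
  have Ts: "wmem ?s ''T'' 0 0 = 0" by (simp add: input_state_def)
  have Ws: "wmem ?s ''W'' i j = val (W i j)" if "i \<in> {1..n}" "j \<in> {1..n}" for i j
    using that by (simp add: input_state_def)
  have "halts_within hungarian ?s (200 * (n * n) + (200 * (n * n) + (50 * n + (1500 * (n * n) + 30) * n)))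
    (outputs_assignments n W {1..n})"
    unfolding hungarian_def
  proof (rule halts_within_Seq[OF halts_within_total[OF ns n Ts Ws]])
    fix s1 assume s1: "frame {''i'', ''j''} {''T''} ?s s1 \<and> wmem s1 ''T'' 0 0 = ereal ?T"
    then have fr1: "frame {''i'', ''j''} {''T''} ?s s1" and T1: "wmem s1 ''T'' 0 0 = ereal ?T" by auto
    have s1s: "nmem s1 ''n'' 0 0 = n" "wmem s1 ''W'' = wmem ?s ''W''"
      using frame_nmem[OF fr1] frame_wmem[OF fr1] ns by auto
    have W1: "wmem s1 ''W'' i j = val (W i j)" if "i \<in> {1..n}" "j \<in> {1..n}" for i j
      using Ws[OF that] s1s by simp
    show "halts_within (Seq copy (Seq init_rows (For ''kk'' phase))) s1
      (200 * (n * n) + (50 * n + (1500 * (n * n) + 30) * n)) (outputs_assignments n W {1..n})"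
    proof (rule halts_within_Seq[OF halts_within_copy[OF s1s(1) n T1 W1]])
      fix s2 assume s2: "frame {''i'', ''j''} {''X''} s1 s2 \<and> wmat s2 ''X'' n ?X"
      then have fr2: "frame {''i'', ''j''} {''X''} s1 s2" by simp
      have s2s: "nmem s2 ''n'' 0 0 = n" "wmem s2 ''T'' 0 0 = ereal ?T"
        using frame_nmem[OF fr2] frame_wmem[OF fr2] s1s T1 by auto
      show "halts_within (Seq init_rows (For ''kk'' phase)) s2 (50 * n + (1500 * (n * n) + 30) * n)
        (outputs_assignments n W {1..n})"
      proof (rule halts_within_Seq[OF halts_within_init_rows[OF s2s(1) n s2s(2)]])
        fix s3 assume s3: "frame {''i''} {''al''} s2 s3 \<and> warr s3 ''al'' n (\<lambda>_. ?T)"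
        then have fr3: "frame {''i''} {''al''} s2 s3" by simp
        have z: "nmem ?s ''cu'' = (\<lambda>_ _. 0)" "nmem ?s ''cv'' = (\<lambda>_ _. 0)" "nmem ?s ''out'' = (\<lambda>_ _. 0)"
          "wmem ?s ''be'' = (\<lambda>_ _. 0)"
          by (auto simp: input_state_def)
        have s3s: "nmem s3 ''n'' 0 0 = n" "nmem s3 ''cu'' = (\<lambda>_ _. 0)" "nmem s3 ''cv'' = (\<lambda>_ _. 0)"
          "nmem s3 ''out'' = (\<lambda>_ _. 0)" "wmem s3 ''be'' = (\<lambda>_ _. 0)" "wmem s3 ''X'' = wmem s2 ''X''"
          using frame_nmem[OF fr3] frame_wmem[OF fr3] frame_nmem[OF fr2] frame_wmem[OF fr2]
            frame_nmem[OF fr1] frame_wmem[OF fr1] z s2s by auto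
        have "dual_inv n ?X (\<lambda>_. 0) (\<lambda>_. 0) (\<lambda>_. ?T) (\<lambda>_. 0)"
          using real_weight_le_total by (simp add: dual_inv_def)
        moreover have "warr s3 ''be'' n (\<lambda>_. 0)" unfolding warr_def s3s by simp
        moreover have "rep n (\<lambda>_. 0) (\<lambda>_. 0)" by (simp add: rep_def)
        moreover have "edges_of n (\<lambda>_. 0) = {}" by (auto simp: edges_of_def)
        moreover have "outputs_assignments n W {1..0} s3" unfolding outputs_assignments_def s3s by simp
        moreover have "wmat s3 ''X'' n ?X" using s2 unfolding wmat_def s3s by simp
        ultimately have inv: "phase_inv n W 0 s3"
          unfolding phase_inv_def s3s using s3 by auto
        have set_kk: "phase_inv n W m (set_n s ''kk'' v) = phase_inv n W m s" for m s v
          unfolding phase_inv_def wmat_def warr_def outputs_assignments_def by simp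
        \<comment> \<open>The counter is the size that the phase is about to reach, so at counter
          value \<open>i\<close> the invariant speaks of \<open>i - 1\<close> edges.\<close>
        have "halts_within (For ''kk'' phase) s3 ((1500 * (n * n) + 30) * n)
          (\<lambda>s. phase_inv n W (Suc n - 1) s \<and>
            frame (insert ''kk'' (nwr phase)) (wwr phase) s3 s)"
        proof (rule halts_within_For[OF s3s(1) n])
          show "phase_inv n W (1 - 1) (set_n s3 ''kk'' 1)" using inv set_kk by simp
          fix i s assume i: "1 \<le> i" "i \<le> n" and kk: "nmem s ''kk'' 0 0 = i" and inv: "phase_inv n W (i - 1) s"
          then show "halts_within phase s (1500 * (n * n)) (\<lambda>s'. phase_inv n W (Suc i - 1) (set_n s' ''kk'' (Suc i)))"
            using halts_within_phase[OF inv] by (simp add: set_kk)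
        qed (auto simp: phase_names phase_names_def)
        then show "halts_within (For ''kk'' phase) s3 ((1500 * (n * n) + 30) * n) (outputs_assignments n W {1..n})"
          by (rule halts_within_weaken) (auto simp: phase_inv_def)
      qed
    qed
  qed
  then show ?thesis
  proof (rule halts_within_weaken)
    define a b where "a = n * n * n" and "b = n * n"
    have "b * 1 \<le> a" "n * 1 \<le> b" unfolding a_def b_def using n by (intro mult_left_mono; simp)+
    moreover have "(1500 * b + 30) * n = 1500 * a + 30 * n" "n ^ 3 = a"
      by (simp_all add: a_def b_def power3_eq_cube algebra_simps)
    ultimately show "200 * (n * n) + (200 * (n * n) + (50 * n + (1500 * (n * n) + 30) * n)) \<le> 3000 * n ^ 3"
      unfolding b_def[symmetric] by simp
  qed
qed

theorem mainTheorem2: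
  shows
    "(\<exists>(P :: prog) (C :: nat). \<forall>(n :: nat) (W :: nat \<Rightarrow> nat \<Rightarrow> maxplus) (L :: (nat \<times> edges) list).
        n \<ge> 1 \<and> L \<noteq> [] \<and> fst (hd L) = 0 \<and> sorted_wrt (<) (map fst L) \<and> fst (last L) \<le> n \<and>
        (\<forall>(k, M)\<in>set L. is_assignment n W k M) \<and>
        (\<forall>k\<le>n. essential (full_char_maxpoly n W) (n - k) \<longrightarrow> k \<in> fst ` set L) \<and>
        (\<forall>k\<in>fst ` set L. essential (full_char_maxpoly n W) (n - k) \<or>
                           semi_essential (full_char_maxpoly n W) (n - k))
        \<longrightarrow> halts_within P (input_state n W L) (C * n ^ 2)
              (outputs_assignments n W
                {m. m \<le> n \<and> semi_essential (full_char_maxpoly n W) (n - m) \<and> m \<notin> fst ` set L}))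
     \<and>
     (\<exists>(P :: prog) (C :: nat). \<forall>(n :: nat) (W :: nat \<Rightarrow> nat \<Rightarrow> maxplus) (k :: nat) (d :: nat)
          (M :: edges) (M' :: edges).
        n \<ge> 1 \<and> d > 1 \<and> is_assignment n W k M \<and> is_assignment n W (k + d) M' \<and>
        adjacent_terms (full_char_maxpoly n W) (n - k) (n - (k + d))
        \<longrightarrow> halts_within P (input_state n W [(k, M), (k + d, M')]) (C * (d * n))
              (outputs_assignments n W {k + i | i. 1 \<le> i \<and> i \<le> d - 1}))
     \<and>
     (\<exists>(P :: prog) (C :: nat). \<forall>(n :: nat) (W :: nat \<Rightarrow> nat \<Rightarrow> maxplus).
        n \<ge> 1
        \<longrightarrow> halts_within P (input_state n W []) (C * n ^ 3)
              (outputs_assignments n W {1..n}))"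
proof (intro conjI, goal_cases)
  case 1
  show ?case
    by (rule exI[of _ fill_gaps], rule exI[of _ 520], intro allI impI, elim conjE)
      (rule halts_within_fill_gaps_all)
next
  case 2
  show ?case using halts_within_fill_gaps_pair by blast
next
  case 3
  show ?case using halts_within_hungarian by blast
qed

end
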